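(* Let $G$ be a finite connected simple (bioriented) graph. The vector space $A=End^{gr}(\mathcal{E})=\bigoplus_n \mathcal{E}_n\otimes\mathcal{E}_n$ of length-graded endomorphisms of essential paths on $G$ is a weak $*$-Hopf algebra with the following structure (for $\xi,\xi'\in\mathcal{E}_n$, $\rho,\rho'\in\mathcal{E}_m$): - product $(\xi\otimes\xi')\cdot(\rho\otimes\rho')=P(\xi\star\rho\otimes\xi'\star\rho')$ and unit $\mathbf 1=\sum_{v,v'}v\otimes v'$ (sum over all pairs of vertices, i.e. length-zero paths); - star $(\xi\otimes\xi')^\star=\xi^\star\otimes\xi'^\star$; - coproduct $\Delta(\xi\otimes\xi')=\sum_{a}\,(\xi\otimes\xi_a)\boxtimes(\xi_a\otimes\xi')$, the sum running over an orthonormal basis $\{\xi_a\}$ of $\mathcal{E}_n$; - counit $\epsilon(\xi\otimes\xi')=(\xi,\xi')$; - antipode $S(\xi\otimes\omega)=\sqrt{\dfrac{\mu_{s(\omega)}\mu_{r(\xi)}}{\mu_{r(\omega)}\mu_{s(\xi)}}}\;\omega^\star\otimes\xi^\star$ for $\xi,\omega\in\mathcal{E}_n$ having definite starting vertices $s(\cdot)$ and ending vertices $r(\cdot)$, extended linearly. Explicitly: the product is associative with unit $\mathbf 1$; the star is an antilinear involution with $(a\cdot b)^\star=b^\star\cdot a^\star$; and for all $a,b\in A$, $$\Delta(ab)=\Delta(a)\Delta(b),\quad \Delta(a^\star)=\Delta(a)^\star,\quad (\Delta\otimes Id)\Delta=(Id\otimes\Delta)\Delta,$$ $$\epsilon(ab)=\epsilon(a\mathbf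 1_1)\epsilon(\mathbf 1_2 b),\quad (\epsilon\otimes Id)\Delta=Id=(Id\otimes\epsilon)\Delta,\quad \epsilon(aa^\star)\ge 0,$$ $$S(ab)=S(b)S(a),\quad S\big((S(a^\star))^\star\big)=a,\quad \Delta(S(a))=(S\otimes S)(\Delta^{op}(a)),\quad S(a_1)\cdot a_2\otimes a_3=\mathbf 1_1\otimes a\mathbf 1_2,$$ where Sweedler notation is used, in particular $\Delta(\mathbf 1)=\mathbf 1_1\otimes\mathbf 1_2$.
   Context: $M$ is the adjacency matrix of $G$, $\beta$ its largest eigenvalue, and $\mu=(\mu_v)$ the Perron–Frobenius eigenvector, $M\mu=\beta\mu$, with all $\mu_v>0$ and smallest component equal to $1$. Paths: an elementary path of length $n$ is a sequence $(v_0,\dots,v_n)$ of vertices with consecutive ones adjacent. $\mathcal{P}_n$ is the complex inner product space with the elementary paths of length $n$ as orthonormal basis; $\mathcal{P}=\bigoplus_n\mathcal{P}_n$. Concatenation: $(v_0,\dots,v_n)\star(v'_0,\dots,v'_m)=\delta_{v_nv'_0}(v_0,\dots,v_n,v'_1,\dots,v'_m)$, extended bilinearly. $\xi\mapsto\xi^\star$ is the antilinear extension of path reversal $(v_0,\dots,v_n)\mapsto(v_n,\dots,v_0)$. The symbol $\boxtimes$ is the tensor product of two copies of $A$; the product and star on $A\boxtimes A$ are taken factorwise. Annihilation and creation operators: linear maps $c_i:\mathcal{P}_n\to\mathcal{P}_{n-2}$, $c_i^\dagger:\mathcal{P}_n\to\mathcal{P}_{n+2}$, $$c_i(v_0,\dots,v_n)=\delta_{v_iv_{i+2}}\sqrt{\mu_{v_{i+1}}/\mu_{v_i}}\,(v_0,\dots,v_i,v_{i+3},\dots,v_n)\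 \text{ if }0\le i\le n-2,\ 0\text{ otherwise},$$ $$c_i^\dagger(v_0,\dots,v_n)=\sum_{v\sim v_i}\sqrt{\mu_v/\mu_{v_i}}\,(v_0,\dots,v_i,v,v_i,v_{i+1},\dots,v_n)\ \text{ if }0\le i\le n,\ 0\text{ otherwise}.$$ Essential paths: $\mathcal{E}_n=\{\xi\in\mathcal{P}_n: c_i\xi=0,\ i=0,\dots,n-2\}$, $\mathcal{E}=\bigoplus_n\mathcal{E}_n$. $End(\mathcal{P}_n)$ and $End(\mathcal{E}_n)$ are identified with $\mathcal{P}_n\otimes\mathcal{P}_n$ and $\mathcal{E}_n\otimes\mathcal{E}_n$; $End^{gr}(\mathcal{P})=\bigoplus_n\mathcal{P}_n\otimes\mathcal{P}_n$. The projection $P:End^{gr}(\mathcal{P})\to End^{gr}(\mathcal{E})$: every element of $\mathcal{P}_n$ is a linear combination of elements $c_{j_k}^\dagger\cdots c_{j_1}^\dagger\xi$ with $0\le j_1<\dots<j_k\le n-2$ and $\xi\in\mathcal{E}_{n-2k}$ ($k\ge0$). $P$ is the linear map determined by $$P(c_{j_k}^\dagger\cdots c_{j_1}^\dagger\xi_a\otimes c_{i_k}^\dagger\cdots c_{i_1}^\dagger\xi_b)=\sum_{c}(c_{i_1}\cdots c_{i_k}c_{j_k}^\dagger\cdots c_{j_1}^\dagger\xi_a,\xi_c)\,\xi_c\otimes\xi_b$$ (sum over an orthonormal basis $\{\xi_c\}$ of $\mathcal{E}_{n-2k}$), and by $P=0$ on tensors of two such terms having different numbers of creation operators. Conventions: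 orthonormal bases of $\mathcal{E}_n$ are taken to consist of elements with real coefficients in elementary paths and with definite starting and ending vertices; formulas for $\Delta$, $\epsilon$, $S$ are given on such elements and extended complex-linearly to $A$. *)

theory Defs
  imports
    Complex_Main
    "HOL-Library.Function_Algebras"
    "Graph_Theory.Graph_Theory"
begin

section \<open>Complex vector spaces with a distinguished basis\<close>

text \<open>
  A vector with finitely many coefficients \<open>x b\<close> in a basis indexed by \<open>'b\<close> is the
  function \<open>x :: 'b \<Rightarrow> complex\<close>. The tensor product of two such spaces has the pairs of
  indices as its basis.
\<close>

definition cscale :: "complex \<Rightarrow> ('b \<Rightarrow> complex) \<Rightarrow> ('b \<Rightarrow> complex)" (infixr "*\<^sub>C" 75)
  where "c *\<^sub>C x = (\<lambda>b. c * x b)"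

interpretation cfun: vector_space cscale
  by unfold_locales (auto simp: cscale_def fun_eq_iff algebra_simps)

definition supp :: "('b \<Rightarrow> complex) \<Rightarrow> 'b set"
  where "supp x = {b. x b \<noteq> 0}"

definition basis_vec :: "'b \<Rightarrow> ('b \<Rightarrow> complex)"
  where "basis_vec b = (\<lambda>b'. if b' = b then 1 else 0)"

definition lin_ext :: "('b \<Rightarrow> ('c \<Rightarrow> complex)) \<Rightarrow> ('b \<Rightarrow> complex) \<Rightarrow> ('c \<Rightarrow> complex)"
  where "lin_ext f x = (\<Sum>b\<in>supp x. x b *\<^sub>C f b)"

definition tensor :: "('b \<Rightarrow> complex) \<Rightarrow> ('c \<Rightarrow> complex) \<Rightarrow> ('b \<times> 'c \<Rightarrow> complex)"
    (infixr "\<otimes>\<^sub>C" 72)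
  where "x \<otimes>\<^sub>C y = (\<lambda>(b, c). x b * y c)"

definition inner_prod :: "('b \<Rightarrow> complex) \<Rightarrow> ('b \<Rightarrow> complex) \<Rightarrow> complex"
  where "inner_prod x y = (\<Sum>b\<in>supp x. x b * cnj (y b))"

definition linear_on :: "('b \<Rightarrow> complex) set \<Rightarrow> (('b \<Rightarrow> complex) \<Rightarrow> ('c \<Rightarrow> complex)) \<Rightarrow> bool"
  where "linear_on V f \<longleftrightarrow>
    (\<forall>x\<in>V. \<forall>y\<in>V. f (x + y) = f x + f y) \<and> (\<forall>c. \<forall>x\<in>V. f (c *\<^sub>C x) = c *\<^sub>C f x)"

definition tensor_square :: "('b \<Rightarrow> complex) set \<Rightarrow> ('b \<times> 'b \<Rightarrow> complex) set"
  where "tensor_square V = cfun.span {x \<otimes>\<^sub>C y | x y. x \<in> V \<and> y \<in> V}"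

text \<open>
  Sweedler notation: for \<open>X = \<Sum>\<^sub>i x\<^sub>i \<otimes> y\<^sub>i\<close> in the tensor square of \<open>V\<close>, \<open>sweedler V h X\<close> is
  \<open>\<Sum>\<^sub>i h x\<^sub>i y\<^sub>i\<close>. The chosen decomposition of \<open>X\<close> into elements of \<open>V\<close> is immaterial whenever
  \<open>h\<close> is bilinear on \<open>V\<close> (or antilinear in both arguments), which is the only way it is used.
\<close>

definition sweedler ::
    "('b \<Rightarrow> complex) set \<Rightarrow> (('b \<Rightarrow> complex) \<Rightarrow> ('b \<Rightarrow> complex) \<Rightarrow> 'd::comm_monoid_add) \<Rightarrow>
     ('b \<times> 'b \<Rightarrow> complex) \<Rightarrow> 'd"
  where "sweedler V h X =
    (\<Sum>(x, y)\<leftarrow>(SOME xys. set xys \<subseteq> V \<times> V \<and> X = (\<Sum>(x, y)\<leftarrow>xys. x \<otimes>\<^sub>C y)). h x y)"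

definition reassoc :: "(('b \<times> 'b) \<times> 'b \<Rightarrow> complex) \<Rightarrow> ('b \<times> 'b \<times> 'b \<Rightarrow> complex)"
  where "reassoc X = (\<lambda>(p, q, r). X ((p, q), r))"


section \<open>Weak *-Hopf algebras\<close>

locale weak_star_hopf_algebra =
  fixes A :: "('b \<Rightarrow> complex) set"
    and mult :: "('b \<Rightarrow> complex) \<Rightarrow> ('b \<Rightarrow> complex) \<Rightarrow> ('b \<Rightarrow> complex)" (infixl "\<cdot>" 74)
    and one :: "'b \<Rightarrow> complex"
    and star :: "('b \<Rightarrow> complex) \<Rightarrow> ('b \<Rightarrow> complex)"
    and Delta :: "('b \<Rightarrow> complex) \<Rightarrow> ('b \<times> 'b \<Rightarrow> complex)"
    and eps :: "('b \<Rightarrow> complex) \<Rightarrow> complex"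
    and S :: "('b \<Rightarrow> complex) \<Rightarrow> ('b \<Rightarrow> complex)"
  assumes subspace: "cfun.subspace A"
    and mult_closed: "\<lbrakk>a \<in> A; b \<in> A\<rbrakk> \<Longrightarrow> a \<cdot> b \<in> A"
    and mult_linear_left: "b \<in> A \<Longrightarrow> linear_on A (\<lambda>a. a \<cdot> b)"
    and mult_linear_right: "a \<in> A \<Longrightarrow> linear_on A (\<lambda>b. a \<cdot> b)"
    and mult_assoc: "\<lbrakk>a \<in> A; b \<in> A; c \<in> A\<rbrakk> \<Longrightarrow> (a \<cdot> b) \<cdot> c = a \<cdot> (b \<cdot> c)"
    and one_closed: "one \<in> A"
    and one_left: "a \<in> A \<Longrightarrow> one \<cdot> a = a"
    and one_right: "a \<in> A \<Longrightarrow> a \<cdot> one = a"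
    and star_closed: "a \<in> A \<Longrightarrow> star a \<in> A"
    and star_add: "\<lbrakk>a \<in> A; b \<in> A\<rbrakk> \<Longrightarrow> star (a + b) = star a + star b"
    and star_scale: "a \<in> A \<Longrightarrow> star (k *\<^sub>C a) = cnj k *\<^sub>C star a"
    and star_star: "a \<in> A \<Longrightarrow> star (star a) = a"
    and star_mult: "\<lbrakk>a \<in> A; b \<in> A\<rbrakk> \<Longrightarrow> star (a \<cdot> b) = star b \<cdot> star a"
    and Delta_closed: "a \<in> A \<Longrightarrow> Delta a \<in> tensor_square A"
    and Delta_linear: "linear_on A Delta"
    and Delta_mult: "\<lbrakk>a \<in> A; b \<in> A\<rbrakk> \<Longrightarrow> Delta (a \<cdot> b) =
      sweedler A (\<lambda>a1 a2. sweedler A (\<lambda>b1 b2. (a1 \<cdot> b1) \<otimes>\<^sub>C (a2 \<cdot> b2)) (Delta b)) (Delta a)"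
    and Delta_star: "a \<in> A \<Longrightarrow>
      Delta (star a) = sweedler A (\<lambda>a1 a2. star a1 \<otimes>\<^sub>C star a2) (Delta a)"
    and Delta_coassoc: "a \<in> A \<Longrightarrow>
      sweedler A (\<lambda>a1 a2. reassoc (Delta a1 \<otimes>\<^sub>C a2)) (Delta a) =
      sweedler A (\<lambda>a1 a2. a1 \<otimes>\<^sub>C Delta a2) (Delta a)"
    and eps_add: "\<lbrakk>a \<in> A; b \<in> A\<rbrakk> \<Longrightarrow> eps (a + b) = eps a + eps b"
    and eps_scale: "a \<in> A \<Longrightarrow> eps (k *\<^sub>C a) = k * eps a"
    and eps_mult: "\<lbrakk>a \<in> A; b \<in> A\<rbrakk> \<Longrightarrow>
      eps (a \<cdot> b) = sweedler A (\<lambda>u w. eps (a \<cdot> u) * eps (w \<cdot> b)) (Delta one)"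
    and counit_left: "a \<in> A \<Longrightarrow> sweedler A (\<lambda>a1 a2. eps a1 *\<^sub>C a2) (Delta a) = a"
    and counit_right: "a \<in> A \<Longrightarrow> sweedler A (\<lambda>a1 a2. eps a2 *\<^sub>C a1) (Delta a) = a"
    and eps_nonneg: "a \<in> A \<Longrightarrow> Im (eps (a \<cdot> star a)) = 0 \<and> Re (eps (a \<cdot> star a)) \<ge> 0"
    and S_closed: "a \<in> A \<Longrightarrow> S a \<in> A"
    and S_linear: "linear_on A S"
    and S_mult: "\<lbrakk>a \<in> A; b \<in> A\<rbrakk> \<Longrightarrow> S (a \<cdot> b) = S b \<cdot> S a"
    and S_star: "a \<in> A \<Longrightarrow> S (star (S (star a))) = a"
    and Delta_S: "a \<in> A \<Longrightarrow> Delta (S a) = sweedler A (\<lambda>a1 a2. S a2 \<otimes>\<^sub>C S a1) (Delta a)"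
    and antipode: "a \<in> A \<Longrightarrow>
      sweedler A (\<lambda>x a3. sweedler A (\<lambda>a1 a2. (S a1 \<cdot> a2) \<otimes>\<^sub>C a3) (Delta x)) (Delta a) =
      sweedler A (\<lambda>u w. u \<otimes>\<^sub>C (a \<cdot> w)) (Delta one)"


section \<open>The Perron--Frobenius eigenvector\<close>

definition adj_matrix :: "'v pair_pre_digraph \<Rightarrow> 'v \<Rightarrow> 'v \<Rightarrow> real"
  where "adj_matrix G v w = (if (v, w) \<in> parcs G then 1 else 0)"

definition adj_eigen :: "'v pair_pre_digraph \<Rightarrow> real \<Rightarrow> ('v \<Rightarrow> real) \<Rightarrow> bool"
  where "adj_eigen G l x \<longleftrightarrow>
    (\<forall>v\<in>pverts G. (\<Sum>w\<in>pverts G. adj_matrix G v w * x w) = l * x v) \<and> (\<exists>v\<in>pverts G. x v \<noteq> 0)"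

definition perron_frobenius :: "'v pair_pre_digraph \<Rightarrow> real \<Rightarrow> ('v \<Rightarrow> real) \<Rightarrow> bool"
  where "perron_frobenius G \<beta> \<mu> \<longleftrightarrow>
    (\<forall>l x. adj_eigen G l x \<longrightarrow> l \<le> \<beta>) \<and> adj_eigen G \<beta> \<mu> \<and>
    (\<forall>v\<in>pverts G. \<mu> v > 0) \<and> Min (\<mu> ` pverts G) = 1"


section \<open>Paths and essential paths\<close>

text \<open>An elementary path of length \<open>n\<close> is a vertex walk, i.e. a list of \<open>n + 1\<close> vertices.\<close>

definition path_space :: "'v pair_pre_digraph \<Rightarrow> nat \<Rightarrow> ('v list \<Rightarrow> complex) set"
  where "path_space G n =
    {\<xi>. finite (supp \<xi>) \<and> (\<forall>p\<in>supp \<xi>. vwalk p (with_proj G) \<and> length p = Suc n)}"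

definition path_conc :: "('v list \<Rightarrow> complex) \<Rightarrow> ('v list \<Rightarrow> complex) \<Rightarrow> ('v list \<Rightarrow> complex)"
  where "path_conc \<xi> \<rho> =
    lin_ext (\<lambda>p. lin_ext (\<lambda>q. if joinable p q then basis_vec (vwalk_join p q) else 0) \<rho>) \<xi>"

text \<open>The antilinear extension of path reversal: the coefficient of \<open>p\<close> comes from \<open>rev p\<close>.\<close>

definition path_star :: "('v list \<Rightarrow> complex) \<Rightarrow> ('v list \<Rightarrow> complex)"
  where "path_star \<xi> = (\<lambda>p. cnj (\<xi> (rev p)))"

definition annih :: "('v \<Rightarrow> real) \<Rightarrow> nat \<Rightarrow> ('v list \<Rightarrow> complex) \<Rightarrow> ('v list \<Rightarrow> complex)"
  where "annih \<mu> i = lin_ext (\<lambda>p.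
    if i + 2 < length p \<and> p ! i = p ! (i + 2)
    then complex_of_real (sqrt (\<mu> (p ! (i + 1)) / \<mu> (p ! i))) *\<^sub>C
           basis_vec (take (i + 1) p @ drop (i + 3) p)
    else 0)"

definition create ::
    "'v pair_pre_digraph \<Rightarrow> ('v \<Rightarrow> real) \<Rightarrow> nat \<Rightarrow> ('v list \<Rightarrow> complex) \<Rightarrow> ('v list \<Rightarrow> complex)"
  where "create G \<mu> i = lin_ext (\<lambda>p.
    if i < length p
    then (\<Sum>v\<in>{v \<in> pverts G. (v, p ! i) \<in> parcs G}.
           complex_of_real (sqrt (\<mu> v / \<mu> (p ! i))) *\<^sub>C
             basis_vec (take (i + 1) p @ v # drop i p))
    else 0)"

definition ess_space :: "'v pair_pre_digraph \<Rightarrow> ('v \<Rightarrow> real) \<Rightarrow> nat \<Rightarrow> ('v list \<Rightarrow> complex) set"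
  where "ess_space G \<mu> n = {\<xi> \<in> path_space G n. \<forall>i. i + 2 \<le> n \<longrightarrow> annih \<mu> i \<xi> = 0}"

definition starts_at :: "('v list \<Rightarrow> complex) \<Rightarrow> 'v \<Rightarrow> bool"
  where "starts_at \<xi> v \<longleftrightarrow> (\<forall>p\<in>supp \<xi>. hd p = v)"

definition ends_at :: "('v list \<Rightarrow> complex) \<Rightarrow> 'v \<Rightarrow> bool"
  where "ends_at \<xi> v \<longleftrightarrow> (\<forall>p\<in>supp \<xi>. last p = v)"

definition ess_onb ::
    "'v pair_pre_digraph \<Rightarrow> ('v \<Rightarrow> real) \<Rightarrow> nat \<Rightarrow> ('v list \<Rightarrow> complex) set \<Rightarrow> bool"
  where "ess_onb G \<mu> n B \<longleftrightarrow>
    finite B \<and> cfun.span B = ess_space G \<mu> n \<and>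
    (\<forall>b\<in>B. \<forall>c\<in>B. inner_prod b c = (if b = c then 1 else 0)) \<and>
    (\<forall>b\<in>B. (\<forall>p. b p \<in> \<real>) \<and> (\<exists>v. starts_at b v) \<and> (\<exists>v. ends_at b v))"


section \<open>Graded endomorphisms and the projection onto essential paths\<close>

definition end_gr :: "(nat \<Rightarrow> ('v list \<Rightarrow> complex) set) \<Rightarrow> ('v list \<times> 'v list \<Rightarrow> complex) set"
  where "end_gr W = cfun.span (\<Union>n. {\<xi> \<otimes>\<^sub>C \<xi>' | \<xi> \<xi>'. \<xi> \<in> W n \<and> \<xi>' \<in> W n})"

definition create_indices :: "nat \<Rightarrow> nat list set"
  where "create_indices n =
    {js. sorted_wrt (<) js \<and> (\<forall>j\<in>set js. j + 2 \<le> n) \<and> 2 * length js \<le> n}"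

text \<open>For \<open>js = [j\<^sub>1, \<dots>, j\<^sub>k]\<close>, \<open>fold\<close> applies the operator with index \<open>j\<^sub>1\<close> first, \<open>foldr\<close> the
  one with index \<open>j\<^sub>k\<close> first.\<close>

abbreviation creates ::
    "'v pair_pre_digraph \<Rightarrow> ('v \<Rightarrow> real) \<Rightarrow> nat list \<Rightarrow> ('v list \<Rightarrow> complex) \<Rightarrow> ('v list \<Rightarrow> complex)"
  where "creates G \<mu> js \<equiv> fold (create G \<mu>) js"

abbreviation annihs ::
    "('v \<Rightarrow> real) \<Rightarrow> nat list \<Rightarrow> ('v list \<Rightarrow> complex) \<Rightarrow> ('v list \<Rightarrow> complex)"
  where "annihs \<mu> js \<equiv> foldr (annih \<mu>) js"

text \<open>The last conjunct only fixes the value outside the domain, so that the map is unique as a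
  total function.\<close>

definition is_ess_proj ::
    "'v pair_pre_digraph \<Rightarrow> ('v \<Rightarrow> real) \<Rightarrow>
     (('v list \<times> 'v list \<Rightarrow> complex) \<Rightarrow> ('v list \<times> 'v list \<Rightarrow> complex)) \<Rightarrow> bool"
  where "is_ess_proj G \<mu> P \<longleftrightarrow>
    linear_on (end_gr (path_space G)) P \<and>
    (\<forall>n. \<forall>js\<in>create_indices n. \<forall>is\<in>create_indices n.
      \<forall>\<xi>a\<in>ess_space G \<mu> (n - 2 * length js). \<forall>\<xi>b\<in>ess_space G \<mu> (n - 2 * length is).
        (length js = length is \<longrightarrow>
          (\<forall>B. ess_onb G \<mu> (n - 2 * length js) B \<longrightarrow>
            P (creates G \<mu> js \<xi>a \<otimes>\<^sub>C creates G \<mu> is \<xi>b) =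
            (\<Sum>\<xi>c\<in>B. inner_prod (annihs \<mu> is (creates G \<mu> js \<xi>a)) \<xi>c *\<^sub>C (\<xi>c \<otimes>\<^sub>C \<xi>b)))) \<and>
        (length js \<noteq> length is \<longrightarrow>
          P (creates G \<mu> js \<xi>a \<otimes>\<^sub>C creates G \<mu> is \<xi>b) = 0)) \<and>
    (\<forall>x. x \<notin> end_gr (path_space G) \<longrightarrow> P x = 0)"

definition ess_proj ::
    "'v pair_pre_digraph \<Rightarrow> ('v \<Rightarrow> real) \<Rightarrow>
     ('v list \<times> 'v list \<Rightarrow> complex) \<Rightarrow> ('v list \<times> 'v list \<Rightarrow> complex)"
  where "ess_proj G \<mu> = (THE P. is_ess_proj G \<mu> P)"


section \<open>The structure maps\<close>

definition ess_algebra ::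
    "'v pair_pre_digraph \<Rightarrow> ('v \<Rightarrow> real) \<Rightarrow> ('v list \<times> 'v list \<Rightarrow> complex) set"
  where "ess_algebra G \<mu> = end_gr (ess_space G \<mu>)"

text \<open>
  Each structure map is the (bi)linear extension of its formula on pairs of elementary paths; on
  tensors of essential paths this gives back the formula, see the lemmas at the end.
\<close>

definition end_conc ::
    "('v list \<times> 'v list \<Rightarrow> complex) \<Rightarrow> ('v list \<times> 'v list \<Rightarrow> complex) \<Rightarrow>
     ('v list \<times> 'v list \<Rightarrow> complex)"
  where "end_conc a b =
    lin_ext (\<lambda>(p, p'). lin_ext (\<lambda>(q, q').
      path_conc (basis_vec p) (basis_vec q) \<otimes>\<^sub>C path_conc (basis_vec p') (basis_vec q')) b) a"

definition ess_mult ::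
    "'v pair_pre_digraph \<Rightarrow> ('v \<Rightarrow> real) \<Rightarrow> ('v list \<times> 'v list \<Rightarrow> complex) \<Rightarrow>
     ('v list \<times> 'v list \<Rightarrow> complex) \<Rightarrow> ('v list \<times> 'v list \<Rightarrow> complex)"
  where "ess_mult G \<mu> a b = ess_proj G \<mu> (end_conc a b)"

definition ess_one :: "'v pair_pre_digraph \<Rightarrow> ('v list \<times> 'v list \<Rightarrow> complex)"
  where "ess_one G = (\<Sum>v\<in>pverts G. \<Sum>v'\<in>pverts G. basis_vec [v] \<otimes>\<^sub>C basis_vec [v'])"

definition ess_star ::
    "('v list \<times> 'v list \<Rightarrow> complex) \<Rightarrow> ('v list \<times> 'v list \<Rightarrow> complex)"
  where "ess_star a = (\<lambda>(p, q). cnj (a (rev p, rev q)))"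

definition ess_coproduct ::
    "(nat \<Rightarrow> ('v list \<Rightarrow> complex) set) \<Rightarrow> ('v list \<times> 'v list \<Rightarrow> complex) \<Rightarrow>
     (('v list \<times> 'v list) \<times> ('v list \<times> 'v list) \<Rightarrow> complex)"
  where "ess_coproduct B = lin_ext (\<lambda>(p, q).
    \<Sum>\<xi>a\<in>B (length p - 1). (basis_vec p \<otimes>\<^sub>C \<xi>a) \<otimes>\<^sub>C (\<xi>a \<otimes>\<^sub>C basis_vec q))"

definition ess_counit :: "('v list \<times> 'v list \<Rightarrow> complex) \<Rightarrow> complex"
  where "ess_counit a = (\<Sum>(p, q)\<in>supp a. a (p, q) * inner_prod (basis_vec p) (basis_vec q))"

definition ess_antipode ::
    "('v \<Rightarrow> real) \<Rightarrow> ('v list \<times> 'v list \<Rightarrow> complex) \<Rightarrow> ('v list \<times> 'v list \<Rightarrow> complex)"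
  where "ess_antipode \<mu> = lin_ext (\<lambda>(p, q).
    complex_of_real (sqrt ((\<mu> (hd q) * \<mu> (last p)) / (\<mu> (last q) * \<mu> (hd p)))) *\<^sub>C
      (path_star (basis_vec q) \<otimes>\<^sub>C path_star (basis_vec p)))"


section \<open>The formulas on tensors of paths\<close>

lemma sum_fun_apply: "(\<Sum>i\<in>I. f i) b = (\<Sum>i\<in>I. (f i :: 'b \<Rightarrow> complex) b)"
  by (induction I rule: infinite_finite_induct) auto

lemma supp_tensor: "supp (x \<otimes>\<^sub>C y) = supp x \<times> supp y"
  by (auto simp: supp_def tensor_def)

lemma expand_basis:
  assumes "finite (supp x)"
  shows "(\<Sum>b\<in>supp x. x b * basis_vec b c) = x c"
  using assms by (auto simp: basis_vec_def supp_def sum.delta' if_distrib cong: if_cong)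

lemma lin_ext_apply: "lin_ext f x c = (\<Sum>b\<in>supp x. x b * f b c)"
  by (simp add: lin_ext_def sum_fun_apply cscale_def)

lemma lin_ext_basis_vec [simp]: "lin_ext f (basis_vec b) = f b"
  by (rule ext) (simp add: lin_ext_apply, simp add: supp_def basis_vec_def)

lemma end_conc_tensor:
  "end_conc (\<xi> \<otimes>\<^sub>C \<xi>') (\<rho> \<otimes>\<^sub>C \<rho>') = path_conc \<xi> \<rho> \<otimes>\<^sub>C path_conc \<xi>' \<rho>'"
proof (rule ext)
  fix z :: "'a list \<times> 'a list"
  obtain c d where z: "z = (c, d)" by force
  define J :: "'a list \<Rightarrow> 'a list \<Rightarrow> 'a list \<Rightarrow> complex"
    where "J p q = (if joinable p q then basis_vec (vwalk_join p q) else 0)" for p q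
  have conc: "path_conc x y e = (\<Sum>p\<in>supp x. \<Sum>q\<in>supp y. x p * y q * J p q e)" for x y e
    by (simp add: path_conc_def lin_ext_apply J_def[symmetric] sum_distrib_left mult.assoc)
  have basis: "path_conc (basis_vec p) (basis_vec q) = J p q" for p q
    by (simp add: path_conc_def J_def)
  have "end_conc (\<xi> \<otimes>\<^sub>C \<xi>') (\<rho> \<otimes>\<^sub>C \<rho>') z =
      (\<Sum>p\<in>supp \<xi>. \<Sum>p'\<in>supp \<xi>'. \<Sum>q\<in>supp \<rho>. \<Sum>q'\<in>supp \<rho>'.
        (\<xi> p * \<rho> q * J p q c) * (\<xi>' p' * \<rho>' q' * J p' q' d))"
    unfolding end_conc_def lin_ext_apply supp_tensor basis z
    by (simp add: case_prod_unfold lin_ext_apply supp_tensor sum.cartesian_product'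
        tensor_def sum_distrib_left mult_ac)
  also have "\<dots> = (\<Sum>p\<in>supp \<xi>. \<Sum>q\<in>supp \<rho>. \<Sum>p'\<in>supp \<xi>'. \<Sum>q'\<in>supp \<rho>'.
        (\<xi> p * \<rho> q * J p q c) * (\<xi>' p' * \<rho>' q' * J p' q' d))"
    by (intro sum.cong refl sum.swap)
  also have "\<dots> = path_conc \<xi> \<rho> c * path_conc \<xi>' \<rho>' d"
    unfolding conc sum_distrib_right by (simp add: sum_distrib_left)
  finally show "end_conc (\<xi> \<otimes>\<^sub>C \<xi>') (\<rho> \<otimes>\<^sub>C \<rho>') z =
      (path_conc \<xi> \<rho> \<otimes>\<^sub>C path_conc \<xi>' \<rho>') z"
    by (simp add: z tensor_def)
qed

lemma ess_mult_tensor: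
  "ess_mult G \<mu> (\<xi> \<otimes>\<^sub>C \<xi>') (\<rho> \<otimes>\<^sub>C \<rho>') =
    ess_proj G \<mu> (path_conc \<xi> \<rho> \<otimes>\<^sub>C path_conc \<xi>' \<rho>')"
  by (simp add: ess_mult_def end_conc_tensor)

lemma ess_star_tensor: "ess_star (\<xi> \<otimes>\<^sub>C \<xi>') = path_star \<xi> \<otimes>\<^sub>C path_star \<xi>'"
  by (auto simp: ess_star_def path_star_def tensor_def)

lemma ess_coproduct_tensor:
  assumes "\<xi> \<in> path_space G n" "\<xi>' \<in> path_space G n"
  shows "ess_coproduct B (\<xi> \<otimes>\<^sub>C \<xi>') = (\<Sum>\<xi>a\<in>B n. (\<xi> \<otimes>\<^sub>C \<xi>a) \<otimes>\<^sub>C (\<xi>a \<otimes>\<^sub>C \<xi>'))"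
proof (rule ext)
  fix z :: "('a list \<times> 'a list) \<times> ('a list \<times> 'a list)"
  obtain a b c d where z: "z = ((a, b), (c, d))" by (metis surj_pair)
  have fin: "finite (supp \<xi>)" "finite (supp \<xi>')" and len: "\<And>p. p \<in> supp \<xi> \<Longrightarrow> length p = Suc n"
    using assms by (auto simp: path_space_def)
  have "ess_coproduct B (\<xi> \<otimes>\<^sub>C \<xi>') z =
      (\<Sum>p\<in>supp \<xi>. \<Sum>q\<in>supp \<xi>'. \<Sum>x\<in>B n.
        (x b * x c) * ((\<xi> p * basis_vec p a) * (\<xi>' q * basis_vec q d)))"
    unfolding ess_coproduct_def lin_ext_apply supp_tensor z sum.cartesian_product'
    by (intro sum.cong refl)
      (simp add: len sum_fun_apply tensor_def sum_distrib_left mult_ac)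
  also have "\<dots> = (\<Sum>x\<in>B n. (x b * x c) *
      ((\<Sum>p\<in>supp \<xi>. \<xi> p * basis_vec p a) * (\<Sum>q\<in>supp \<xi>'. \<xi>' q * basis_vec q d)))"
    by (simp only: sum_product, simp only: sum_distrib_left)
      (simp only: sum.swap[of _ "B n" "supp \<xi>'"] sum.swap[of _ "B n" "supp \<xi>"])
  also have "\<dots> = (\<Sum>x\<in>B n. (\<xi> \<otimes>\<^sub>C x) \<otimes>\<^sub>C (x \<otimes>\<^sub>C \<xi>')) z"
    by (simp add: expand_basis fin z sum_fun_apply tensor_def mult_ac)
  finally show "ess_coproduct B (\<xi> \<otimes>\<^sub>C \<xi>') z = \<dots>" .
qed

lemma ess_counit_tensor:
  assumes "\<xi> \<in> path_space G n" "\<xi>' \<in> path_space G n" "\<And>p. \<xi>' p \<in> \<real>"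
  shows "ess_counit (\<xi> \<otimes>\<^sub>C \<xi>') = inner_prod \<xi> \<xi>'"
proof -
  have fin: "finite (supp \<xi>)" "finite (supp \<xi>')"
    using assms by (auto simp: path_space_def)
  have basis: "inner_prod (basis_vec p) (basis_vec q) = basis_vec q p" for p q :: "'a list"
    by (simp add: inner_prod_def) (simp add: supp_def basis_vec_def)
  have "ess_counit (\<xi> \<otimes>\<^sub>C \<xi>') = (\<Sum>p\<in>supp \<xi>. \<xi> p * (\<Sum>q\<in>supp \<xi>'. \<xi>' q * basis_vec q p))"
    unfolding ess_counit_def supp_tensor sum.cartesian_product'
    by (simp add: tensor_def basis sum_distrib_left mult_ac)
  also have "\<dots> = inner_prod \<xi> \<xi>'"
    using assms(3) by (simp add: expand_basis fin inner_prod_def Reals_cnj_iff)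
  finally show ?thesis .
qed

lemma ess_antipode_tensor:
  assumes "\<xi> \<in> path_space G n" "\<omega> \<in> path_space G n"
    and "\<And>p. \<xi> p \<in> \<real>" "\<And>p. \<omega> p \<in> \<real>"
    and "starts_at \<xi> s\<xi>" "ends_at \<xi> r\<xi>" "starts_at \<omega> s\<omega>" "ends_at \<omega> r\<omega>"
  shows "ess_antipode \<mu> (\<xi> \<otimes>\<^sub>C \<omega>) =
    complex_of_real (sqrt ((\<mu> s\<omega> * \<mu> r\<xi>) / (\<mu> r\<omega> * \<mu> s\<xi>))) *\<^sub>C (path_star \<omega> \<otimes>\<^sub>C path_star \<xi>)"
    (is "_ = ?k *\<^sub>C _")
proof (rule ext)
  fix z :: "'a list \<times> 'a list"
  obtain c d where z: "z = (c, d)" by force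
  have fin: "finite (supp \<xi>)" "finite (supp \<omega>)"
    using assms by (auto simp: path_space_def)
  have star: "path_star (basis_vec p) e = basis_vec p (rev e)" for p e :: "'a list"
    by (simp add: path_star_def basis_vec_def)
  have "ess_antipode \<mu> (\<xi> \<otimes>\<^sub>C \<omega>) z = (\<Sum>p\<in>supp \<xi>. \<Sum>q\<in>supp \<omega>.
      ?k * ((\<omega> q * basis_vec q (rev c)) * (\<xi> p * basis_vec p (rev d))))"
    unfolding ess_antipode_def lin_ext_apply supp_tensor z sum.cartesian_product'
    using assms(5-8)
    by (intro sum.cong refl)
      (simp add: starts_at_def ends_at_def cscale_def tensor_def star mult_ac)
  also have "\<dots> = ?k * ((\<Sum>q\<in>supp \<omega>. \<omega> q * basis_vec q (rev c)) *
      (\<Sum>p\<in>supp \<xi>. \<xi> p * basis_vec p (rev d)))"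
    by (simp only: sum_product, simp only: sum_distrib_left) (rule sum.swap)
  also have "\<dots> = ?k * (path_star \<omega> c * path_star \<xi> d)"
    using assms(3,4) by (simp add: expand_basis fin path_star_def Reals_cnj_iff)
  finally show "ess_antipode \<mu> (\<xi> \<otimes>\<^sub>C \<omega>) z = (?k *\<^sub>C (path_star \<omega> \<otimes>\<^sub>C path_star \<xi>)) z"
    by (simp add: z tensor_def cscale_def)
qed

end

theory Submission
  imports Defs
begin

text \<open>
  The annihilation and creation operators satisfy the Temperley-Lieb relations, and for the bilinear
  pairing of paths they are adjoint to each other. Imposing the relations
  \<open>cre i x \<otimes> y \<sim> x \<otimes> ann i y\<close> and \<open>y \<otimes> cre i x \<sim> ann i y \<otimes> x\<close> on the graded endomorphisms of paths
  leaves exactly one representative in the endomorphisms of essential paths, namely the projection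
  \<open>P\<close>; in other words a linear map that respects the relations factors through \<open>P\<close>. Concatenation,
  the star, the counit, the coproduct \<open>x \<otimes> y \<mapsto> \<Sum>p. (x \<otimes> p) \<boxtimes> (p \<otimes> y)\<close> over elementary
  paths and the antipode all make sense before projecting and respect the relations, so each axiom
  reduces to an elementary identity for paths. For the antipode axiom the weights are those of nested
  creation operators: \<open>\<Sum>p. sqrt (\<mu> (hd p) / \<mu> (last p)) (rev p \<star> p)\<close> is obtained from the vertices by
  creating \<open>n\<close> times at the middle of the path.
\<close>

section \<open>Linear and bilinear maps on finitely supported functions\<close>

text \<open>The sorted words in creation operators span the path spaces but are not a basis: some of
  them even vanish, such as a word that begins with a creation at index 1 on a path of length 0.
  Values prescribed on such a family need not extend to a linear map, so the existence of
  \<open>P\<close>, on which the \<open>THE\<close> in \<open>ess_proj\<close> depends, is a genuine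
  claim. The recursion \<open>pr\<close> starts from an arbitrary choice of decompositions. The
  choice does no harm if every family \<open>w\<close> with
  \<open>(\<Sum>i. cre i (w i)) = 0\<close> contributes nothing, and the Temperley-Lieb relations
  give this by induction on the length, provided that both families of relations are proved
  together. A second gap lies between the sum over an orthonormal basis in the coproduct and the sum
  over all walks that the relations require: the two agree as soon as a creation operator in one
  slot meets an essential path in the projection. Finally, the star is antilinear while invariance
  speaks of linear maps, so the star is applied on both sides of the map under study.\<close>

definition FS :: "('b \<Rightarrow> complex) set"
  where "FS = {x. finite (supp x)}"

lemma cscale_apply: "(c *\<^sub>C x) b = c * x b"
  by (simp add: cscale_def)

text \<open>Linearity lemmas match on sums of functions, which pointwise unfolding would destroy.\<close>
declare plus_fun_apply [simp del] zero_fun_apply [simp del] minus_apply [simp del]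

lemmas pointwise = plus_fun_apply zero_fun_apply minus_apply sum_fun_apply cscale_apply

lemma supp_zero [simp]: "supp 0 = {}"
  by (simp add: supp_def pointwise)

lemma supp_basis_vec [simp]: "supp (basis_vec b) = {b}"
  by (auto simp: supp_def basis_vec_def)

lemma supp_add: "supp (x + y) \<subseteq> supp x \<union> supp y"
  by (auto simp: supp_def pointwise)

lemma supp_scale: "supp (c *\<^sub>C x) \<subseteq> supp x"
  by (auto simp: supp_def pointwise)

lemma FS_subspace: "cfun.subspace FS"
  unfolding cfun.subspace_def FS_def
  by (auto intro: finite_subset[OF supp_add] finite_subset[OF supp_scale])

lemma FS_zero [simp]: "0 \<in> FS"
  by (simp add: FS_def)

lemma FS_add [simp]: "x \<in> FS \<Longrightarrow> y \<in> FS \<Longrightarrow> x + y \<in> FS"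
  by (rule cfun.subspace_add[OF FS_subspace])

lemma FS_scale [simp]: "x \<in> FS \<Longrightarrow> c *\<^sub>C x \<in> FS"
  by (rule cfun.subspace_scale[OF FS_subspace])

lemma FS_sum [simp]: "(\<And>i. i \<in> I \<Longrightarrow> f i \<in> FS) \<Longrightarrow> (\<Sum>i\<in>I. f i) \<in> FS"
  by (rule cfun.subspace_sum[OF FS_subspace])

lemma FS_basis_vec [simp]: "basis_vec b \<in> FS"
  by (simp add: FS_def)

lemma FS_tensor [simp]: "x \<in> FS \<Longrightarrow> y \<in> FS \<Longrightarrow> x \<otimes>\<^sub>C y \<in> FS"
  by (simp add: FS_def supp_tensor)

lemma FS_lin_ext: "x \<in> FS \<Longrightarrow> (\<And>b. b \<in> supp x \<Longrightarrow> f b \<in> FS) \<Longrightarrow> lin_ext f x \<in> FS"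
  by (simp add: lin_ext_def)

lemma lin_ext_eq_sum:
  assumes "finite F" "supp x \<subseteq> F"
  shows "lin_ext f x = (\<Sum>b\<in>F. x b *\<^sub>C f b)"
  unfolding lin_ext_def
  by (rule sum.mono_neutral_left) (use assms in \<open>auto simp: supp_def fun_eq_iff pointwise\<close>)

text \<open>Finite support matters: a sum over an infinite set is 0 by convention, so
  \<open>lin_ext\<close> is not additive beyond \<open>FS\<close>.\<close>

lemma linear_on_FS_lin_ext [simp]: "linear_on FS (lin_ext f)"
  unfolding linear_on_def
proof (intro conjI ballI allI)
  fix x y :: "'a \<Rightarrow> complex" and c
  assume x: "x \<in> FS" and y: "y \<in> FS"
  let ?F = "supp x \<union> supp y"
  have F: "finite ?F" using x y by (simp add: FS_def)
  show "lin_ext f (x + y) = lin_ext f x + lin_ext f y"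
    by (subst (1 2 3) lin_ext_eq_sum[OF F])
      (use supp_add[of x y] in \<open>auto simp: fun_eq_iff pointwise sum.distrib algebra_simps\<close>)
next
  fix x :: "'a \<Rightarrow> complex" and c
  assume x: "x \<in> FS"
  then have F: "finite (supp x)" by (simp add: FS_def)
  show "lin_ext f (c *\<^sub>C x) = c *\<^sub>C lin_ext f x"
    by (subst (1 2) lin_ext_eq_sum[OF F])
      (use supp_scale[of c x] in \<open>auto simp: fun_eq_iff pointwise sum_distrib_left algebra_simps\<close>)
qed

lemma linear_on_add: "linear_on V f \<Longrightarrow> x \<in> V \<Longrightarrow> y \<in> V \<Longrightarrow> f (x + y) = f x + f y"
  and linear_on_scale: "linear_on V f \<Longrightarrow> x \<in> V \<Longrightarrow> f (c *\<^sub>C x) = c *\<^sub>C f x"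
  by (auto simp: linear_on_def)

lemma linear_on_subset: "linear_on V f \<Longrightarrow> W \<subseteq> V \<Longrightarrow> linear_on W f"
  unfolding linear_on_def by blast

lemma linear_on_zero: "linear_on V f \<Longrightarrow> cfun.subspace V \<Longrightarrow> f 0 = 0"
  using linear_on_scale[of V f 0 0] by (simp add: cfun.subspace_0)

lemma linear_on_sum:
  assumes "linear_on V f" "cfun.subspace V" "\<And>i. i \<in> I \<Longrightarrow> x i \<in> V"
  shows "f (\<Sum>i\<in>I. x i) = (\<Sum>i\<in>I. f (x i))"
  using assms(3)
proof (induction I rule: infinite_finite_induct)
  case (insert a I)
  then have "(\<Sum>i\<in>I. x i) \<in> V" by (intro cfun.subspace_sum[OF assms(2)]) auto
  then have "f (x a + (\<Sum>i\<in>I. x i)) = f (x a) + f (\<Sum>i\<in>I. x i)"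
    using insert.prems by (intro linear_on_add[OF assms(1)]) auto
  with insert show ?case by simp
qed (use linear_on_zero[OF assms(1,2)] in simp_all)

lemmas lin_add = linear_on_add[where V = FS]
lemmas lin_scale = linear_on_scale[where V = FS]
lemmas lin_zero = linear_on_zero[OF _ FS_subspace]
lemmas lin_sum = linear_on_sum[OF _ FS_subspace]

lemma linear_on_diff: "linear_on V f \<Longrightarrow> cfun.subspace V \<Longrightarrow> x \<in> V \<Longrightarrow> y \<in> V \<Longrightarrow> f (x - y) = f x - f y"
  using linear_on_add[of V f "x - y" y] by (simp add: cfun.subspace_diff)

lemmas lin_diff = linear_on_diff[OF _ FS_subspace]

lemma linear_onI:
  "(\<And>x y. x \<in> V \<Longrightarrow> y \<in> V \<Longrightarrow> f (x + y) = f x + f y) \<Longrightarrow>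
    (\<And>c x. x \<in> V \<Longrightarrow> f (c *\<^sub>C x) = c *\<^sub>C f x) \<Longrightarrow> linear_on V f"
  by (simp add: linear_on_def)

lemma linear_on_compose:
  assumes "linear_on V f" "linear_on W g" "\<And>x. x \<in> V \<Longrightarrow> f x \<in> W"
  shows "linear_on V (\<lambda>x. g (f x))"
  by (rule linear_onI) (simp_all add: linear_on_add[OF assms(1)] linear_on_add[OF assms(2)]
      linear_on_scale[OF assms(1)] linear_on_scale[OF assms(2)] assms(3))

lemma linear_on_id: "linear_on V (\<lambda>x. x)"
  by (rule linear_onI) simp_all

lemma linear_on_sum_maps: "(\<And>i. i \<in> I \<Longrightarrow> linear_on V (f i)) \<Longrightarrow> linear_on V (\<lambda>x. \<Sum>i\<in>I. f i x)"
  by (rule linear_onI)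
    (simp_all add: linear_on_add[of V "f _"] linear_on_scale[of V "f _"] sum.distrib
      cfun.scale_sum_right)

lemma linear_on_scale_map: "linear_on V f \<Longrightarrow> linear_on V (\<lambda>x. c *\<^sub>C f x)"
  by (rule linear_onI)
    (simp_all add: linear_on_add[of V f] linear_on_scale[of V f] cfun.scale_right_distrib mult.commute)

lemma linear_on_eq_span:
  assumes "linear_on V f" "linear_on V g" "cfun.subspace V" "S \<subseteq> V"
    and "\<And>x. x \<in> S \<Longrightarrow> f x = g x" "x \<in> cfun.span S"
  shows "f x = g x"
proof -
  have "cfun.subspace {x \<in> V. f x = g x}"
    using linear_on_zero[OF assms(1,3)] linear_on_zero[OF assms(2,3)]
      linear_on_add[OF assms(1)] linear_on_add[OF assms(2)]
      linear_on_scale[OF assms(1)] linear_on_scale[OF assms(2)] assms(3)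
    by (simp add: cfun.subspace_def)
  then have "cfun.span S \<subseteq> {x \<in> V. f x = g x}"
    using assms(4,5) by (intro cfun.span_minimal) auto
  with assms(6) show ?thesis by blast
qed

lemma FS_expand: "x \<in> FS \<Longrightarrow> x = (\<Sum>b\<in>supp x. x b *\<^sub>C basis_vec b)"
  by (simp add: fun_eq_iff pointwise expand_basis FS_def)

lemma FS_expand_on:
  assumes "finite F" "supp x \<subseteq> F"
  shows "x = (\<Sum>b\<in>F. x b *\<^sub>C basis_vec b)"
  using assms lin_ext_eq_sum[OF assms, of basis_vec] FS_expand[of x] finite_subset[of "supp x" F]
  by (simp add: lin_ext_def FS_def)

lemma lin_expand:
  assumes "linear_on FS f" "x \<in> FS"
  shows "f x = lin_ext (\<lambda>b. f (basis_vec b)) x"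
proof -
  have "f x = f (\<Sum>b\<in>supp x. x b *\<^sub>C basis_vec b)" using FS_expand[OF assms(2)] by simp
  also have "\<dots> = (\<Sum>b\<in>supp x. f (x b *\<^sub>C basis_vec b))" by (rule lin_sum[OF assms(1)]) simp
  finally show ?thesis by (simp add: lin_scale[OF assms(1)] lin_ext_def)
qed

lemma lin_eqI:
  assumes "linear_on FS f" "linear_on FS g" "x \<in> FS"
    and "\<And>b. b \<in> supp x \<Longrightarrow> f (basis_vec b) = g (basis_vec b)"
  shows "f x = g x"
  by (simp add: lin_expand[OF assms(1,3)] lin_expand[OF assms(2,3)])
    (simp add: lin_ext_def assms(4) cong: sum.cong)

lemma lin_ext_param:
  assumes "\<And>b. linear_on V (f b)"
  shows "linear_on V (\<lambda>y. lin_ext (\<lambda>b. f b y) x)"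
  unfolding lin_ext_def by (intro linear_on_sum_maps linear_on_scale_map assms)

lemma tensor_basis_vec: "basis_vec p \<otimes>\<^sub>C basis_vec q = basis_vec (p, q)"
  by (auto simp: tensor_def basis_vec_def fun_eq_iff)

lemma tensor_add_left: "(x + y) \<otimes>\<^sub>C z = x \<otimes>\<^sub>C z + y \<otimes>\<^sub>C z"
  and tensor_add_right: "z \<otimes>\<^sub>C (x + y) = z \<otimes>\<^sub>C x + z \<otimes>\<^sub>C y"
  and tensor_scale_left: "(c *\<^sub>C x) \<otimes>\<^sub>C z = c *\<^sub>C (x \<otimes>\<^sub>C z)"
  and tensor_scale_right: "z \<otimes>\<^sub>C (c *\<^sub>C x) = c *\<^sub>C (z \<otimes>\<^sub>C x)"
  and tensor_zero_left [simp]: "0 \<otimes>\<^sub>C z = 0"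
  and tensor_zero_right [simp]: "z \<otimes>\<^sub>C 0 = 0"
  by (auto simp: tensor_def fun_eq_iff pointwise algebra_simps)

lemma tensor_sum_left: "(\<Sum>i\<in>I. x i) \<otimes>\<^sub>C z = (\<Sum>i\<in>I. x i \<otimes>\<^sub>C z)"
  and tensor_sum_right: "z \<otimes>\<^sub>C (\<Sum>i\<in>I. x i) = (\<Sum>i\<in>I. z \<otimes>\<^sub>C x i)"
  by (auto simp: tensor_def fun_eq_iff pointwise sum_distrib_left sum_distrib_right)

definition bilinear_FS :: "(('b \<Rightarrow> complex) \<Rightarrow> ('c \<Rightarrow> complex) \<Rightarrow> ('d \<Rightarrow> complex)) \<Rightarrow> bool"
  where "bilinear_FS f \<longleftrightarrow>
    (\<forall>y\<in>FS. linear_on FS (\<lambda>x. f x y)) \<and> (\<forall>x\<in>FS. linear_on FS (f x))"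

lemma bilinear_FS_left: "bilinear_FS f \<Longrightarrow> y \<in> FS \<Longrightarrow> linear_on FS (\<lambda>x. f x y)"
  and bilinear_FS_right: "bilinear_FS f \<Longrightarrow> x \<in> FS \<Longrightarrow> linear_on FS (f x)"
  by (auto simp: bilinear_FS_def)

lemma bilinear_FS_tensor [simp]: "bilinear_FS (\<otimes>\<^sub>C)"
  by (simp add: bilinear_FS_def linear_on_def tensor_add_left tensor_add_right
      tensor_scale_left tensor_scale_right)

lemma bilinear_FS_compose:
  assumes "bilinear_FS f" "linear_on FS g" "linear_on FS h"
    and "\<And>x. x \<in> FS \<Longrightarrow> g x \<in> FS" "\<And>x. x \<in> FS \<Longrightarrow> h x \<in> FS"
  shows "bilinear_FS (\<lambda>x y. f (g x) (h y))"
  using linear_on_compose[OF assms(2) bilinear_FS_left[OF assms(1)]]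
    linear_on_compose[OF assms(3) bilinear_FS_right[OF assms(1)]]
  by (simp add: bilinear_FS_def assms(4,5))

lemma bilinear_FS_post:
  assumes "bilinear_FS f" "linear_on FS g" "\<And>x y. x \<in> FS \<Longrightarrow> y \<in> FS \<Longrightarrow> f x y \<in> FS"
  shows "bilinear_FS (\<lambda>x y. g (f x y))"
  using linear_on_compose[OF bilinear_FS_left[OF assms(1)] assms(2)]
    linear_on_compose[OF bilinear_FS_right[OF assms(1)] assms(2)]
  by (simp add: bilinear_FS_def assms(3))

lemma bilinear_FS_lin_ext [simp]: "bilinear_FS (\<lambda>x y. lin_ext (\<lambda>p. lin_ext (f p) y) x)"
  unfolding bilinear_FS_def by (auto intro: lin_ext_param)

text \<open>The universal property of the tensor product: pairs of indices form its basis, so a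
  bilinear map becomes a linear one through its values on pairs of basis vectors.\<close>

definition bext :: "(('b \<Rightarrow> complex) \<Rightarrow> ('c \<Rightarrow> complex) \<Rightarrow> ('d \<Rightarrow> complex)) \<Rightarrow>
    ('b \<times> 'c \<Rightarrow> complex) \<Rightarrow> ('d \<Rightarrow> complex)"
  where "bext f = lin_ext (\<lambda>(p, q). f (basis_vec p) (basis_vec q))"

lemma linear_on_bext [simp]: "linear_on FS (bext f)"
  by (simp add: bext_def)

lemma bilinear_eqI:
  assumes "bilinear_FS f" "bilinear_FS g" "x \<in> FS" "y \<in> FS"
    and "\<And>p q. p \<in> supp x \<Longrightarrow> q \<in> supp y \<Longrightarrow>
      f (basis_vec p) (basis_vec q) = g (basis_vec p) (basis_vec q)"
  shows "f x y = g x y"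
proof (rule lin_eqI[of "\<lambda>x. f x y" "\<lambda>x. g x y" x])
  fix p assume "p \<in> supp x"
  then show "f (basis_vec p) y = g (basis_vec p) y"
    using bilinear_FS_right[OF assms(1)] bilinear_FS_right[OF assms(2)]
    by (intro lin_eqI[of "f (basis_vec p)" "g (basis_vec p)" y]) (simp_all add: assms(4,5))
qed (use bilinear_FS_left[OF assms(1,4)] bilinear_FS_left[OF assms(2,4)] assms(3) in auto)

lemma bext_tensor:
  assumes "bilinear_FS f" "x \<in> FS" "y \<in> FS"
  shows "bext f (x \<otimes>\<^sub>C y) = f x y"
proof (rule bilinear_eqI[of "\<lambda>x y. bext f (x \<otimes>\<^sub>C y)" f])
  show "bilinear_FS (\<lambda>x y. bext f (x \<otimes>\<^sub>C y))"
    by (rule bilinear_FS_post[OF bilinear_FS_tensor linear_on_bext]) simp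
qed (use assms in \<open>simp_all add: tensor_basis_vec bext_def\<close>)

text \<open>In nested Sweedler sums the inner bilinear map depends on an element of the outer sum;
  this keeps the whole expression linear in that element.\<close>

lemma bext_param:
  assumes "\<And>x y. x \<in> FS \<Longrightarrow> y \<in> FS \<Longrightarrow> linear_on V (\<lambda>a. f a x y)"
  shows "linear_on V (\<lambda>a. bext (f a) X)"
  unfolding bext_def using lin_ext_param[of V "\<lambda>p a. case p of (p, q) \<Rightarrow> f a (basis_vec p) (basis_vec q)"] assms
  by (simp add: case_prod_unfold)


section \<open>Sweedler sums of bilinear expressions\<close>

lemma sum_list_tensor_FS:
  "set xys \<subseteq> FS \<times> FS \<Longrightarrow> (\<Sum>(x, y)\<leftarrow>xys. x \<otimes>\<^sub>C y) \<in> FS"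
  by (induction xys) auto

lemma tensor_square_decomp:
  assumes "cfun.subspace V" "X \<in> tensor_square V"
  shows "\<exists>xys. set xys \<subseteq> V \<times> V \<and> X = (\<Sum>(x, y)\<leftarrow>xys. x \<otimes>\<^sub>C y)"
  using assms(2) unfolding tensor_square_def
proof (induction rule: cfun.span_induct_alt)
  case base
  show ?case by (rule exI[of _ "[]"]) simp
next
  case (step c z X)
  then obtain xys x y where *: "set xys \<subseteq> V \<times> V" "X = (\<Sum>(x, y)\<leftarrow>xys. x \<otimes>\<^sub>C y)"
    "z = x \<otimes>\<^sub>C y" "x \<in> V" "y \<in> V" by auto
  then show ?case
    using assms(1)
    by (intro exI[of _ "(c *\<^sub>C x, y) # xys"]) (auto simp: tensor_scale_left cfun.subspace_def)
qed

text \<open>The decomposition picked by \<open>SOME\<close> is arbitrary, but a map \<open>H\<close>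
  defined on the tensor itself cannot distinguish decompositions. Only additivity is required, which
  also covers the antilinear star and scalar values.\<close>

lemma sweedler_eq_additive:
  assumes V: "cfun.subspace V" "V \<subseteq> FS" and X: "X \<in> tensor_square V"
    and h: "\<And>x y. x \<in> V \<Longrightarrow> y \<in> V \<Longrightarrow> h x y = H (x \<otimes>\<^sub>C y)"
    and H: "H 0 = 0" "\<And>X Y. X \<in> FS \<Longrightarrow> Y \<in> FS \<Longrightarrow> H (X + Y) = H X + H Y"
  shows "sweedler V h X = H X"
proof -
  define xys where "xys = (SOME xys. set xys \<subseteq> V \<times> V \<and> X = (\<Sum>(x, y)\<leftarrow>xys. x \<otimes>\<^sub>C y))"
  have xys: "set xys \<subseteq> V \<times> V" "X = (\<Sum>(x, y)\<leftarrow>xys. x \<otimes>\<^sub>C y)"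
    using someI_ex[OF tensor_square_decomp[OF V(1) X]] by (auto simp: xys_def)
  have "(\<Sum>(x, y)\<leftarrow>zs. h x y) = H (\<Sum>(x, y)\<leftarrow>zs. x \<otimes>\<^sub>C y)" if "set zs \<subseteq> V \<times> V" for zs
    using that
  proof (induction zs)
    case (Cons z zs)
    obtain x y where z: "z = (x, y)" by force
    have "set zs \<subseteq> FS \<times> FS" using Cons.prems V(2) by auto
    then have "(\<Sum>(x, y)\<leftarrow>zs. x \<otimes>\<^sub>C y) \<in> FS" by (rule sum_list_tensor_FS)
    moreover have "x \<otimes>\<^sub>C y \<in> FS" using Cons.prems V(2) z by (intro FS_tensor) auto
    ultimately show ?case using Cons by (simp add: z H(2) h)
  qed (simp add: H(1))
  from this[OF xys(1)] show ?thesis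
    unfolding sweedler_def xys_def[symmetric] xys(2)[symmetric] .
qed

lemma sweedler_eq_bext:
  assumes "cfun.subspace V" "V \<subseteq> FS" "X \<in> tensor_square V" "bilinear_FS f"
    and "\<And>x y. x \<in> V \<Longrightarrow> y \<in> V \<Longrightarrow> h x y = f x y"
  shows "sweedler V h X = bext f X"
proof (rule sweedler_eq_additive[OF assms(1-3)])
  fix x y assume "x \<in> V" "y \<in> V"
  then show "h x y = bext f (x \<otimes>\<^sub>C y)"
    using bext_tensor[OF assms(4), of x y] assms(2) by (simp add: assms(5) subset_iff)
qed (use lin_zero[OF linear_on_bext] lin_add[OF linear_on_bext] in auto)

section \<open>Annihilation and creation operators\<close>

locale perron_graph =
  fixes G :: "'v pair_pre_digraph" and \<beta> :: real and \<mu> :: "'v \<Rightarrow> real"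
  assumes graph: "pair_graph G" and pf: "perron_frobenius G \<beta> \<mu>"
begin

abbreviation ann where "ann \<equiv> annih \<mu>"
abbreviation cre where "cre \<equiv> create G \<mu>"

definition nbs :: "'v \<Rightarrow> 'v set"
  where "nbs v = {w \<in> pverts G. (w, v) \<in> parcs G}"

definition wt :: "'v \<Rightarrow> 'v \<Rightarrow> complex"
  where "wt w v = complex_of_real (sqrt (\<mu> w / \<mu> v))"

definition walks :: "nat \<Rightarrow> 'v list set"
  where "walks n = {p. vwalk p (with_proj G) \<and> length p = Suc n}"

text \<open>Prefixing a vertex turns the operators at position \<open>i\<close> into those at
  position \<open>Suc i\<close>. Adjacency is not checked, so the result need not be a walk.\<close>

definition push :: "'v \<Rightarrow> ('v list \<Rightarrow> complex) \<Rightarrow> ('v list \<Rightarrow> complex)"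
  where "push u = lin_ext (\<lambda>p. basis_vec (u # p))"

lemma finite_verts: "finite (pverts G)"
  using graph by (simp add: pair_graph_def pair_digraph_def pair_fin_digraph_def
      pair_fin_digraph_axioms_def)

lemma arcs_verts: "(u, v) \<in> parcs G \<Longrightarrow> u \<in> pverts G \<and> v \<in> pverts G"
proof -
  interpret pair_graph G by (rule graph)
  show "(u, v) \<in> parcs G \<Longrightarrow> u \<in> pverts G \<and> v \<in> pverts G"
    using arc_fst_in_verts arc_snd_in_verts by fastforce
qed

lemma arcs_sym: "(u, v) \<in> parcs G \<longleftrightarrow> (v, u) \<in> parcs G"
proof -
  interpret pair_graph G by (rule graph)
  show ?thesis
    using pair_sym_arcs by (auto simp: symmetric_def sym_def)
qed

lemma finite_nbs [simp]: "finite (nbs v)"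
  using finite_verts by (simp add: nbs_def)

lemma nbs_iff: "w \<in> nbs v \<longleftrightarrow> (v, w) \<in> parcs G"
  using arcs_verts arcs_sym by (auto simp: nbs_def)

lemma mu_pos: "v \<in> pverts G \<Longrightarrow> \<mu> v > 0"
  using pf by (simp add: perron_frobenius_def)

lemma wt_square: "v \<in> pverts G \<Longrightarrow> w \<in> pverts G \<Longrightarrow> wt w v * wt w v = complex_of_real (\<mu> w / \<mu> v)"
  using mu_pos[of v] mu_pos[of w] by (simp add: wt_def flip: of_real_mult)

lemma wt_inverse: "v \<in> pverts G \<Longrightarrow> w \<in> pverts G \<Longrightarrow> wt w v * wt v w = 1"
  using mu_pos[of v] mu_pos[of w] by (simp add: wt_def real_sqrt_divide flip: of_real_mult)

text \<open>The eigenvector equation divided by \<open>\<mu> v\<close>. It is the source of the loop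
  value \<open>\<beta>\<close> in the Temperley-Lieb relations.\<close>

lemma eigen: "v \<in> pverts G \<Longrightarrow> (\<Sum>w\<in>nbs v. wt w v * wt w v) = complex_of_real \<beta>"
proof -
  assume v: "v \<in> pverts G"
  have "(\<Sum>w\<in>nbs v. \<mu> w) = (\<Sum>w\<in>pverts G. if (w, v) \<in> parcs G then \<mu> w else 0)"
    unfolding nbs_def by (rule sum.inter_filter[OF finite_verts])
  also have "\<dots> = (\<Sum>w\<in>pverts G. adj_matrix G v w * \<mu> w)"
    by (rule sum.cong) (auto simp: adj_matrix_def arcs_sym)
  also have "\<dots> = \<beta> * \<mu> v"
    using pf v by (simp add: perron_frobenius_def adj_eigen_def)
  finally have "(\<Sum>w\<in>nbs v. \<mu> w / \<mu> v) = \<beta>"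
    using mu_pos[OF v] by (simp flip: sum_divide_distrib)
  moreover have "(\<Sum>w\<in>nbs v. wt w v * wt w v) = (\<Sum>w\<in>nbs v. complex_of_real (\<mu> w / \<mu> v))"
    using v by (intro sum.cong refl wt_square) (auto simp: nbs_def)
  ultimately show ?thesis by (simp only: of_real_sum[symmetric])
qed

lemma lin_ann [simp]: "linear_on FS (ann i)"
  and lin_cre [simp]: "linear_on FS (cre i)"
  and lin_push [simp]: "linear_on FS (push u)"
  by (simp_all add: annih_def create_def push_def)

lemma FS_ann [simp]: "x \<in> FS \<Longrightarrow> ann i x \<in> FS"
  and FS_cre [simp]: "x \<in> FS \<Longrightarrow> cre i x \<in> FS"
  and FS_push [simp]: "x \<in> FS \<Longrightarrow> push u x \<in> FS"
  unfolding annih_def create_def push_def by (auto intro!: FS_lin_ext FS_sum)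

lemma push_basis [simp]: "push u (basis_vec p) = basis_vec (u # p)"
  by (simp add: push_def)

lemma ann_basis: "ann i (basis_vec p) =
    (if i + 2 < length p \<and> p ! i = p ! (i + 2)
     then wt (p ! (i + 1)) (p ! i) *\<^sub>C basis_vec (take (i + 1) p @ drop (i + 3) p) else 0)"
  by (simp add: annih_def wt_def)

lemma cre_basis: "cre i (basis_vec p) =
    (if i < length p
     then \<Sum>v\<in>nbs (p ! i). wt v (p ! i) *\<^sub>C basis_vec (take (i + 1) p @ v # drop i p) else 0)"
  by (simp add: create_def wt_def nbs_def)

lemma ann_basis_short: "length p \<le> i + 2 \<Longrightarrow> ann i (basis_vec p) = 0"
  by (simp add: ann_basis)

lemma cre_basis_short: "length p \<le> i \<Longrightarrow> cre i (basis_vec p) = 0"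
  by (simp add: cre_basis)

lemma ann_basis_0: "ann 0 (basis_vec (u # w # v # p)) = (if u = v then wt w v *\<^sub>C basis_vec (v # p) else 0)"
  by (simp add: ann_basis)

lemma cre_basis_0: "cre 0 (basis_vec (v # p)) = (\<Sum>w\<in>nbs v. wt w v *\<^sub>C basis_vec (v # w # v # p))"
  by (simp add: cre_basis)

lemma ann_Suc_basis: "ann (Suc i) (basis_vec (u # p)) = push u (ann i (basis_vec p))"
  by (simp add: ann_basis lin_scale lin_zero drop_Cons' add.commute[of i])

lemma cre_Suc_basis: "cre (Suc i) (basis_vec (u # p)) = push u (cre i (basis_vec p))"
  by (simp add: cre_basis lin_scale lin_zero lin_sum[OF lin_push])

lemma ann_Suc_push: "x \<in> FS \<Longrightarrow> ann (Suc i) (push u x) = push u (ann i x)"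
  by (rule lin_eqI[of "\<lambda>x. ann (Suc i) (push u x)" "\<lambda>x. push u (ann i x)"])
    (simp_all add: linear_on_compose[where W = FS] ann_Suc_basis)

lemma cre_Suc_push: "x \<in> FS \<Longrightarrow> cre (Suc i) (push u x) = push u (cre i x)"
  by (rule lin_eqI[of "\<lambda>x. cre (Suc i) (push u x)" "\<lambda>x. push u (cre i x)"])
    (simp_all add: linear_on_compose[where W = FS] cre_Suc_basis)

text \<open>After an inner operator has acted, a tail is a combination of paths and no longer a
  single list. Knowing its common first vertex is enough to evaluate the operators at position 0 in
  front of it.\<close>

definition starts :: "'v \<Rightarrow> ('v list \<Rightarrow> complex) set"
  where "starts v = {x \<in> FS. \<forall>p\<in>supp x. p \<noteq> [] \<and> hd p = v}"

lemma starts_FS: "x \<in> starts v \<Longrightarrow> x \<in> FS"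
  by (simp add: starts_def)

lemma starts_subspace: "cfun.subspace (starts v)"
  using supp_add supp_scale unfolding starts_def cfun.subspace_def by fastforce

lemma basis_starts [simp]: "basis_vec (v # p) \<in> starts v"
  by (simp add: starts_def)

lemma push_starts: "x \<in> FS \<Longrightarrow> push v x \<in> starts v"
  unfolding push_def lin_ext_def by (intro cfun.subspace_sum cfun.subspace_scale starts_subspace) simp

lemma ann_starts_basis: "ann i (basis_vec (v # p)) \<in> starts v"
proof (cases i)
  case 0
  then show ?thesis
    using cfun.subspace_0[OF starts_subspace] cfun.subspace_scale[OF starts_subspace]
    by (simp add: ann_basis)
next
  case (Suc j)
  then show ?thesis by (simp add: ann_Suc_basis push_starts)
qed

lemma cre_starts_basis: "cre i (basis_vec (v # p)) \<in> starts v"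
proof (cases i)
  case 0
  then show ?thesis
    by (simp add: cre_basis_0 cfun.subspace_sum[OF starts_subspace] cfun.subspace_scale[OF starts_subspace])
next
  case (Suc j)
  then show ?thesis by (simp add: cre_Suc_basis push_starts)
qed

lemma ann_0_push_push: "x \<in> starts v \<Longrightarrow> ann 0 (push u (push w x)) = (if u = v then wt w v *\<^sub>C x else 0)"
proof (rule lin_eqI[of "\<lambda>x. ann 0 (push u (push w x))" "\<lambda>x. if u = v then wt w v *\<^sub>C x else 0"])
  show "linear_on FS (\<lambda>x. ann 0 (push u (push w x)))"
    by (rule linear_on_compose[OF linear_on_compose[OF lin_push lin_push FS_push] lin_ann]) simp_all
  show "linear_on FS (\<lambda>x. if u = v then wt w v *\<^sub>C x else 0)"
    by (rule linear_onI) (simp_all add: cfun.scale_right_distrib mult.commute)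
next
  fix p assume "x \<in> starts v" "p \<in> supp x"
  then obtain q where "p = v # q" by (cases p) (auto simp: starts_def)
  then show "ann 0 (push u (push w (basis_vec p))) = (if u = v then wt w v *\<^sub>C basis_vec p else 0)"
    by (simp add: ann_basis_0)
qed (simp add: starts_FS)

lemma cre_0_starts: "x \<in> starts v \<Longrightarrow> cre 0 x = (\<Sum>w\<in>nbs v. wt w v *\<^sub>C push v (push w x))"
proof (rule lin_eqI[of "cre 0" "\<lambda>x. \<Sum>w\<in>nbs v. wt w v *\<^sub>C push v (push w x)"])
  show "linear_on FS (\<lambda>x. \<Sum>w\<in>nbs v. wt w v *\<^sub>C push v (push w x))"
    by (intro linear_on_sum_maps linear_on_scale_map linear_on_compose[OF lin_push lin_push FS_push])
      simp
next
  fix p assume "x \<in> starts v" "p \<in> supp x"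
  then obtain q where "p = v # q" by (cases p) (auto simp: starts_def)
  then show "cre 0 (basis_vec p) = (\<Sum>w\<in>nbs v. wt w v *\<^sub>C push v (push w (basis_vec p)))"
    by (simp add: cre_basis_0)
qed (simp_all add: starts_FS)

subsection \<open>Temperley-Lieb relations\<close>

text \<open>All relations are shown by stripping the common initial segment of a path, down to the case
  where the smaller index is \<open>0\<close>.\<close>

lemma ann_cre_same_basis:
  "i < length p \<Longrightarrow> set p \<subseteq> pverts G \<Longrightarrow> ann i (cre i (basis_vec p)) = complex_of_real \<beta> *\<^sub>C basis_vec p"
proof (induction p arbitrary: i)
  case (Cons v p)
  show ?case
  proof (cases i)
    case 0
    have "ann 0 (cre 0 (basis_vec (v # p))) = (\<Sum>w\<in>nbs v. (wt w v * wt w v) *\<^sub>C basis_vec (v # p))"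
      by (simp add: cre_basis_0 lin_sum[OF lin_ann] lin_scale[OF lin_ann] ann_basis_0)
    then show ?thesis using Cons.prems 0 by (simp add: eigen flip: cfun.scale_sum_left)
  next
    case (Suc j)
    with Cons show ?thesis by (simp add: cre_Suc_basis ann_Suc_push lin_scale)
  qed
qed simp

text \<open>The zigzag relation: of the inserted detours \<open>v, w, v\<close> only the one with
  \<open>w = u\<close> survives the contraction at \<open>i\<close>. It occurs because
  \<open>u\<close> is adjacent to \<open>v\<close>, and its two weights are inverse to each
  other.\<close>

lemma ann_cre_succ_basis:
  "Suc i < length p \<Longrightarrow> vwalk p (with_proj G) \<Longrightarrow> ann i (cre (Suc i) (basis_vec p)) = basis_vec p"
proof (induction p arbitrary: i)
  case (Cons u p)
  then obtain v q where p: "p = v # q" by (cases p) auto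
  have uv: "(u, v) \<in> parcs G" "vwalk p (with_proj G)"
    using Cons.prems p by (auto simp: vwalk_def)
  show ?case
  proof (cases i)
    case 0
    have "ann 0 (cre (Suc 0) (basis_vec (u # p))) =
        (\<Sum>w\<in>nbs v. if w = u then (wt w v * wt v w) *\<^sub>C basis_vec (u # p) else 0)"
      unfolding p
      by (simp add: cre_Suc_basis cre_basis_0 lin_sum[OF lin_ann] lin_sum[OF lin_push]
          lin_scale[OF lin_ann] lin_scale[OF lin_push] ann_basis_0 if_distrib cong: if_cong sum.cong)
    also have "\<dots> = basis_vec (u # p)"
      using uv(1) arcs_verts[OF uv(1)] by (simp add: nbs_iff arcs_sym[of v u] wt_inverse)
    finally show ?thesis using 0 by simp
  next
    case (Suc j)
    with Cons uv show ?thesis by (simp add: cre_Suc_basis ann_Suc_push)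
  qed
qed simp

lemma ann_succ_cre_basis:
  "Suc i < length p \<Longrightarrow> vwalk p (with_proj G) \<Longrightarrow> ann (Suc i) (cre i (basis_vec p)) = basis_vec p"
proof (induction p arbitrary: i)
  case (Cons u p)
  then obtain v q where p: "p = v # q" by (cases p) auto
  have uv: "(u, v) \<in> parcs G" "vwalk p (with_proj G)"
    using Cons.prems p by (auto simp: vwalk_def)
  show ?case
  proof (cases i)
    case 0
    have "ann (Suc 0) (cre 0 (basis_vec (u # p))) =
        (\<Sum>w\<in>nbs u. if w = v then (wt w u * wt u w) *\<^sub>C basis_vec (u # p) else 0)"
      unfolding p
      by (simp add: ann_Suc_basis cre_basis_0 lin_sum[OF lin_ann]
          lin_scale[OF lin_ann] ann_basis_0 if_distrib lin_scale lin_zero cong: if_cong sum.cong)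
    also have "\<dots> = basis_vec (u # p)"
      using uv(1) arcs_verts[OF uv(1)] by (simp add: nbs_iff wt_inverse)
    finally show ?thesis using 0 by simp
  next
    case (Suc j)
    with Cons uv show ?thesis by (simp add: cre_Suc_basis ann_Suc_push)
  qed
qed simp

text \<open>Distant operators touch disjoint positions and commute up to the shift by 2 caused by
  the change of length. The identity holds for arbitrary lists, because out of range both sides
  vanish.\<close>

lemma ann_cre_above_basis:
  "i \<le> j \<Longrightarrow> ann i (cre (j + 2) (basis_vec p)) = cre j (ann i (basis_vec p))"
proof (induction i arbitrary: j p)
  case 0
  show ?case
  proof (cases "length p \<le> 2")
    case True
    then show ?thesis
      by (simp add: ann_basis_short cre_basis_short lin_zero)
  next
    case False
    then obtain u w v q where p: "p = u # w # v # q"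
      by (metis One_nat_def Suc_1 le_SucI length_Cons list.exhaust list.size(3) not_less_eq_eq zero_le)
    show ?thesis
      unfolding p
      by (simp add: cre_Suc_basis cre_Suc_push ann_0_push_push[OF cre_starts_basis] ann_basis_0
          lin_scale lin_zero)
  qed
next
  case (Suc i)
  then obtain k where j: "j = Suc k" by (cases j) auto
  show ?case
  proof (cases p)
    case (Cons u q)
    then show ?thesis
      using Suc j by (simp add: cre_Suc_basis ann_Suc_basis ann_Suc_push cre_Suc_push)
  qed (simp add: ann_basis_short cre_basis_short lin_zero)
qed

lemma ann_above_cre_basis:
  "j \<le> i \<Longrightarrow> ann (i + 2) (cre j (basis_vec p)) = cre j (ann i (basis_vec p))"
proof (induction j arbitrary: i p)
  case 0
  show ?case
  proof (cases p)
    case (Cons v q)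
    have "ann (i + 2) (cre 0 (basis_vec p)) = (\<Sum>w\<in>nbs v. wt w v *\<^sub>C push v (push w (ann i (basis_vec p))))"
      unfolding Cons
      by (simp add: cre_basis_0 lin_sum[OF lin_ann] lin_scale[OF lin_ann] ann_Suc_basis)
    also have "\<dots> = cre 0 (ann i (basis_vec p))"
      unfolding Cons by (rule cre_0_starts[OF ann_starts_basis, symmetric])
    finally show ?thesis .
  qed (simp add: ann_basis_short cre_basis_short lin_zero)
next
  case (Suc j)
  then obtain k where i: "i = Suc k" by (cases i) auto
  show ?case
  proof (cases p)
    case (Cons u q)
    then show ?thesis
      using Suc i by (simp add: cre_Suc_basis ann_Suc_basis ann_Suc_push cre_Suc_push)
  qed (simp add: ann_basis_short cre_basis_short lin_zero)
qed

text \<open>The exchange rule by which a word in creation operators can be sorted; the operator that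
  is passed has its index raised by 2.\<close>

lemma cre_cre_basis:
  "i \<le> j \<Longrightarrow> cre i (cre j (basis_vec p)) = cre (j + 2) (cre i (basis_vec p))"
proof (induction i arbitrary: j p)
  case 0
  show ?case
  proof (cases p)
    case (Cons v q)
    have "cre (j + 2) (cre 0 (basis_vec p)) = (\<Sum>w\<in>nbs v. wt w v *\<^sub>C push v (push w (cre j (basis_vec p))))"
      unfolding Cons
      by (simp add: cre_basis_0 lin_sum[OF lin_cre] lin_scale[OF lin_cre] cre_Suc_basis)
    also have "\<dots> = cre 0 (cre j (basis_vec p))"
      unfolding Cons by (rule cre_0_starts[OF cre_starts_basis, symmetric])
    finally show ?thesis ..
  qed (simp add: cre_basis_short lin_zero)
next
  case (Suc i)
  then obtain k where j: "j = Suc k" by (cases j) auto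
  show ?case
  proof (cases p)
    case (Cons u q)
    then show ?thesis
      using Suc j by (simp add: cre_Suc_basis cre_Suc_push)
  qed (simp add: cre_basis_short lin_zero)
qed

lemma ann_cre_above: "i \<le> j \<Longrightarrow> x \<in> FS \<Longrightarrow> ann i (cre (j + 2) x) = cre j (ann i x)"
  by (rule lin_eqI[of "\<lambda>x. ann i (cre (j + 2) x)" "\<lambda>x. cre j (ann i x)"])
    (simp_all add: linear_on_compose[where W = FS] ann_cre_above_basis del: add_2_eq_Suc')

lemma ann_above_cre: "j \<le> i \<Longrightarrow> x \<in> FS \<Longrightarrow> ann (i + 2) (cre j x) = cre j (ann i x)"
  by (rule lin_eqI[of "\<lambda>x. ann (i + 2) (cre j x)" "\<lambda>x. cre j (ann i x)"])
    (simp_all add: linear_on_compose[where W = FS] ann_above_cre_basis del: add_2_eq_Suc')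

lemma cre_cre: "i \<le> j \<Longrightarrow> x \<in> FS \<Longrightarrow> cre i (cre j x) = cre (j + 2) (cre i x)"
  by (rule lin_eqI[of "\<lambda>x. cre i (cre j x)" "\<lambda>x. cre (j + 2) (cre i x)"])
    (simp_all add: linear_on_compose[where W = FS] cre_cre_basis del: add_2_eq_Suc')

end

lemma FS_diff [simp]: "x \<in> FS \<Longrightarrow> y \<in> FS \<Longrightarrow> x - y \<in> FS"
  by (rule cfun.subspace_diff[OF FS_subspace])

lemma lin_closed:
  assumes "linear_on FS f" "cfun.subspace W" "x \<in> FS" "\<And>p. p \<in> supp x \<Longrightarrow> f (basis_vec p) \<in> W"
  shows "f x \<in> W"
  unfolding lin_expand[OF assms(1,3)] lin_ext_def
  by (intro cfun.subspace_sum cfun.subspace_scale assms)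

lemma linear_on_zero_map: "linear_on V (\<lambda>x. 0)"
  by (rule linear_onI) simp_all

section \<open>Hermitian inner products and orthogonal decomposition\<close>

lemma inner_prod_eq_sum:
  assumes "finite F" "supp x \<subseteq> F"
  shows "inner_prod x y = (\<Sum>b\<in>F. x b * cnj (y b))"
  unfolding inner_prod_def
  by (rule sum.mono_neutral_left) (use assms in \<open>auto simp: supp_def\<close>)

lemma inner_prod_add_left: "x \<in> FS \<Longrightarrow> y \<in> FS \<Longrightarrow> inner_prod (x + y) z = inner_prod x z + inner_prod y z"
  using supp_add[of x y]
  by (simp add: inner_prod_eq_sum[of "supp x \<union> supp y"] FS_def pointwise sum.distrib algebra_simps)

lemma inner_prod_scale_left: "x \<in> FS \<Longrightarrow> inner_prod (c *\<^sub>C x) z = c * inner_prod x z"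
  using supp_scale[of c x]
  by (simp add: inner_prod_eq_sum[of "supp x"] FS_def pointwise sum_distrib_left algebra_simps)

lemma inner_prod_zero_left [simp]: "inner_prod 0 z = 0"
  by (simp add: inner_prod_def)

lemma inner_prod_diff_left: "x \<in> FS \<Longrightarrow> y \<in> FS \<Longrightarrow> inner_prod (x - y) z = inner_prod x z - inner_prod y z"
  using inner_prod_add_left[of "x - y" y z] by simp

lemma inner_prod_sum_left: "(\<And>i. i \<in> I \<Longrightarrow> x i \<in> FS) \<Longrightarrow> inner_prod (\<Sum>i\<in>I. x i) z = (\<Sum>i\<in>I. inner_prod (x i) z)"
proof (induction I rule: infinite_finite_induct)
  case (insert a I)
  then have "(\<Sum>i\<in>I. x i) \<in> FS" by (intro FS_sum) auto
  with insert show ?case by (simp add: inner_prod_add_left)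
qed simp_all

lemma inner_prod_commute: "x \<in> FS \<Longrightarrow> y \<in> FS \<Longrightarrow> inner_prod y x = cnj (inner_prod x y)"
  by (simp add: inner_prod_eq_sum[of "supp x \<union> supp y"] FS_def mult.commute)

lemma inner_prod_self_eq_0:
  assumes "x \<in> FS" "inner_prod x x = 0"
  shows "x = 0"
proof -
  have "complex_of_real (\<Sum>b\<in>supp x. (cmod (x b))\<^sup>2) = 0"
    using assms(2) by (simp add: inner_prod_def complex_norm_square[symmetric])
  then have "(\<Sum>b\<in>supp x. (cmod (x b))\<^sup>2) = 0" by (simp only: of_real_eq_0_iff)
  then have "\<forall>b\<in>supp x. x b = 0"
    using assms(1) by (simp add: FS_def sum_nonneg_eq_0_iff)
  then show ?thesis by (auto simp: supp_def fun_eq_iff pointwise)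
qed

text \<open>Gram-Schmidt without normalization.\<close>
lemma orthogonal_decomposition:
  assumes "finite T" "T \<subseteq> FS" "x \<in> FS"
  shows "\<exists>d\<in>cfun.span T. \<forall>s\<in>T. inner_prod (x - d) s = 0"
  using assms
proof (induction T arbitrary: x rule: finite_induct)
  case empty
  show ?case by (auto intro: cfun.span_zero)
next
  case (insert t T)
  have span_FS: "cfun.span T \<subseteq> FS" using insert.prems(1) by (intro cfun.span_minimal FS_subspace) auto
  obtain d where d: "d \<in> cfun.span T" "\<forall>s\<in>T. inner_prod (x - d) s = 0"
    using insert.IH[of x] insert.prems by auto
  obtain e where e: "e \<in> cfun.span T" "\<forall>s\<in>T. inner_prod (t - e) s = 0"
    using insert.IH[of t] insert.prems by auto
  let ?r = "x - d" and ?q = "t - e"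
  have FS: "x \<in> FS" "d \<in> FS" "e \<in> FS" "t \<in> FS" "?r \<in> FS" "?q \<in> FS"
    using d(1) e(1) insert.prems span_FS by (auto intro: cfun.subspace_diff[OF FS_subspace])
  have orth_span: "inner_prod y e = 0" if "y \<in> FS" "\<forall>s\<in>T. inner_prod y s = 0" for y
  proof -
    have "cfun.span T \<subseteq> {z \<in> FS. inner_prod y z = 0}"
    proof (rule cfun.span_minimal)
      show "T \<subseteq> {z \<in> FS. inner_prod y z = 0}" using that(2) insert.prems(1) by auto
      have "cfun.subspace {z \<in> FS. inner_prod z y = 0}"
        using that(1) by (simp add: cfun.subspace_def inner_prod_add_left inner_prod_scale_left)
      moreover have "{z \<in> FS. inner_prod y z = 0} = {z \<in> FS. inner_prod z y = 0}"
        using that(1) by (metis inner_prod_commute complex_cnj_zero_iff)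
      ultimately show "cfun.subspace {z \<in> FS. inner_prod y z = 0}" by simp
    qed
    with e(1) show ?thesis by blast
  qed
  \<comment> \<open>\<open>?q\<close> is the component of \<open>t\<close> orthogonal to the span of
    \<open>T\<close>. If it is zero, \<open>t\<close> already lies in that span and no correction is
    made.\<close>
  define k where "k = (if ?q = 0 then 0 else inner_prod ?r ?q / inner_prod ?q ?q)"
  define d' where "d' = d + k *\<^sub>C ?q"
  have d': "d' \<in> cfun.span (insert t T)"
    unfolding d'_def using d(1) e(1) cfun.span_mono[of T "insert t T"]
    by (intro cfun.span_add cfun.span_scale cfun.span_diff) (auto intro: cfun.span_base)
  have r': "x - d' = ?r - k *\<^sub>C ?q" by (simp add: d'_def)
  have T0: "inner_prod (x - d') s = 0" if "s \<in> T" for s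
    using that d(2) e(2) FS unfolding r' by (simp add: inner_prod_diff_left inner_prod_scale_left)
  have FS': "x - d' \<in> FS" unfolding r' using FS by (intro cfun.subspace_diff[OF FS_subspace]) auto
  have "inner_prod (x - d') ?q = inner_prod ?r ?q - k * inner_prod ?q ?q"
    using FS unfolding r' by (simp add: inner_prod_diff_left inner_prod_scale_left)
  also have "\<dots> = 0"
  proof (cases "?q = 0")
    case True
    then show ?thesis unfolding True by (simp add: inner_prod_def pointwise)
  next
    case False
    then show ?thesis using FS inner_prod_self_eq_0[of ?q] by (auto simp: k_def)
  qed
  finally have "inner_prod (x - d') ?q = 0" .
  moreover have "inner_prod (x - d') e = 0" using orth_span[OF FS'] T0 by auto
  \<comment> \<open>\<open>t\<close> is the sum of \<open>?q\<close> and \<open>e\<close>, and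
    \<open>x - d'\<close> is orthogonal to both.\<close>
  ultimately have "inner_prod (x - d') t = 0"
    using inner_prod_diff_left[of t e "x - d'"] FS FS'
    by (metis inner_prod_commute complex_cnj_zero_iff diff_0_right)
  with T0 d' show ?case by (intro bexI[of _ d']) auto
qed

context perron_graph
begin

section \<open>Path spaces\<close>

abbreviation PS where "PS \<equiv> path_space G"
abbreviation E where "E \<equiv> ess_space G \<mu>"

lemma walks_Cons: "u # v # p \<in> walks (Suc n) \<longleftrightarrow> (u, v) \<in> parcs G \<and> v # p \<in> walks n"
  using arcs_verts by (auto simp: walks_def vwalk_def)

lemma walks_single: "[v] \<in> walks 0 \<longleftrightarrow> v \<in> pverts G"
  by (auto simp: walks_def vwalk_def)

lemma walks_0: "walks 0 = (\<lambda>v. [v]) ` pverts G"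
  by (auto simp: walks_def vwalk_def length_Suc_conv image_iff)

lemma walksD: "p \<in> walks n \<Longrightarrow> vwalk p (with_proj G) \<and> length p = Suc n \<and> p \<noteq> [] \<and> set p \<subseteq> pverts G"
  by (auto simp: walks_def vwalk_def)

lemma finite_walks [simp]: "finite (walks n)"
  by (rule finite_subset[OF _ finite_lists_length_eq[OF finite_verts, of "Suc n"]])
    (auto simp: walks_def vwalk_def)

lemma path_space_iff: "x \<in> PS n \<longleftrightarrow> supp x \<subseteq> walks n"
  unfolding path_space_def walks_def by (auto intro: finite_subset[OF _ finite_walks[of n, unfolded walks_def]])

lemma PS_FS: "x \<in> PS n \<Longrightarrow> x \<in> FS"
  by (simp add: path_space_def FS_def)

lemma PS_subspace: "cfun.subspace (PS n)"
  by (simp add: cfun.subspace_def path_space_iff order_trans[OF supp_add] order_trans[OF supp_scale])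

lemma basis_PS: "basis_vec p \<in> PS n \<longleftrightarrow> p \<in> walks n"
  by (simp add: path_space_iff)

lemma PS_expand: "x \<in> PS n \<Longrightarrow> x = (\<Sum>p\<in>walks n. x p *\<^sub>C basis_vec p)"
  by (rule FS_expand_on) (simp_all add: path_space_iff)

lemma PS_eqI:
  assumes "linear_on FS f" "linear_on FS g" "x \<in> PS n"
    and "\<And>p. p \<in> walks n \<Longrightarrow> f (basis_vec p) = g (basis_vec p)"
  shows "f x = g x"
  using assms(3,4) by (auto simp: path_space_iff PS_FS intro!: lin_eqI[OF assms(1,2), of x])

lemma PS_lin_closed:
  assumes "linear_on FS f" "cfun.subspace W" "x \<in> PS n"
    and "\<And>p. p \<in> walks n \<Longrightarrow> f (basis_vec p) \<in> W"
  shows "f x \<in> W"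
  using assms(3,4) by (auto simp: path_space_iff PS_FS intro!: lin_closed[OF assms(1,2), of x])

lemma push_apply: "x \<in> FS \<Longrightarrow> push u x (u' # p) = (if u = u' then x p else 0)"
proof -
  assume x: "x \<in> FS"
  have "push u x (u' # p) = (\<Sum>q\<in>supp x. if u = u' then x q * basis_vec q p else 0)"
    unfolding push_def lin_ext_apply by (rule sum.cong) (auto simp: basis_vec_def)
  then show ?thesis using x by (simp add: expand_basis FS_def)
qed

lemma push_PS:
  assumes "x \<in> PS n" "x \<in> starts v" "(u, v) \<in> parcs G"
  shows "push u x \<in> PS (Suc n)"
  using assms unfolding push_def lin_ext_def
proof (intro cfun.subspace_sum cfun.subspace_scale PS_subspace)
  fix p assume "p \<in> supp x"
  with assms have "p \<in> walks n" "p \<noteq> []" "hd p = v" by (auto simp: path_space_iff starts_def)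
  then show "basis_vec (u # p) \<in> PS (Suc n)"
    using assms(3) by (cases p) (auto simp: basis_PS walks_Cons)
qed

lemma ann_basis_PS: "p \<in> walks (n + 2) \<Longrightarrow> ann i (basis_vec p) \<in> PS n"
proof (induction i arbitrary: n p)
  case 0
  then obtain u w v q where p: "p = u # w # v # q"
    using walksD[OF 0] by (auto simp: length_Suc_conv numeral_2_eq_2)
  have "v # q \<in> walks n" using 0 p by (auto simp: walks_Cons)
  then show ?case
    by (auto simp: p ann_basis_0 basis_PS cfun.subspace_0[OF PS_subspace] intro!: cfun.subspace_scale[OF PS_subspace])
next
  case (Suc i)
  obtain u v q where p: "p = u # v # q"
    using walksD[OF Suc.prems] by (auto simp: length_Suc_conv numeral_2_eq_2)
  show ?case
  proof (cases n)
    case 0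
    then show ?thesis using walksD[OF Suc.prems] by (simp add: ann_basis_short cfun.subspace_0[OF PS_subspace])
  next
    case (Suc m)
    with Suc.prems p have "v # q \<in> walks (m + 2)" "(u, v) \<in> parcs G" by (auto simp: walks_Cons)
    with Suc.IH[OF this(1)] show ?thesis
      unfolding p Suc ann_Suc_basis by (intro push_PS[OF _ ann_starts_basis])
  qed
qed

lemma cre_basis_PS: "p \<in> walks n \<Longrightarrow> cre i (basis_vec p) \<in> PS (n + 2)"
proof (induction i arbitrary: n p)
  case 0
  then obtain v q where p: "p = v # q" using walksD[OF 0] by (cases p) auto
  show ?case
    unfolding p cre_basis_0
    by (intro cfun.subspace_sum cfun.subspace_scale PS_subspace)
      (use 0 p in \<open>auto simp: basis_PS walks_Cons nbs_iff arcs_sym\<close>)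
next
  case (Suc i)
  obtain u q where p: "p = u # q" using walksD[OF Suc.prems] by (cases p) auto
  show ?case
  proof (cases q)
    case Nil
    then show ?thesis using p by (simp add: cre_basis_short cfun.subspace_0[OF PS_subspace])
  next
    case (Cons v r)
    then obtain m where n: "n = Suc m" using walksD[OF Suc.prems] p by (cases n) auto
    with Suc.prems p Cons have "q \<in> walks m" "(u, v) \<in> parcs G" by (auto simp: walks_Cons)
    with Suc.IH[OF this(1)] show ?thesis
      unfolding p Cons n cre_Suc_basis using push_PS[OF _ cre_starts_basis, of i v r "m + 2" u] by simp
  qed
qed

lemma ann_PS: "x \<in> PS (n + 2) \<Longrightarrow> ann i x \<in> PS n"
  by (erule PS_lin_closed[OF lin_ann PS_subspace]) (rule ann_basis_PS)

lemma cre_PS: "x \<in> PS n \<Longrightarrow> cre i x \<in> PS (n + 2)"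
  by (erule PS_lin_closed[OF lin_cre PS_subspace]) (rule cre_basis_PS)

lemma ann_PS_short: "x \<in> PS n \<Longrightarrow> n < i + 2 \<Longrightarrow> ann i x = 0"
  by (rule PS_eqI[OF lin_ann linear_on_zero_map]) (auto dest!: walksD intro: ann_basis_short)

lemma cre_PS_short: "x \<in> PS n \<Longrightarrow> n < i \<Longrightarrow> cre i x = 0"
  by (rule PS_eqI[OF lin_cre linear_on_zero_map]) (auto dest!: walksD intro: cre_basis_short)

lemma ann_cre_same: "x \<in> PS n \<Longrightarrow> i \<le> n \<Longrightarrow> ann i (cre i x) = complex_of_real \<beta> *\<^sub>C x"
  by (rule PS_eqI[OF linear_on_compose[OF lin_cre lin_ann FS_cre] linear_on_scale_map[OF linear_on_id]])
    (auto dest!: walksD intro: ann_cre_same_basis)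

lemma ann_cre_succ: "x \<in> PS n \<Longrightarrow> Suc i \<le> n \<Longrightarrow> ann i (cre (Suc i) x) = x"
  by (rule PS_eqI[OF linear_on_compose[OF lin_cre lin_ann FS_cre] linear_on_id])
    (auto dest!: walksD intro: ann_cre_succ_basis)

lemma ann_succ_cre: "x \<in> PS n \<Longrightarrow> Suc i \<le> n \<Longrightarrow> ann (Suc i) (cre i x) = x"
  by (rule PS_eqI[OF linear_on_compose[OF lin_cre lin_ann FS_cre] linear_on_id])
    (auto dest!: walksD intro: ann_succ_cre_basis)

text \<open>Contracting a detour \<open>v, w, v\<close> and inserting it carry the same weight
  \<open>wt w v\<close>, so the matrices of \<open>ann i\<close> and \<open>cre i\<close> in the
  basis of walks are transposes of each other.\<close>

lemma ann_cre_adjoint: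
  "p \<in> walks (n + 2) \<Longrightarrow> q \<in> walks n \<Longrightarrow> ann i (basis_vec p) q = cre i (basis_vec q) p"
proof (induction i arbitrary: n p q)
  case 0
  obtain u w v p' where p: "p = u # w # v # p'"
    using walksD[OF 0(1)] by (auto simp: length_Suc_conv numeral_2_eq_2)
  obtain v' q' where q: "q = v' # q'" using walksD[OF 0(2)] by (cases q) auto
  have w: "w \<in> nbs v" using 0(1) p by (simp add: walks_Cons nbs_iff arcs_sym)
  have "cre 0 (basis_vec q) p = (\<Sum>w'\<in>nbs v'. if w' = w then
      (if u = v \<and> q = v # p' then wt w v else 0) else 0)"
    unfolding q cre_basis_0 sum_fun_apply cscale_apply
    by (rule sum.cong) (auto simp: p basis_vec_def)
  also have "\<dots> = (if w \<in> nbs v' then (if u = v \<and> q = v # p' then wt w v else 0) else 0)"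
    by simp
  also have "\<dots> = ann 0 (basis_vec p) q"
    using w unfolding p q ann_basis_0 by (auto simp: pointwise basis_vec_def)
  finally show ?case ..
next
  case (Suc i)
  obtain u v p' where p: "p = u # v # p'"
    using walksD[OF Suc.prems(1)] by (auto simp: length_Suc_conv numeral_2_eq_2)
  obtain u' q' where q: "q = u' # q'" using walksD[OF Suc.prems(2)] by (cases q) auto
  show ?case
  proof (cases n)
    case 0
    then show ?thesis using walksD[OF Suc.prems(1)] walksD[OF Suc.prems(2)]
      by (simp add: ann_basis_short cre_basis_short pointwise)
  next
    case (Suc m)
    obtain v' r' where q': "q' = v' # r'" using walksD[OF Suc.prems(2)] q Suc by (cases q') auto
    have "v # p' \<in> walks (m + 2)" "q' \<in> walks m"
      using Suc.prems p q q' Suc by (auto simp: walks_Cons)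
    from Suc.IH[OF this] show ?thesis
      unfolding p q ann_Suc_basis cre_Suc_basis by (auto simp: push_apply)
  qed
qed

text \<open>Transposition against the canonical element, the sum of all \<open>r \<otimes> r\<close>
  over walks \<open>r\<close>: both sides expand into one double sum of matrix entries. This is how
  a relation passes through the coproduct.\<close>

lemma sum_ann_basis:
  assumes h: "bilinear_FS h"
  shows "(\<Sum>r\<in>walks (n + 2). h (ann i (basis_vec r)) (basis_vec r)) =
    (\<Sum>q\<in>walks n. h (basis_vec q) (cre i (basis_vec q)))"
proof -
  have "h (ann i (basis_vec r)) (basis_vec r) =
      (\<Sum>q\<in>walks n. cre i (basis_vec q) r *\<^sub>C h (basis_vec q) (basis_vec r))"
    if r: "r \<in> walks (n + 2)" for r
  proof -
    have "h (ann i (basis_vec r)) (basis_vec r) =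
        h (\<Sum>q\<in>walks n. ann i (basis_vec r) q *\<^sub>C basis_vec q) (basis_vec r)"
      using PS_expand[OF ann_basis_PS[OF r]] by simp
    also have "\<dots> = (\<Sum>q\<in>walks n. ann i (basis_vec r) q *\<^sub>C h (basis_vec q) (basis_vec r))"
      by (simp add: lin_sum[OF bilinear_FS_left[OF h]] lin_scale[OF bilinear_FS_left[OF h]])
    finally show ?thesis by (simp add: ann_cre_adjoint[OF r] cong: sum.cong)
  qed
  moreover have "h (basis_vec q) (cre i (basis_vec q)) =
      (\<Sum>r\<in>walks (n + 2). cre i (basis_vec q) r *\<^sub>C h (basis_vec q) (basis_vec r))"
    if q: "q \<in> walks n" for q
  proof -
    have "h (basis_vec q) (cre i (basis_vec q)) =
        h (basis_vec q) (\<Sum>r\<in>walks (n + 2). cre i (basis_vec q) r *\<^sub>C basis_vec r)"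
      using PS_expand[OF cre_basis_PS[OF q]] by simp
    then show ?thesis
      by (simp add: lin_sum[OF bilinear_FS_right[OF h]] lin_scale[OF bilinear_FS_right[OF h]])
  qed
  ultimately show ?thesis by (simp add: sum.swap[of _ "walks n"] cong: sum.cong)
qed

lemma sum_cre_basis:
  assumes h: "bilinear_FS h"
  shows "(\<Sum>r\<in>walks (n + 2). h (basis_vec r) (ann i (basis_vec r))) =
    (\<Sum>q\<in>walks n. h (cre i (basis_vec q)) (basis_vec q))"
  using sum_ann_basis[of "\<lambda>x y. h y x"] h by (simp add: bilinear_FS_def)

text \<open>Real matrix entries make the transposes Hermitian adjoints as well, and let complex
  conjugation commute with the operators.\<close>

lemma ann_basis_real: "cnj (ann i (basis_vec p) q) = ann i (basis_vec p) q"
  by (simp add: ann_basis pointwise wt_def) (simp add: basis_vec_def)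

lemma cre_basis_real: "cnj (cre i (basis_vec p) q) = cre i (basis_vec p) q"
  by (simp add: cre_basis pointwise wt_def) (auto simp: basis_vec_def intro!: sum.cong)

lemma ann_apply:
  assumes "x \<in> PS (n + 2)" "q \<in> walks n"
  shows "ann i x q = inner_prod x (cre i (basis_vec q))"
proof -
  have "ann i x = (\<Sum>p\<in>walks (n + 2). x p *\<^sub>C ann i (basis_vec p))"
    by (subst PS_expand[OF assms(1)]) (simp add: lin_sum[OF lin_ann] lin_scale[OF lin_ann])
  then show ?thesis
    using assms
    by (simp add: inner_prod_eq_sum[of "walks (n + 2)"] path_space_iff cre_basis_real pointwise ann_cre_adjoint
        cong: sum.cong)
qed

subsection \<open>Essential paths\<close>

lemma ess_space_iff: "x \<in> E n \<longleftrightarrow> x \<in> PS n \<and> (\<forall>i. ann i x = 0)"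
  unfolding ess_space_def using ann_PS_short not_le_imp_less by blast

lemma ess_PS: "x \<in> E n \<Longrightarrow> x \<in> PS n" and ess_ann: "x \<in> E n \<Longrightarrow> ann i x = 0"
  by (auto simp: ess_space_iff)

lemma ess_FS: "x \<in> E n \<Longrightarrow> x \<in> FS"
  by (auto dest: ess_PS PS_FS)

lemma ess_subspace: "cfun.subspace (E n)"
proof -
  have "E n = {x \<in> PS n. \<forall>i. ann i x = 0}"
    by (auto simp: ess_space_iff)
  then show ?thesis
    using PS_subspace[of n] lin_add[OF lin_ann] lin_scale[OF lin_ann] lin_zero[OF lin_ann]
    by (simp add: cfun.subspace_def PS_FS[of _ n])
qed

lemma ess_space_small: "n < 2 \<Longrightarrow> E n = PS n"
  by (auto simp: ess_space_iff ann_PS_short)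

text \<open>By adjointness, the orthogonal complement of all images of creation operators is the
  common kernel of the annihilation operators. Subtracting the orthogonal projection onto the span
  of these images therefore leaves an essential path. The \<open>w i\<close> are in general not
  unique.\<close>

lemma PS_decomp:
  assumes x: "x \<in> PS (n + 2)"
  shows "\<exists>e\<in>E (n + 2). \<exists>w. (\<forall>i. w i \<in> PS n) \<and> x = e + (\<Sum>i\<le>n. cre i (w i))"
proof -
  let ?T = "(\<lambda>(i, q). cre i (basis_vec q)) ` ({..n} \<times> walks n)"
  let ?D = "{(\<Sum>i\<le>n. cre i (w i)) | w. \<forall>i. w i \<in> PS n}"
  have "?T \<subseteq> FS" by auto
  then obtain d where d: "d \<in> cfun.span ?T" "\<forall>s\<in>?T. inner_prod (x - d) s = 0"
    using orthogonal_decomposition[of ?T x] x by (auto simp: PS_FS)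
  have "cfun.subspace ?D"
    unfolding cfun.subspace_def
  proof (intro conjI ballI allI)
    show "0 \<in> ?D"
      by (rule CollectI, rule exI[of _ "\<lambda>i. 0"]) (simp add: cfun.subspace_0[OF PS_subspace] lin_zero[OF lin_cre])
  next
    fix a b assume "a \<in> ?D" "b \<in> ?D"
    then obtain v w where vw: "\<forall>i. v i \<in> PS n" "\<forall>i. w i \<in> PS n"
      "a = (\<Sum>i\<le>n. cre i (v i))" "b = (\<Sum>i\<le>n. cre i (w i))" by auto
    then have "v i \<in> FS \<and> w i \<in> FS" for i using PS_FS by blast
    with vw show "a + b \<in> ?D"
      by (intro CollectI exI[of _ "\<lambda>i. v i + w i"])
        (auto simp: lin_add[OF lin_cre] PS_FS sum.distrib cfun.subspace_add[OF PS_subspace])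
  next
    fix k a assume "a \<in> ?D"
    then obtain v where v: "\<forall>i. v i \<in> PS n" "a = (\<Sum>i\<le>n. cre i (v i))" by auto
    then have "v i \<in> FS" for i using PS_FS by blast
    with v show "k *\<^sub>C a \<in> ?D"
      by (intro CollectI exI[of _ "\<lambda>i. k *\<^sub>C v i"])
        (auto simp: lin_scale[OF lin_cre] PS_FS cfun.scale_sum_right cfun.subspace_scale[OF PS_subspace])
  qed
  moreover have "?T \<subseteq> ?D"
  proof
    fix s assume "s \<in> ?T"
    then obtain i q where "s = cre i (basis_vec q)" "i \<in> {..n}" "q \<in> walks n" by auto
    then show "s \<in> ?D"
      by (intro CollectI exI[of _ "\<lambda>j. if j = i then basis_vec q else 0"])
        (auto simp: if_distrib[of "cre _"] lin_zero[OF lin_cre] basis_PS cfun.subspace_0[OF PS_subspace] cong: if_cong)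
  qed
  ultimately have "d \<in> ?D" using d(1) cfun.span_minimal by blast
  then obtain w where w: "\<forall>i. w i \<in> PS n" "d = (\<Sum>i\<le>n. cre i (w i))" by auto
  have "d \<in> PS (n + 2)" unfolding w(2) using w(1) cre_PS by (intro cfun.subspace_sum PS_subspace) auto
  then have e: "x - d \<in> PS (n + 2)" using x by (intro cfun.subspace_diff PS_subspace)
  have "ann i (x - d) = 0" for i
  proof (cases "i \<le> n")
    case True
    \<comment> \<open>Each coefficient is the inner product of \<open>x - d\<close> with an element
      of \<open>?T\<close>.\<close>
    have "ann i (x - d) q = 0" for q
    proof (cases "q \<in> walks n")
      case True
      then show ?thesis using d(2) \<open>i \<le> n\<close> by (simp add: ann_apply[OF e])
    next
      case False
      then show ?thesis using ann_PS[OF e, of i] by (auto simp: path_space_iff supp_def)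
    qed
    then show ?thesis by (simp add: fun_eq_iff pointwise)
  qed (use ann_PS_short[OF e] in simp)
  with e have "x - d \<in> E (n + 2)" by (simp add: ess_space_iff)
  with w show ?thesis by (intro bexI[of _ "x - d"] exI[of _ w]) auto
qed


section \<open>The projection onto essential paths\<close>

lemma ann_cre_inner_prod:
  assumes x: "x \<in> PS (n + 2)" and y: "y \<in> PS n"
  shows "inner_prod (ann i x) y = inner_prod x (cre i y)"
proof -
  have y': "cre i y p = (\<Sum>q\<in>walks n. y q * cre i (basis_vec q) p)" for p
    by (subst PS_expand[OF y]) (simp add: lin_sum[OF lin_cre] lin_scale[OF lin_cre] pointwise)
  have "inner_prod x (cre i y) = (\<Sum>p\<in>walks (n + 2). \<Sum>q\<in>walks n. x p * (cnj (y q) * cre i (basis_vec q) p))"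
    using x by (simp add: inner_prod_eq_sum[of "walks (n + 2)"] path_space_iff y' cre_basis_real
        sum_distrib_left)
  also have "\<dots> = (\<Sum>q\<in>walks n. ann i x q * cnj (y q))"
    using x by (subst sum.swap)
      (simp add: ann_apply[OF x] inner_prod_eq_sum[of "walks (n + 2)"] path_space_iff cre_basis_real
        sum_distrib_left mult_ac cong: sum.cong)
  also have "\<dots> = inner_prod (ann i x) y"
    using ann_PS[OF x, of i] by (simp add: inner_prod_eq_sum[of "walks n"] path_space_iff)
  finally show ?thesis ..
qed

lemma ess_inner_prod_cre:
  assumes "e \<in> E (n + 2)" "y \<in> PS n"
  shows "inner_prod e (cre i y) = 0" "inner_prod (cre i y) e = 0"
proof -
  show *: "inner_prod e (cre i y) = 0"
    using ann_cre_inner_prod[of e n y i] assms by (simp add: ess_PS ess_ann)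
  show "inner_prod (cre i y) e = 0"
    using * inner_prod_commute[of e "cre i y"] assms by (simp add: ess_FS PS_FS)
qed

text \<open>A vector that is essential and also a sum of images of creation operators is orthogonal
  to itself.\<close>

lemma ess_cre_zero:
  assumes "\<And>i. i \<le> n \<Longrightarrow> w i \<in> PS n" "(\<Sum>i\<le>n. cre i (w i)) \<in> E (n + 2)"
  shows "(\<Sum>i\<le>n. cre i (w i)) = 0"
proof (rule inner_prod_self_eq_0)
  show "(\<Sum>i\<le>n. cre i (w i)) \<in> FS" by (rule ess_FS[OF assms(2)])
  have "inner_prod (\<Sum>i\<le>n. cre i (w i)) e = 0" if "e \<in> E (n + 2)" for e
    using that assms(1) PS_FS[of _ n]
    by (subst inner_prod_sum_left) (simp_all add: ess_inner_prod_cre)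
  from this[OF assms(2)]
  show "inner_prod (\<Sum>i\<le>n. cre i (w i)) (\<Sum>i\<le>n. cre i (w i)) = 0" .
qed

text \<open>The choice is made for basis vectors only, so that \<open>ess_part\<close> and
  \<open>cre_part\<close> are linear by construction. A walk of length \<open>n + 2\<close> has
  \<open>n + 3\<close> vertices, whence the offsets 1 and 3.\<close>

definition dec :: "'v list \<Rightarrow> ('v list \<Rightarrow> complex) \<times> (nat \<Rightarrow> 'v list \<Rightarrow> complex)"
  where "dec p = (SOME ew. fst ew \<in> E (length p - 1) \<and> (\<forall>i. snd ew i \<in> PS (length p - 3)) \<and>
    basis_vec p = fst ew + (\<Sum>i\<le>length p - 3. cre i (snd ew i)))"

definition ess_part :: "('v list \<Rightarrow> complex) \<Rightarrow> ('v list \<Rightarrow> complex)"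
  where "ess_part = lin_ext (\<lambda>p. fst (dec p))"

definition cre_part :: "nat \<Rightarrow> ('v list \<Rightarrow> complex) \<Rightarrow> ('v list \<Rightarrow> complex)"
  where "cre_part i = lin_ext (\<lambda>p. snd (dec p) i)"

lemma lin_ess_part [simp]: "linear_on FS ess_part"
  and lin_cre_part [simp]: "linear_on FS (cre_part i)"
  by (simp_all add: ess_part_def cre_part_def)

lemma dec:
  assumes "p \<in> walks (n + 2)"
  shows "fst (dec p) \<in> E (n + 2)" "snd (dec p) i \<in> PS n"
    "basis_vec p = fst (dec p) + (\<Sum>i\<le>n. cre i (snd (dec p) i))"
proof -
  have len: "length p - 1 = n + 2" "length p - 3 = n" using walksD[OF assms] by auto
  define Q where "Q ew \<longleftrightarrow> fst ew \<in> E (n + 2) \<and> (\<forall>i. snd ew i \<in> PS n) \<and>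
    basis_vec p = fst ew + (\<Sum>i\<le>n. cre i (snd ew i))" for ew
  obtain e w where "e \<in> E (n + 2)" "\<forall>i. w i \<in> PS n" "basis_vec p = e + (\<Sum>i\<le>n. cre i (w i))"
    using PS_decomp[of "basis_vec p" n] assms by (auto simp: basis_PS)
  then have ew: "Q (e, w)" by (simp add: Q_def)
  have "dec p = (SOME ew. Q ew)" by (simp only: dec_def Q_def len)
  with someI[of Q, OF ew] have "Q (dec p)" by simp
  then show "fst (dec p) \<in> E (n + 2)" "snd (dec p) i \<in> PS n"
    "basis_vec p = fst (dec p) + (\<Sum>i\<le>n. cre i (snd (dec p) i))"
    by (simp_all only: Q_def)
qed

lemma ess_part_ess: "x \<in> PS (n + 2) \<Longrightarrow> ess_part x \<in> E (n + 2)"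
  by (erule PS_lin_closed[OF lin_ess_part ess_subspace]) (simp add: ess_part_def dec(1) del: add_2_eq_Suc')

lemma cre_part_PS: "x \<in> PS (n + 2) \<Longrightarrow> cre_part i x \<in> PS n"
  by (erule PS_lin_closed[OF lin_cre_part PS_subspace]) (simp add: cre_part_def dec(2))

lemma ess_cre_parts:
  assumes x: "x \<in> PS (n + 2)"
  shows "x = ess_part x + (\<Sum>i\<le>n. cre i (cre_part i x))"
proof -
  let ?w = "walks (n + 2)"
  have "x = (\<Sum>p\<in>?w. x p *\<^sub>C (fst (dec p) + (\<Sum>i\<le>n. cre i (snd (dec p) i))))"
    by (subst PS_expand[OF x]) (rule sum.cong[OF refl], simp flip: dec(3))
  also have "\<dots> = (\<Sum>p\<in>?w. x p *\<^sub>C fst (dec p)) + (\<Sum>i\<le>n. \<Sum>p\<in>?w. x p *\<^sub>C cre i (snd (dec p) i))"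
    by (simp add: cfun.scale_right_distrib cfun.scale_sum_right sum.distrib) (rule sum.swap)
  also have "(\<Sum>p\<in>?w. x p *\<^sub>C fst (dec p)) = ess_part x"
    using x by (simp add: ess_part_def lin_ext_eq_sum[of ?w] path_space_iff)
  also have "(\<Sum>i\<le>n. \<Sum>p\<in>?w. x p *\<^sub>C cre i (snd (dec p) i)) = (\<Sum>i\<le>n. cre i (cre_part i x))"
  proof (rule sum.cong[OF refl])
    fix i
    have "snd (dec p) i \<in> FS" if "p \<in> ?w" for p
      using dec(2)[OF that] by (rule PS_FS)
    then show "(\<Sum>p\<in>?w. x p *\<^sub>C cre i (snd (dec p) i)) = cre i (cre_part i x)"
      using x by (simp add: cre_part_def lin_ext_eq_sum[of ?w] path_space_iff lin_sum[OF lin_cre]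
          lin_scale[OF lin_cre])
  qed
  finally show ?thesis .
qed

text \<open>The creation parts depend on the choice, but the essential part does not: it belongs to
  an orthogonal decomposition.\<close>

lemma ess_part_cre:
  assumes "x \<in> PS n"
  shows "ess_part (cre i x) = 0"
proof (cases "i \<le> n")
  case True
  \<comment> \<open>The difference of two decompositions of \<open>cre i x\<close>, the obvious one
    and the chosen one. Its sum of creations is \<open>ess_part (cre i x)\<close>, which
    \<open>ess_cre_zero\<close> forces to vanish.\<close>
  let ?w = "\<lambda>j. (if j = i then x else 0) - cre_part j (cre i x)"
  have z: "cre i x \<in> PS (n + 2)" by (rule cre_PS[OF assms])
  have w: "?w j \<in> PS n" for j
    using assms cre_part_PS[OF z] by (auto intro!: cfun.subspace_diff[OF PS_subspace] cfun.subspace_0[OF PS_subspace] cfun.subspace_neg[OF PS_subspace])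
  have FS: "x \<in> FS" "cre_part j (cre i x) \<in> FS" for j
    using assms cre_part_PS[OF z] by (auto intro: PS_FS)
  have "cre j (?w j) = (if j = i then cre i x else 0) - cre j (cre_part j (cre i x))" for j
    by (cases "j = i") (simp_all add: lin_diff[OF lin_cre] FS lin_zero[OF lin_cre] del: diff_0)
  then have "(\<Sum>j\<le>n. cre j (?w j)) = (\<Sum>j\<le>n. if j = i then cre i x else 0) - (\<Sum>j\<le>n. cre j (cre_part j (cre i x)))"
    by (simp only: sum_subtractf)
  also have "\<dots> = ess_part (cre i x)"
    using True ess_cre_parts[OF z] by (simp add: algebra_simps)
  finally show ?thesis
    using ess_cre_zero[of n ?w] w ess_part_ess[OF z] by simp
qed (simp add: cre_PS_short[OF assms] lin_zero[OF lin_ess_part])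

lemma ess_part_id:
  assumes "x \<in> E (n + 2)"
  shows "ess_part x = x"
proof -
  have x: "x \<in> PS (n + 2)" using assms by (rule ess_PS)
  have "(\<Sum>i\<le>n. cre i (cre_part i x)) = x - ess_part x"
    by (subst (2) ess_cre_parts[OF x]) simp
  then have "(\<Sum>i\<le>n. cre i (cre_part i x)) \<in> E (n + 2)"
    using assms ess_part_ess[OF x] by (simp add: cfun.subspace_diff[OF ess_subspace])
  then have "(\<Sum>i\<le>n. cre i (cre_part i x)) = 0"
    using cre_part_PS[OF x] by (intro ess_cre_zero)
  with ess_cre_parts[OF x] show ?thesis by simp
qed

text \<open>The recursion that the relations \<open>cre i x \<otimes> y \<sim> x \<otimes> ann i y\<close> force, given a choice of
  decompositions \<open>x = ess_part x + (\<Sum>i. cre i (cre_part i x))\<close>; the choice will turn out to be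
  irrelevant.\<close>
fun pr :: "nat \<Rightarrow> ('v list \<times> 'v list \<Rightarrow> complex) \<Rightarrow> ('v list \<times> 'v list \<Rightarrow> complex)" where
  "pr 0 X = X"
| "pr (Suc 0) X = X"
| "pr (Suc (Suc n)) X = bext (\<lambda>x y. ess_part x \<otimes>\<^sub>C ess_part y +
     (\<Sum>i\<le>n. pr n (cre_part i x \<otimes>\<^sub>C ann i y))) X"

lemma lin_pr [simp]: "linear_on FS (pr n)"
proof (cases "n < 2")
  case True
  then have "pr n = (\<lambda>X. X)" by (auto simp: less_2_cases_iff fun_eq_iff)
  then show ?thesis by (simp add: linear_on_id)
next
  case False
  then obtain m where "n = Suc (Suc m)" by (metis add_2_eq_Suc le_Suc_ex not_less)
  then have "pr n = bext (\<lambda>x y. ess_part x \<otimes>\<^sub>C ess_part y + (\<Sum>i\<le>m. pr m (cre_part i x \<otimes>\<^sub>C ann i y)))"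
    by (simp add: fun_eq_iff)
  then show ?thesis by simp
qed

text \<open>On walks all the maps involved stay inside \<open>FS\<close>; elsewhere \<open>dec\<close> is arbitrary.\<close>
lemma pr_step:
  assumes x: "x \<in> PS (n + 2)" and y: "y \<in> PS (n + 2)"
  shows "pr (n + 2) (x \<otimes>\<^sub>C y) = ess_part x \<otimes>\<^sub>C ess_part y + (\<Sum>i\<le>n. pr n (cre_part i x \<otimes>\<^sub>C ann i y))"
    (is "_ = ?f x y")
proof -
  let ?w = "walks (n + 2)"
  have FSp: "ess_part (basis_vec p) \<in> FS" "cre_part i (basis_vec p) \<in> FS" if "p \<in> ?w" for p i
    using ess_part_ess[of "basis_vec p" n] cre_part_PS[of "basis_vec p" n i] that
    by (auto simp: basis_PS intro: ess_FS PS_FS)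
  have ex: "ess_part x = (\<Sum>p\<in>?w. x p *\<^sub>C ess_part (basis_vec p))"
    "cre_part i x = (\<Sum>p\<in>?w. x p *\<^sub>C cre_part i (basis_vec p))" for i
    by (subst PS_expand[OF x], simp add: lin_sum lin_scale)+
  have ey: "ess_part y = (\<Sum>q\<in>?w. y q *\<^sub>C ess_part (basis_vec q))"
    "ann i y = (\<Sum>q\<in>?w. y q *\<^sub>C ann i (basis_vec q))" for i
    by (subst PS_expand[OF y], simp add: lin_sum lin_scale)+
  have "supp (x \<otimes>\<^sub>C y) \<subseteq> ?w \<times> ?w" using x y by (auto simp: supp_tensor path_space_iff)
  then have "pr (n + 2) (x \<otimes>\<^sub>C y) =
      (\<Sum>z\<in>?w \<times> ?w. (x \<otimes>\<^sub>C y) z *\<^sub>C (case z of (p, q) \<Rightarrow> ?f (basis_vec p) (basis_vec q)))"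
    by (simp add: bext_def lin_ext_eq_sum[of "?w \<times> ?w"])
  also have "\<dots> = (\<Sum>p\<in>?w. \<Sum>q\<in>?w. (x p * y q) *\<^sub>C ?f (basis_vec p) (basis_vec q))"
    by (simp add: sum.cartesian_product' tensor_def)
  also have "\<dots> = (\<Sum>p\<in>?w. \<Sum>q\<in>?w. (x p * y q) *\<^sub>C (ess_part (basis_vec p) \<otimes>\<^sub>C ess_part (basis_vec q))) +
      (\<Sum>i\<le>n. \<Sum>p\<in>?w. \<Sum>q\<in>?w. (x p * y q) *\<^sub>C pr n (cre_part i (basis_vec p) \<otimes>\<^sub>C ann i (basis_vec q)))"
    by (simp add: cfun.scale_right_distrib cfun.scale_sum_right sum.distrib)
      (rule trans[OF sum.cong[OF refl sum.swap] sum.swap])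
  also have "(\<Sum>p\<in>?w. \<Sum>q\<in>?w. (x p * y q) *\<^sub>C (ess_part (basis_vec p) \<otimes>\<^sub>C ess_part (basis_vec q))) =
      ess_part x \<otimes>\<^sub>C ess_part y"
    unfolding ex ey by (subst sum.swap) (simp add: tensor_sum_left tensor_sum_right tensor_scale_left tensor_scale_right
        cfun.scale_sum_right mult.commute)
  also have "(\<Sum>i\<le>n. \<Sum>p\<in>?w. \<Sum>q\<in>?w. (x p * y q) *\<^sub>C pr n (cre_part i (basis_vec p) \<otimes>\<^sub>C ann i (basis_vec q))) =
      (\<Sum>i\<le>n. pr n (cre_part i x \<otimes>\<^sub>C ann i y))"
    unfolding ex ey by (intro sum.cong refl, subst sum.swap)
      (simp add: tensor_sum_left tensor_sum_right tensor_scale_left tensor_scale_right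
        lin_sum[OF lin_pr] lin_scale[OF lin_pr] FSp cfun.scale_sum_right mult.commute)
  finally show ?thesis .
qed

lemma pr_sum_left:
  assumes "\<And>j. j \<in> J \<Longrightarrow> x j \<in> FS" "y \<in> FS"
  shows "pr n ((\<Sum>j\<in>J. x j) \<otimes>\<^sub>C y) = (\<Sum>j\<in>J. pr n (x j \<otimes>\<^sub>C y))"
  unfolding tensor_sum_left by (rule lin_sum[OF lin_pr]) (simp add: assms)

lemma pr_sum_right:
  assumes "\<And>j. j \<in> J \<Longrightarrow> x j \<in> FS" "y \<in> FS"
  shows "pr n (y \<otimes>\<^sub>C (\<Sum>j\<in>J. x j)) = (\<Sum>j\<in>J. pr n (y \<otimes>\<^sub>C x j))"
  unfolding tensor_sum_right by (rule lin_sum[OF lin_pr]) (simp add: assms)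

text \<open>The core of the existence of \<open>P\<close>: the recursion does not depend on the
  chosen decompositions. Both relations are proved in one induction because moving two operators
  past each other uses one relation on each side in a lower degree.\<close>

lemma pr_invariant:
  assumes "x \<in> PS n" "y \<in> PS (n + 2)"
  shows "pr (n + 2) (cre i x \<otimes>\<^sub>C y) = pr n (x \<otimes>\<^sub>C ann i y) \<and>
    pr (n + 2) (y \<otimes>\<^sub>C cre i x) = pr n (ann i y \<otimes>\<^sub>C x)"
  using assms
proof (induction n arbitrary: x y i rule: less_induct)
  case (less n)
  \<comment> \<open>For equal or neighbouring indices both inner operators reduce to the same
    scalar. For distant indices they are first exchanged, then the creation is moved to the left and
    the annihilation back by the induction hypothesis, and finally they are exchanged again.\<close>
  have swap: "pr n (a \<otimes>\<^sub>C ann i (cre j b)) = pr n (ann j (cre i a) \<otimes>\<^sub>C b)"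
    if ab: "a \<in> PS n" "b \<in> PS n" and ij: "i \<le> n" "j \<le> n" for a b i j
  proof -
    have FS: "a \<in> FS" "b \<in> FS" using ab by (auto intro: PS_FS)
    have "i = j \<or> j = Suc i \<or> i = Suc j \<or> (\<exists>k. j = k + 2 \<and> i \<le> k) \<or> (\<exists>k. i = k + 2 \<and> j \<le> k)"
      by presburger
    then consider "i = j" | "j = Suc i" | "i = Suc j" | k where "j = k + 2" "i \<le> k" | k where "i = k + 2" "j \<le> k"
      by blast
    then show ?thesis
    proof cases
      case 1
      then show ?thesis using ab ij by (simp add: ann_cre_same tensor_scale_left tensor_scale_right)
    next
      case 2
      then show ?thesis using ab ij by (simp add: ann_cre_succ ann_succ_cre)
    next
      case 3
      then show ?thesis using ab ij by (simp add: ann_cre_succ ann_succ_cre)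
    next
      case (4 k)
      obtain m where n: "n = m + 2" using ij(2) 4(1) by (intro that[of "n - 2"]) simp
      have m: "m < n" "ann i b \<in> PS m" "ann k a \<in> PS m" "a \<in> PS (m + 2)" "b \<in> PS (m + 2)"
        using ab n ann_PS by auto
      have "pr n (a \<otimes>\<^sub>C ann i (cre j b)) = pr (m + 2) (a \<otimes>\<^sub>C cre k (ann i b))"
        by (simp only: 4(1) n ann_cre_above[OF 4(2) FS(2)])
      also have "\<dots> = pr m (ann k a \<otimes>\<^sub>C ann i b)"
        using less.IH[OF m(1,2,4)] by blast
      also have "\<dots> = pr (m + 2) (cre i (ann k a) \<otimes>\<^sub>C b)"
        using less.IH[OF m(1,3,5), of i] by argo
      also have "\<dots> = pr n (ann j (cre i a) \<otimes>\<^sub>C b)"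
        by (simp only: 4(1) n ann_above_cre[OF 4(2) FS(1)])
      finally show ?thesis .
    next
      case (5 k)
      obtain m where n: "n = m + 2" using ij(1) 5(1) by (intro that[of "n - 2"]) simp
      have m: "m < n" "ann k b \<in> PS m" "ann j a \<in> PS m" "a \<in> PS (m + 2)" "b \<in> PS (m + 2)"
        using ab n ann_PS by auto
      have "pr n (a \<otimes>\<^sub>C ann i (cre j b)) = pr (m + 2) (a \<otimes>\<^sub>C cre j (ann k b))"
        by (simp only: 5(1) n ann_above_cre[OF 5(2) FS(2)])
      also have "\<dots> = pr m (ann j a \<otimes>\<^sub>C ann k b)"
        using less.IH[OF m(1,2,4)] by blast
      also have "\<dots> = pr (m + 2) (cre k (ann j a) \<otimes>\<^sub>C b)"
        using less.IH[OF m(1,3,5), of k] by argo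
      also have "\<dots> = pr n (ann j (cre i a) \<otimes>\<^sub>C b)"
        by (simp only: 5(1) n ann_cre_above[OF 5(2) FS(1)])
      finally show ?thesis .
    qed
  qed
  \<comment> \<open>A relation among creation operators contributes nothing: after expanding
    \<open>b\<close>, \<open>swap\<close> collects the family \<open>w\<close> into its vanishing
    sum.\<close>
  have well: "(\<Sum>i\<le>n. pr n (w i \<otimes>\<^sub>C ann i b)) = 0"
    if w: "\<And>i. w i \<in> PS n" "(\<Sum>i\<le>n. cre i (w i)) = 0" and b: "b \<in> PS (n + 2)" for w b
  proof -
    let ?b = "\<lambda>j. cre_part j b"
    have FS: "w i \<in> FS" "?b j \<in> FS" "ess_part b \<in> FS" for i j
      using w(1) cre_part_PS[OF b] ess_part_ess[OF b] by (auto intro: PS_FS ess_FS)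
    have ann_b: "ann i b = (\<Sum>j\<le>n. ann i (cre j (?b j)))" for i
      by (subst ess_cre_parts[OF b])
        (simp add: lin_add[OF lin_ann] lin_sum[OF lin_ann] FS ess_ann[OF ess_part_ess[OF b]])
    have "(\<Sum>i\<le>n. pr n (w i \<otimes>\<^sub>C ann i b)) = (\<Sum>i\<le>n. \<Sum>j\<le>n. pr n (w i \<otimes>\<^sub>C ann i (cre j (?b j))))"
      unfolding ann_b by (intro sum.cong refl pr_sum_right) (simp_all add: FS)
    also have "\<dots> = (\<Sum>i\<le>n. \<Sum>j\<le>n. pr n (ann j (cre i (w i)) \<otimes>\<^sub>C ?b j))"
      by (intro sum.cong refl swap) (simp_all add: w cre_part_PS[OF b])
    also have "\<dots> = (\<Sum>j\<le>n. pr n (ann j (\<Sum>i\<le>n. cre i (w i)) \<otimes>\<^sub>C ?b j))"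
      by (subst sum.swap) (simp add: FS pr_sum_left lin_sum[OF lin_ann])
    also have "\<dots> = 0" unfolding w(2) by (simp add: lin_zero[OF lin_ann] lin_zero[OF lin_pr])
    finally show ?thesis .
  qed
  have FS: "x \<in> FS" "y \<in> FS" using less.prems by (auto intro: PS_FS)
  show ?case
  proof (cases "i \<le> n")
    case True
    have z: "cre i x \<in> PS (n + 2)" using less.prems(1) by (rule cre_PS)
    let ?z = "\<lambda>j. cre_part j (cre i x)"
    \<comment> \<open>The obvious decomposition of \<open>cre i x\<close> minus the chosen one is
      such a relation, which \<open>well\<close> removes.\<close>
    let ?w = "\<lambda>j. (if j = i then x else 0) - ?z j"
    have w: "?w j \<in> PS n" for j
      using less.prems cre_part_PS[OF z] by (auto intro!: cfun.subspace_diff[OF PS_subspace] cfun.subspace_0[OF PS_subspace] cfun.subspace_neg[OF PS_subspace])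
    have FSz: "?z j \<in> FS" for j using cre_part_PS[OF z] by (rule PS_FS)
    have "cre j (?w j) = (if j = i then cre i x else 0) - cre j (?z j)" for j
      by (cases "j = i") (simp_all add: lin_diff[OF lin_cre] FS FSz lin_zero[OF lin_cre] del: diff_0)
    then have "(\<Sum>j\<le>n. cre j (?w j)) = (\<Sum>j\<le>n. if j = i then cre i x else 0) - (\<Sum>j\<le>n. cre j (?z j))"
      by (simp only: sum_subtractf)
    also have "\<dots> = 0"
      using True ess_cre_parts[OF z] by (simp add: ess_part_cre[OF less.prems(1)])
    finally have "(\<Sum>j\<le>n. pr n (?w j \<otimes>\<^sub>C ann j y)) = 0"
      using w less.prems(2) by (intro well)
    moreover have "pr n (?w j \<otimes>\<^sub>C ann j y) = (if j = i then pr n (x \<otimes>\<^sub>C ann i y) else 0) - pr n (?z j \<otimes>\<^sub>C ann j y)" for j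
    proof -
      have "?w j \<otimes>\<^sub>C ann j y = (if j = i then x \<otimes>\<^sub>C ann i y else 0) - ?z j \<otimes>\<^sub>C ann j y"
        by (auto simp: tensor_def fun_eq_iff pointwise algebra_simps)
      then show ?thesis using FS FSz by (simp add: lin_diff[OF lin_pr] lin_zero[OF lin_pr])
    qed
    ultimately have "pr n (x \<otimes>\<^sub>C ann i y) = (\<Sum>j\<le>n. pr n (?z j \<otimes>\<^sub>C ann j y))"
      using True by (simp add: sum_subtractf)
    then have 1: "pr (n + 2) (cre i x \<otimes>\<^sub>C y) = pr n (x \<otimes>\<^sub>C ann i y)"
      unfolding pr_step[OF z less.prems(2)] ess_part_cre[OF less.prems(1)] by simp
    let ?y = "\<lambda>j. cre_part j y"
    have FSy: "?y j \<in> FS" "ess_part y \<in> FS" for j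
      using cre_part_PS[OF less.prems(2)] ess_part_ess[OF less.prems(2)] by (auto intro: PS_FS ess_FS)
    \<comment> \<open>The essential part of \<open>cre i x\<close> is zero, so only the creation
      parts of \<open>y\<close> enter, and \<open>swap\<close> reassembles them; the essential part
      of \<open>y\<close> is later restored at no cost, since \<open>ann i\<close> kills it.\<close>
    have "pr (n + 2) (y \<otimes>\<^sub>C cre i x) = (\<Sum>j\<le>n. pr n (?y j \<otimes>\<^sub>C ann j (cre i x)))"
      unfolding pr_step[OF less.prems(2) z] ess_part_cre[OF less.prems(1)] by simp
    also have "\<dots> = (\<Sum>j\<le>n. pr n (ann i (cre j (?y j)) \<otimes>\<^sub>C x))"
      by (intro sum.cong refl swap) (simp_all add: True less.prems(1) cre_part_PS[OF less.prems(2)])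
    also have "\<dots> = pr n (ann i (\<Sum>j\<le>n. cre j (?y j)) \<otimes>\<^sub>C x)"
      using FS FSy by (simp add: lin_sum[OF lin_ann] pr_sum_left)
    also have "ann i (\<Sum>j\<le>n. cre j (?y j)) = ann i y"
      by (subst (2) ess_cre_parts[OF less.prems(2)])
        (use FSy in \<open>simp add: lin_add[OF lin_ann] ess_ann[OF ess_part_ess[OF less.prems(2)]]\<close>)
    finally show ?thesis using 1 by simp
  next
    case False
    then have "cre i x = 0" "ann i y = 0"
      using cre_PS_short[OF less.prems(1)] ann_PS_short[OF less.prems(2)] by auto
    then show ?thesis by (simp add: lin_zero[OF lin_pr] del: pr.simps)
  qed
qed

lemma pr_ess:
  assumes "x \<in> E n" "y \<in> E n"
  shows "pr n (x \<otimes>\<^sub>C y) = x \<otimes>\<^sub>C y"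
proof (cases "n < 2")
  case True
  then show ?thesis by (auto simp: less_2_cases_iff)
next
  case False
  then obtain m where n: "n = m + 2" by (metis add.commute le_Suc_ex not_less)
  show ?thesis
    using assms unfolding n
    by (subst pr_step) (simp_all add: ess_PS ess_part_id ess_ann lin_zero[OF lin_pr] del: add_2_eq_Suc')
qed


section \<open>Graded endomorphisms and the maps that respect the relations\<close>

abbreviation Q where "Q \<equiv> end_gr PS"
abbreviation A where "A \<equiv> ess_algebra G \<mu>"

lemma end_gr_subspace: "cfun.subspace (end_gr W)"
  by (simp add: end_gr_def)

lemma tensor_end_gr: "x \<in> W n \<Longrightarrow> y \<in> W n \<Longrightarrow> x \<otimes>\<^sub>C y \<in> end_gr W"
  unfolding end_gr_def by (rule cfun.span_base) blast

lemma end_gr_minimal: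
  assumes "cfun.subspace V" "\<And>n x y. x \<in> W n \<Longrightarrow> y \<in> W n \<Longrightarrow> x \<otimes>\<^sub>C y \<in> V"
  shows "end_gr W \<subseteq> V"
  unfolding end_gr_def by (rule cfun.span_minimal[OF _ assms(1)]) (use assms(2) in blast)

lemma end_gr_eqI:
  assumes "linear_on V f" "linear_on V g" "cfun.subspace V" "X \<in> end_gr W"
    and "\<And>n x y. x \<in> W n \<Longrightarrow> y \<in> W n \<Longrightarrow> x \<otimes>\<^sub>C y \<in> V"
    and "\<And>n x y. x \<in> W n \<Longrightarrow> y \<in> W n \<Longrightarrow> f (x \<otimes>\<^sub>C y) = g (x \<otimes>\<^sub>C y)"
  shows "f X = g X"
  using assms(4) unfolding end_gr_def
  by (rule linear_on_eq_span[OF assms(1-3), rotated 2]) (use assms(5,6) in blast)+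

lemma Q_FS: "Q \<subseteq> FS"
  by (rule end_gr_minimal[OF FS_subspace]) (auto intro: FS_tensor PS_FS)

lemma A_Q: "A \<subseteq> Q"
  unfolding ess_algebra_def
  by (rule end_gr_minimal[OF end_gr_subspace]) (auto intro: tensor_end_gr ess_PS)

lemma A_FS: "A \<subseteq> FS"
  using A_Q Q_FS by blast

lemma A_subspace: "cfun.subspace A"
  unfolding ess_algebra_def by (rule end_gr_subspace)

lemma tensor_A: "x \<in> E n \<Longrightarrow> y \<in> E n \<Longrightarrow> x \<otimes>\<^sub>C y \<in> A"
  unfolding ess_algebra_def by (rule tensor_end_gr)

text \<open>The length of a path selects the degree of the recursion, and \<open>lin_ext\<close>
  joins all degrees into one map that is linear on the whole of \<open>FS\<close>.\<close>

definition PP :: "('v list \<times> 'v list \<Rightarrow> complex) \<Rightarrow> ('v list \<times> 'v list \<Rightarrow> complex)"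
  where "PP = lin_ext (\<lambda>(p, q).
    if \<exists>n. p \<in> walks n \<and> q \<in> walks n then pr (length p - 1) (basis_vec (p, q)) else 0)"

lemma lin_PP [simp]: "linear_on FS PP"
  by (simp add: PP_def)

lemma PP_tensor:
  assumes "x \<in> PS n" "y \<in> PS n"
  shows "PP (x \<otimes>\<^sub>C y) = pr n (x \<otimes>\<^sub>C y)"
proof (rule lin_eqI[OF lin_PP lin_pr])
  fix b assume "b \<in> supp (x \<otimes>\<^sub>C y)"
  then obtain p q where "b = (p, q)" "p \<in> walks n" "q \<in> walks n"
    using assms by (auto simp: supp_tensor path_space_iff)
  then show "PP (basis_vec b) = pr n (basis_vec b)"
    using walksD[of p n] by (auto simp: PP_def)
qed (use assms in \<open>auto intro: FS_tensor PS_FS\<close>)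

lemma PP_cre_left: "x \<in> PS n \<Longrightarrow> y \<in> PS (n + 2) \<Longrightarrow> PP (cre i x \<otimes>\<^sub>C y) = PP (x \<otimes>\<^sub>C ann i y)"
  and PP_cre_right: "x \<in> PS n \<Longrightarrow> y \<in> PS (n + 2) \<Longrightarrow> PP (y \<otimes>\<^sub>C cre i x) = PP (ann i y \<otimes>\<^sub>C x)"
  using pr_invariant[of x n y i] PP_tensor[of "cre i x" "n + 2" y] PP_tensor[of y "n + 2" "cre i x"]
    PP_tensor[of x n "ann i y"] PP_tensor[of "ann i y" n x] cre_PS[of x n i] ann_PS[of y n i]
  by (simp_all del: add_2_eq_Suc')

lemma PP_ess_tensor: "x \<in> E n \<Longrightarrow> y \<in> E n \<Longrightarrow> PP (x \<otimes>\<^sub>C y) = x \<otimes>\<^sub>C y"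
  by (simp add: PP_tensor[OF ess_PS ess_PS] pr_ess)

lemma PP_ess:
  assumes "X \<in> A"
  shows "PP X = X"
  using assms unfolding ess_algebra_def
  by (rule end_gr_eqI[OF lin_PP linear_on_id FS_subspace]) (auto intro: PP_ess_tensor FS_tensor ess_FS)

lemma pr_closed: "x \<in> PS n \<Longrightarrow> y \<in> PS n \<Longrightarrow> pr n (x \<otimes>\<^sub>C y) \<in> A"
proof (induction n arbitrary: x y rule: less_induct)
  case (less n)
  show ?case
  proof (cases "n < 2")
    case True
    then have "x \<otimes>\<^sub>C y \<in> A" using less.prems by (intro tensor_A[of _ n]) (simp_all add: ess_space_small)
    with True show ?thesis by (auto simp: less_2_cases_iff)
  next
    case False
    then obtain m where n: "n = m + 2" by (intro that[of "n - 2"]) simp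
    have xy: "x \<in> PS (m + 2)" "y \<in> PS (m + 2)" using less.prems n by auto
    have "pr m (cre_part i x \<otimes>\<^sub>C ann i y) \<in> A" for i
      by (rule less.IH) (use n in \<open>auto intro: cre_part_PS[OF xy(1)] ann_PS[OF xy(2)]\<close>)
    then show ?thesis
      unfolding n pr_step[OF xy]
      by (intro cfun.subspace_add cfun.subspace_sum A_subspace tensor_A[of _ "m + 2"] ess_part_ess xy)
  qed
qed

lemma PP_closed: "X \<in> FS \<Longrightarrow> PP X \<in> A"
proof (rule lin_closed[OF lin_PP A_subspace])
  fix b :: "'v list \<times> 'v list"
  obtain p q where b: "b = (p, q)" by force
  show "PP (basis_vec b) \<in> A"
  proof (cases "\<exists>n. p \<in> walks n \<and> q \<in> walks n")
    case True
    then obtain n where "basis_vec p \<in> PS n" "basis_vec q \<in> PS n" by (auto simp: basis_PS)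
    then show ?thesis
      using PP_tensor[of "basis_vec p" n "basis_vec q"] pr_closed[of "basis_vec p" n "basis_vec q"]
      by (simp add: b tensor_basis_vec)
  next
    case False
    then show ?thesis by (auto simp: PP_def b cfun.subspace_0[OF A_subspace])
  qed
qed

lemma FS_PP [simp]: "X \<in> FS \<Longrightarrow> PP X \<in> FS"
  using PP_closed A_FS by blast

text \<open>The kernel of the projection is generated by the relations \<open>cre i x \<otimes> y \<sim> x \<otimes> ann i y\<close> and
  \<open>y \<otimes> cre i x \<sim> ann i y \<otimes> x\<close>: a linear map respecting them is determined by its values on
  essential paths.\<close>
definition invariant :: "(('v list \<times> 'v list \<Rightarrow> complex) \<Rightarrow> ('d \<Rightarrow> complex)) \<Rightarrow> bool"
  where "invariant F \<longleftrightarrow> linear_on FS F \<and>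
    (\<forall>n i. \<forall>x\<in>PS n. \<forall>y\<in>PS (n + 2).
      F (cre i x \<otimes>\<^sub>C y) = F (x \<otimes>\<^sub>C ann i y) \<and> F (y \<otimes>\<^sub>C cre i x) = F (ann i y \<otimes>\<^sub>C x))"

lemma invariantI:
  assumes "linear_on FS F"
    and "\<And>n i x y. x \<in> PS n \<Longrightarrow> y \<in> PS (n + 2) \<Longrightarrow> F (cre i x \<otimes>\<^sub>C y) = F (x \<otimes>\<^sub>C ann i y)"
    and "\<And>n i x y. x \<in> PS n \<Longrightarrow> y \<in> PS (n + 2) \<Longrightarrow> F (y \<otimes>\<^sub>C cre i x) = F (ann i y \<otimes>\<^sub>C x)"
  shows "invariant F"
  using assms by (simp add: invariant_def del: add_2_eq_Suc')

lemma invariant_linear: "invariant F \<Longrightarrow> linear_on FS F"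
  and invariant_left: "invariant F \<Longrightarrow> x \<in> PS n \<Longrightarrow> y \<in> PS (n + 2) \<Longrightarrow> F (cre i x \<otimes>\<^sub>C y) = F (x \<otimes>\<^sub>C ann i y)"
  and invariant_right: "invariant F \<Longrightarrow> x \<in> PS n \<Longrightarrow> y \<in> PS (n + 2) \<Longrightarrow> F (y \<otimes>\<^sub>C cre i x) = F (ann i y \<otimes>\<^sub>C x)"
  unfolding invariant_def by blast+

lemma invariant_PP: "invariant PP"
  by (rule invariantI[OF lin_PP PP_cre_left PP_cre_right])

lemma invariant_post:
  assumes "invariant F" "linear_on FS g" "\<And>X. X \<in> FS \<Longrightarrow> F X \<in> FS"
  shows "invariant (\<lambda>X. g (F X))"
  by (rule invariantI[OF linear_on_compose[OF invariant_linear[OF assms(1)] assms(2,3)]])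
    (simp_all add: invariant_left[OF assms(1)] invariant_right[OF assms(1)] del: add_2_eq_Suc')

text \<open>The relation turns each creation operator into an annihilation operator on the essential
  factor, which it kills.\<close>

lemma invariant_ess_cre:
  assumes "invariant F" "x \<in> E (n + 2)" "\<And>i. w i \<in> PS n"
  shows "F (x \<otimes>\<^sub>C (\<Sum>i\<le>n. cre i (w i))) = 0" "F ((\<Sum>i\<le>n. cre i (w i)) \<otimes>\<^sub>C x) = 0"
proof -
  note lin = invariant_linear[OF assms(1)]
  have FS: "x \<in> FS" "w i \<in> FS" for i using assms by (auto intro: ess_FS PS_FS)
  have "F (x \<otimes>\<^sub>C cre i (w i)) = 0" "F (cre i (w i) \<otimes>\<^sub>C x) = 0" for i
    using invariant_right[OF assms(1,3) ess_PS[OF assms(2)], of i i]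
      invariant_left[OF assms(1,3) ess_PS[OF assms(2)], of i i] ess_ann[OF assms(2)]
    by (simp_all add: lin_zero[OF lin])
  then show "F (x \<otimes>\<^sub>C (\<Sum>i\<le>n. cre i (w i))) = 0" "F ((\<Sum>i\<le>n. cre i (w i)) \<otimes>\<^sub>C x) = 0"
    by (simp_all add: tensor_sum_left tensor_sum_right lin_sum[OF lin] FS)
qed

text \<open>Induction on the length: up to a tensor of two essential parts, the relations shift
  every creation operator to the other side and reach length \<open>n - 2\<close>.\<close>

lemma invariant_eq_tensor:
  assumes F: "invariant F" "invariant F'"
    and eq: "\<And>n x y. x \<in> E n \<Longrightarrow> y \<in> E n \<Longrightarrow> F (x \<otimes>\<^sub>C y) = F' (x \<otimes>\<^sub>C y)"
    and "x \<in> PS n" "y \<in> PS n"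
  shows "F (x \<otimes>\<^sub>C y) = F' (x \<otimes>\<^sub>C y)"
  using assms(4,5)
proof (induction n arbitrary: x y rule: less_induct)
  case (less n)
  show ?case
  proof (cases "n < 2")
    case True
    with less.prems show ?thesis by (auto intro!: eq[of x n y] simp: ess_space_small)
  next
    case False
    then obtain m where n: "n = m + 2" by (intro that[of "n - 2"]) simp
    note lin = invariant_linear[OF F(1)] invariant_linear[OF F(2)]
    have x: "x \<in> PS (m + 2)" and y: "y \<in> PS (m + 2)" using less.prems n by auto
    let ?ex = "ess_part x" and ?ey = "ess_part y"
    let ?cx = "\<lambda>i. cre_part i x" and ?cy = "\<lambda>i. cre_part i y"
    have FS: "x \<in> FS" "y \<in> FS" "?ex \<in> FS" "?ey \<in> FS" "?cx i \<in> FS" "?cy i \<in> FS" for i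
      using x y cre_part_PS[OF x] cre_part_PS[OF y] ess_part_ess[OF x] ess_part_ess[OF y]
      by (auto intro: PS_FS ess_FS)
    have expand: "H (x \<otimes>\<^sub>C y) = H (?ex \<otimes>\<^sub>C ?ey) + (\<Sum>i\<le>m. H (?cx i \<otimes>\<^sub>C ann i y))" if H: "invariant H" for H :: "_ \<Rightarrow> 'a \<Rightarrow> complex"
    proof -
      note lin = invariant_linear[OF H]
      \<comment> \<open>\<open>y\<close> is decomposed only against the essential part of
        \<open>x\<close>, where its creation parts vanish; against the creation parts of
        \<open>x\<close> it is kept whole and receives the annihilations.\<close>
      have "x \<otimes>\<^sub>C y = ?ex \<otimes>\<^sub>C y + (\<Sum>i\<le>m. cre i (?cx i)) \<otimes>\<^sub>C y"
        by (subst ess_cre_parts[OF x]) (rule tensor_add_left)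
      moreover have "?ex \<otimes>\<^sub>C y = ?ex \<otimes>\<^sub>C ?ey + ?ex \<otimes>\<^sub>C (\<Sum>i\<le>m. cre i (?cy i))"
        by (subst ess_cre_parts[OF y]) (rule tensor_add_right)
      ultimately have "H (x \<otimes>\<^sub>C y) = H (?ex \<otimes>\<^sub>C ?ey) + H ((\<Sum>i\<le>m. cre i (?cx i)) \<otimes>\<^sub>C y)"
        using FS invariant_ess_cre(1)[OF H ess_part_ess[OF x] cre_part_PS[OF y]]
        by (simp add: lin_add[OF lin])
      also have "H ((\<Sum>i\<le>m. cre i (?cx i)) \<otimes>\<^sub>C y) = (\<Sum>i\<le>m. H (cre i (?cx i) \<otimes>\<^sub>C y))"
        using FS by (simp add: tensor_sum_left lin_sum[OF lin])
      finally show ?thesis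
        by (simp add: invariant_left[OF H cre_part_PS[OF x] y])
    qed
    have "F (?cx i \<otimes>\<^sub>C ann i y) = F' (?cx i \<otimes>\<^sub>C ann i y)" for i
      by (rule less.IH[of m]) (use n in \<open>auto intro: cre_part_PS[OF x] ann_PS[OF y]\<close>)
    then show ?thesis
      unfolding expand[OF F(1)] expand[OF F(2)] eq[OF ess_part_ess[OF x] ess_part_ess[OF y]] by simp
  qed
qed

lemma invariant_eqI:
  assumes "invariant F" "invariant F'"
    and "\<And>n x y. x \<in> E n \<Longrightarrow> y \<in> E n \<Longrightarrow> F (x \<otimes>\<^sub>C y) = F' (x \<otimes>\<^sub>C y)"
    and "X \<in> Q"
  shows "F X = F' X"
  using assms(4)
  by (rule end_gr_eqI[OF invariant_linear[OF assms(1)] invariant_linear[OF assms(2)] FS_subspace])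
    (auto intro: FS_tensor PS_FS invariant_eq_tensor[OF assms(1-3)])

text \<open>The working tool for the axioms: a projection in front of an invariant map may be
  dropped or inserted. The composite with \<open>PP\<close> is invariant too and has the same values
  on essential tensors.\<close>

lemma invariant_PP_eq:
  assumes "invariant F" "X \<in> Q"
  shows "F (PP X) = F X"
  by (rule invariant_eqI[OF invariant_post[OF invariant_PP invariant_linear[OF assms(1)]] assms(1) _ assms(2)])
    (simp_all add: PP_ess_tensor)

subsection \<open>Words in the creation operators\<close>

text \<open>The second argument counts creation operators. The indices are left unrestricted, so
  that the Temperley-Lieb relations preserve the count; comparing counts yields the vanishing of
  \<open>P\<close> on words with different numbers of creations.\<close>

primrec cspan :: "nat \<Rightarrow> nat \<Rightarrow> ('v list \<Rightarrow> complex) set" where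
  "cspan n 0 = E n"
| "cspan n (Suc k) = cfun.span {cre i x | i x. x \<in> cspan n k}"

lemma cspan_subspace: "cfun.subspace (cspan n k)"
  by (cases k) (simp_all add: ess_subspace)

lemma cspan_PS: "cspan n k \<subseteq> PS (n + 2 * k)"
proof (induction k)
  case 0
  then show ?case by (auto intro: ess_PS)
next
  case (Suc k)
  have "{cre i x | i x. x \<in> cspan n k} \<subseteq> PS (n + 2 * k + 2)" using Suc cre_PS by blast
  then show ?case using cfun.span_minimal[OF _ PS_subspace] by (simp add: add.assoc)
qed

lemma cspan_FS: "x \<in> cspan n k \<Longrightarrow> x \<in> FS"
  using cspan_PS PS_FS by blast

lemma cspan_cre: "x \<in> cspan n k \<Longrightarrow> cre i x \<in> cspan n (Suc k)"
  by (auto intro: cfun.span_base)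

lemma span_lin_image:
  assumes "linear_on FS f" "T \<subseteq> FS" "cfun.subspace W" "\<And>x. x \<in> T \<Longrightarrow> f x \<in> W" "x \<in> cfun.span T"
  shows "f x \<in> W"
proof -
  have "cfun.subspace {x \<in> FS. f x \<in> W}"
    using assms(3) lin_zero[OF assms(1)] lin_add[OF assms(1)] lin_scale[OF assms(1)]
    by (simp add: cfun.subspace_def)
  then have "cfun.span T \<subseteq> {x \<in> FS. f x \<in> W}"
    by (rule cfun.span_minimal[rotated]) (use assms(2,4) in auto)
  with assms(5) show ?thesis by blast
qed

text \<open>An annihilation cancels exactly one creation: at an equal or neighbouring index the pair
  contracts to a scalar, at a distance the annihilation passes on to the inner word, and on an
  essential path it gives zero.\<close>

lemma ann_cspan_aux: "x \<in> cspan n k \<Longrightarrow> ann i x \<in> (case k of 0 \<Rightarrow> {0} | Suc l \<Rightarrow> cspan n l)"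
proof (induction k arbitrary: i x)
  case 0
  then show ?case by (simp add: ess_ann)
next
  case (Suc k)
  let ?T = "{cre i x | i x. x \<in> cspan n k}"
  note zero = cfun.subspace_0[OF cspan_subspace]
  have "ann i z \<in> cspan n k" if zT: "z \<in> ?T" for z
  proof -
    obtain j y where z: "z = cre j y" and y: "y \<in> cspan n k" using zT by blast
    let ?m = "n + 2 * k"
    have yP: "y \<in> PS ?m" using y cspan_PS by blast
    have yF: "y \<in> FS" using yP by (rule PS_FS)
    have ca: "cre l (ann i' y) \<in> cspan n k" for l i'
    proof (cases k)
      case 0
      then show ?thesis using Suc.IH[OF y, of i'] zero[of n k] by (simp add: lin_zero[OF lin_cre])
    next
      case (Suc k')
      then show ?thesis using Suc.IH[OF y, of i'] cspan_cre by simp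
    qed
    show ?thesis
    proof (cases "i \<le> ?m \<and> j \<le> ?m")
      case True
      have "i = j \<or> j = Suc i \<or> i = Suc j \<or> (\<exists>l. j = l + 2 \<and> i \<le> l) \<or> (\<exists>l. i = l + 2 \<and> j \<le> l)"
        by presburger
      then consider "i = j" | "j = Suc i" | "i = Suc j" | l where "j = l + 2" "i \<le> l" | l where "i = l + 2" "j \<le> l"
        by blast
      then show ?thesis
      proof cases
        case 1
        then show ?thesis using True y by (simp add: z ann_cre_same[OF yP] cfun.subspace_scale[OF cspan_subspace])
      next
        case 2
        then show ?thesis using True y by (simp add: z ann_cre_succ[OF yP])
      next
        case 3
        then show ?thesis using True y by (simp add: z ann_succ_cre[OF yP])
      next
        case 4
        then show ?thesis using ca by (simp add: z ann_cre_above[OF _ yF] del: add_2_eq_Suc')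
      next
        case 5
        then show ?thesis using ca by (simp add: z ann_above_cre[OF _ yF] del: add_2_eq_Suc')
      qed
    next
      case False
      then have "ann i z = 0"
        using cre_PS_short[OF yP, of j] ann_PS_short[OF cre_PS[OF yP, of j], of i]
        by (auto simp: z lin_zero[OF lin_ann] not_le)
      then show ?thesis using zero by simp
    qed
  qed
  moreover have "?T \<subseteq> FS" using cspan_FS by (auto intro!: FS_cre)
  ultimately show ?case
    using Suc.prems span_lin_image[OF lin_ann _ cspan_subspace, of ?T i n k x] by simp
qed

lemma ann_cspan: "x \<in> cspan n (Suc k) \<Longrightarrow> ann i x \<in> cspan n k"
  using ann_cspan_aux[of x n "Suc k" i] by simp

lemma creates_cspan: "x \<in> cspan n k \<Longrightarrow> creates G \<mu> js x \<in> cspan n (k + length js)"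
proof (induction js arbitrary: x k)
  case (Cons j js)
  show ?case using Cons.IH[OF cspan_cre[OF Cons.prems, of j]] by simp
qed simp

lemma annihs_cspan:
  "x \<in> cspan n k \<Longrightarrow> (if length is \<le> k then annihs \<mu> is x \<in> cspan n (k - length is) else annihs \<mu> is x = 0)"
proof (induction "is")
  case (Cons i "is")
  show ?case
  proof (cases "length (i # is) \<le> k")
    case True
    then have "k - length is = Suc (k - length (i # is))" by simp
    then have "annihs \<mu> is x \<in> cspan n (Suc (k - length (i # is)))"
      using Cons True by (simp del: cspan.simps)
    from ann_cspan[OF this] True show ?thesis by simp
  next
    case False
    show ?thesis
    proof (cases "length is = k")
      case True
      then have "annihs \<mu> is x \<in> cspan n 0" using Cons by simp
      then show ?thesis using True by (simp add: ess_ann)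
    next
      case 2: False
      then show ?thesis using False Cons by (simp add: lin_zero[OF lin_ann])
    qed
  qed
qed simp

lemma creates_PS: "x \<in> PS m \<Longrightarrow> creates G \<mu> js x \<in> PS (m + 2 * length js)"
proof (induction js arbitrary: x m)
  case (Cons j js)
  show ?case using Cons.IH[OF cre_PS[OF Cons.prems, of j]] by simp
qed simp

lemma annihs_PS: "x \<in> PS (m + 2 * length is) \<Longrightarrow> annihs \<mu> is x \<in> PS m"
proof (induction "is" arbitrary: m)
  case (Cons i "is")
  have "annihs \<mu> is x \<in> PS (m + 2)" using Cons by simp
  from ann_PS[OF this] show ?case by simp
qed simp

text \<open>The outermost creation operator crosses first, which is why the annihilations act in the
  order of \<open>foldr\<close>.\<close>

lemma invariant_creates_right:
  assumes F: "invariant F"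
  shows "y \<in> PS m \<Longrightarrow> x \<in> PS (m + 2 * length is) \<Longrightarrow>
    F (x \<otimes>\<^sub>C creates G \<mu> is y) = F (annihs \<mu> is x \<otimes>\<^sub>C y)"
proof (induction "is" arbitrary: y m)
  case (Cons i "is")
  have x: "x \<in> PS (m + 2 + 2 * length is)" using Cons.prems(2) by simp
  show ?case
    using Cons.IH[OF cre_PS[OF Cons.prems(1)] x] invariant_right[OF F Cons.prems(1) annihs_PS[OF x]]
    by simp
qed simp

lemma invariant_creates_left:
  assumes F: "invariant F"
  shows "y \<in> PS m \<Longrightarrow> x \<in> PS (m + 2 * length is) \<Longrightarrow>
    F (creates G \<mu> is y \<otimes>\<^sub>C x) = F (y \<otimes>\<^sub>C annihs \<mu> is x)"
proof (induction "is" arbitrary: y m)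
  case (Cons i "is")
  have x: "x \<in> PS (m + 2 + 2 * length is)" using Cons.prems(2) by simp
  show ?case
    using Cons.IH[OF cre_PS[OF Cons.prems(1)] x] invariant_left[OF F Cons.prems(1) annihs_PS[OF x]]
    by simp
qed simp

section \<open>Expansions in orthonormal bases of essential paths\<close>

lemma ess_onb_expand:
  assumes B: "ess_onb G \<mu> n B" and x: "x \<in> E n"
  shows "x = (\<Sum>b\<in>B. inner_prod x b *\<^sub>C b)"
proof -
  have BE: "B \<subseteq> E n" and fin: "finite B"
    using B cfun.span_superset[of B] by (auto simp: ess_onb_def)
  have BF: "B \<subseteq> FS" using BE ess_FS by blast
  have lin: "linear_on FS (\<lambda>x. \<Sum>b\<in>B. inner_prod x b *\<^sub>C b)"
    by (rule linear_onI) (simp_all add: inner_prod_add_left inner_prod_scale_left cfun.scale_left_distrib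
        sum.distrib cfun.scale_sum_right)
  show ?thesis
  proof (rule linear_on_eq_span[OF linear_on_id lin FS_subspace BF])
    fix b assume b: "b \<in> B"
    have "(\<Sum>c\<in>B. inner_prod b c *\<^sub>C c) = (\<Sum>c\<in>B. if c = b then c else 0)"
      using B b by (intro sum.cong) (auto simp: ess_onb_def)
    then show "b = (\<Sum>c\<in>B. inner_prod b c *\<^sub>C c)" using b fin by simp
  qed (use B x in \<open>simp add: ess_onb_def\<close>)
qed

lemma ess_onb_subset: "ess_onb G \<mu> n B \<Longrightarrow> B \<subseteq> E n"
  using cfun.span_superset[of B] by (auto simp: ess_onb_def)

text \<open>A linear map that vanishes on the images of the creation operators factors through the
  orthogonal projection onto the essential paths.\<close>
lemma lin_ess_expand:
  assumes f: "linear_on FS f" "\<And>m i y. n = m + 2 \<Longrightarrow> y \<in> PS m \<Longrightarrow> f (cre i y) = 0"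
    and B: "ess_onb G \<mu> n B" and z: "z \<in> PS n"
  shows "f z = (\<Sum>c\<in>B. inner_prod z c *\<^sub>C f c)"
proof -
  have "\<exists>e\<in>E n. f z = f e \<and> (\<forall>c\<in>B. inner_prod z c = inner_prod e c)"
  proof (cases "n < 2")
    case True
    then show ?thesis using z by (intro bexI[of _ z]) (simp_all add: ess_space_small)
  next
    case False
    then obtain m where n: "n = m + 2" by (intro that[of "n - 2"]) simp
    have z': "z \<in> PS (m + 2)" using z n by auto
    have FS: "ess_part z \<in> FS" "cre_part i z \<in> FS" for i
      using cre_part_PS[OF z'] ess_part_ess[OF z'] by (auto intro: PS_FS ess_FS)
    show ?thesis
    proof (intro bexI[of _ "ess_part z"] conjI ballI)
      have "f z = f (ess_part z + (\<Sum>i\<le>m. cre i (cre_part i z)))"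
        using ess_cre_parts[OF z'] by simp
      then show "f z = f (ess_part z)"
        using FS f(2)[OF n cre_part_PS[OF z']] by (simp add: lin_add[OF f(1)] lin_sum[OF f(1)])
      show "ess_part z \<in> E n" unfolding n by (rule ess_part_ess[OF z'])
      fix c assume "c \<in> B"
      then have c: "c \<in> E (m + 2)" using ess_onb_subset[OF B] n by auto
      have "inner_prod z c = inner_prod (ess_part z + (\<Sum>i\<le>m. cre i (cre_part i z))) c"
        using ess_cre_parts[OF z'] by simp
      also have "\<dots> = inner_prod (ess_part z) c"
        using FS by (simp add: inner_prod_add_left inner_prod_sum_left ess_inner_prod_cre(2)[OF c cre_part_PS[OF z']])
      finally show "inner_prod z c = inner_prod (ess_part z) c" .
    qed
  qed
  then obtain e where e: "e \<in> E n" "f z = f e" "\<forall>c\<in>B. inner_prod z c = inner_prod e c"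
    by blast
  have BF: "c \<in> FS" if "c \<in> B" for c using that ess_onb_subset[OF B] ess_FS by blast
  have "f e = f (\<Sum>c\<in>B. inner_prod e c *\<^sub>C c)"
    by (rule arg_cong[OF ess_onb_expand[OF B e(1)]])
  also have "\<dots> = (\<Sum>c\<in>B. inner_prod e c *\<^sub>C f c)"
    by (simp add: lin_sum[OF f(1)] lin_scale[OF f(1)] BF)
  finally have "f e = (\<Sum>c\<in>B. inner_prod e c *\<^sub>C f c)" .
  with e show ?thesis by simp
qed

text \<open>Against an essential right factor, \<open>PP\<close> acts on the left factor as the
  orthogonal projection onto essential paths: images of creation operators cross over and are
  killed.\<close>

lemma PP_ess_right:
  assumes B: "ess_onb G \<mu> n B" and z: "z \<in> PS n" and b: "b \<in> E n"
  shows "PP (z \<otimes>\<^sub>C b) = (\<Sum>c\<in>B. inner_prod z c *\<^sub>C (c \<otimes>\<^sub>C b))"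
proof -
  have "PP (z \<otimes>\<^sub>C b) = (\<Sum>c\<in>B. inner_prod z c *\<^sub>C PP (c \<otimes>\<^sub>C b))"
  proof (rule lin_ess_expand[OF _ _ B z])
    show "linear_on FS (\<lambda>z. PP (z \<otimes>\<^sub>C b))"
      using b by (intro linear_on_compose[OF bilinear_FS_left[OF bilinear_FS_tensor] lin_PP]) (simp_all add: ess_FS)
    show "PP (cre i y \<otimes>\<^sub>C b) = 0" if "n = m + 2" "y \<in> PS m" for m i y
      using PP_cre_left[of y m b i] that b by (simp add: ess_PS ess_ann lin_zero[OF lin_PP] del: add_2_eq_Suc')
  qed
  then show ?thesis
    using ess_onb_subset[OF B] b by (simp add: PP_ess_tensor[of _ n] subset_iff cong: sum.cong)
qed

section \<open>Existence and uniqueness of the projection\<close>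

lemma creates_indices_PS:
  assumes "js \<in> create_indices n" "x \<in> PS (n - 2 * length js)"
  shows "creates G \<mu> js x \<in> PS n"
  using creates_PS[OF assms(2), of js] assms(1) by (simp add: create_indices_def)

text \<open>Moving the word \<open>is\<close> to the left leaves an essential right factor, where
  \<open>PP_ess_right\<close> gives the prescribed orthogonal projection.\<close>

lemma is_ess_proj_PP: "is_ess_proj G \<mu> (\<lambda>X. if X \<in> Q then PP X else 0)"
  unfolding is_ess_proj_def
proof (intro conjI allI ballI impI)
  show "linear_on Q (\<lambda>X. if X \<in> Q then PP X else 0)"
    using Q_FS end_gr_subspace[of PS]
    by (intro linear_onI) (auto simp: cfun.subspace_def lin_add[OF lin_PP] lin_scale[OF lin_PP] subset_iff)
next
  fix n js "is" xa xb
  assume js: "js \<in> create_indices n" and "is": "is \<in> create_indices n"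
    and xa: "xa \<in> E (n - 2 * length js)" and xb: "xb \<in> E (n - 2 * length is)"
  let ?u = "creates G \<mu> js xa" and ?v = "creates G \<mu> is xb"
  have u: "?u \<in> PS n" and v: "?v \<in> PS n"
    using js "is" xa xb by (auto intro: creates_indices_PS ess_PS)
  have Q: "?u \<otimes>\<^sub>C ?v \<in> Q" using u v by (rule tensor_end_gr)
  have len: "n - 2 * length js + 2 * length js = n" "n - 2 * length is + 2 * length is = n"
    using js "is" by (auto simp: create_indices_def)
  have right: "PP (?u \<otimes>\<^sub>C ?v) = PP (annihs \<mu> is ?u \<otimes>\<^sub>C xb)"
    using u len by (intro invariant_creates_right[OF invariant_PP ess_PS[OF xb]]) simp
  have left: "PP (?u \<otimes>\<^sub>C ?v) = PP (xa \<otimes>\<^sub>C annihs \<mu> js ?v)"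
    using v len by (intro invariant_creates_left[OF invariant_PP ess_PS[OF xa]]) simp
  show "(if ?u \<otimes>\<^sub>C ?v \<in> Q then PP (?u \<otimes>\<^sub>C ?v) else 0) =
      (\<Sum>c\<in>B. inner_prod (annihs \<mu> is ?u) c *\<^sub>C (c \<otimes>\<^sub>C xb))"
    if "length js = length is" and B: "ess_onb G \<mu> (n - 2 * length js) B" for B
  proof -
    have "annihs \<mu> is ?u \<in> PS (n - 2 * length is)" using u len by (intro annihs_PS) simp
    then show ?thesis using Q right PP_ess_right[of "n - 2 * length is" B _ xb] that xb by simp
  qed
  show "(if ?u \<otimes>\<^sub>C ?v \<in> Q then PP (?u \<otimes>\<^sub>C ?v) else 0) = 0" if ne: "length js \<noteq> length is"
  proof -
    have cu: "?u \<in> cspan (n - 2 * length js) (length js)" and cv: "?v \<in> cspan (n - 2 * length is) (length is)"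
      using creates_cspan[of xa _ 0 js] creates_cspan[of xb _ 0 "is"] xa xb by auto
    have "PP (?u \<otimes>\<^sub>C ?v) = 0"
    \<comment> \<open>The longer word is moved across, and its annihilations outnumber the creations
      that they meet.\<close>
    proof (cases "length js < length is")
      case True
      then have "annihs \<mu> is ?u = 0" using annihs_cspan[OF cu, of "is"] by simp
      then show ?thesis using right by (simp add: lin_zero[OF lin_PP])
    next
      case False
      then have "annihs \<mu> js ?v = 0" using annihs_cspan[OF cv, of js] ne by simp
      then show ?thesis using left by (simp add: lin_zero[OF lin_PP])
    qed
    then show ?thesis by simp
  qed
qed simp

text \<open>Insertion into a sorted word by the exchange rule. An old index grows by at most 2,
  hence the bound \<open>a + 2 \<le> M\<close>; it is stated for all \<open>M\<close> at once
  because the induction also needs it with a bound depending on the last index.\<close>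

lemma cre_creates_sorted:
  assumes "sorted_wrt (<) js" "x \<in> FS"
  shows "\<exists>js'. sorted_wrt (<) js' \<and> length js' = Suc (length js) \<and>
    (\<forall>M. i \<le> M \<longrightarrow> (\<forall>a\<in>set js. a + 2 \<le> M) \<longrightarrow> (\<forall>a\<in>set js'. a \<le> M)) \<and>
    cre i (creates G \<mu> js x) = creates G \<mu> js' x"
  using assms
proof (induction js rule: rev_induct)
  case Nil
  show ?case by (rule exI[of _ "[i]"]) simp
next
  case (snoc j js)
  have FS: "creates G \<mu> js x \<in> FS" using snoc.prems(2)
    by (induction js arbitrary: x) auto
  show ?case
  proof (cases "i \<le> j")
    case True
    obtain js' where js': "sorted_wrt (<) js'" "length js' = Suc (length js)"
      "\<forall>M. i \<le> M \<longrightarrow> (\<forall>a\<in>set js. a + 2 \<le> M) \<longrightarrow> (\<forall>a\<in>set js'. a \<le> M)"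
      "cre i (creates G \<mu> js x) = creates G \<mu> js' x"
      using snoc by (auto simp: sorted_wrt_append)
    \<comment> \<open>The bound is used with \<open>M = j + 1\<close>: the new word then stays below
      \<open>j + 2\<close>, the raised index of the operator that was passed.\<close>
    have "\<forall>a\<in>set js. a + 2 \<le> j + 1" using snoc.prems(1) by (auto simp: sorted_wrt_append)
    with js'(3) True have "\<forall>a\<in>set js'. a \<le> j + 1" by simp
    then have "sorted_wrt (<) (js' @ [j + 2])" using js'(1) by (auto simp: sorted_wrt_append)
    moreover have "cre i (creates G \<mu> (js @ [j]) x) = creates G \<mu> (js' @ [j + 2]) x"
      using cre_cre[OF True FS] js'(4) by simp
    ultimately show ?thesis using js'(2,3) by (intro exI[of _ "js' @ [j + 2]"]) auto
  next
    case False
    then have "sorted_wrt (<) (js @ [j, i])" using snoc.prems(1) by (auto simp: sorted_wrt_append)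
    then show ?thesis by (intro exI[of _ "js @ [j, i]"]) auto
  qed
qed

definition words :: "nat \<Rightarrow> ('v list \<Rightarrow> complex) set"
  where "words n = {creates G \<mu> js x | js x. js \<in> create_indices n \<and> x \<in> E (n - 2 * length js)}"

lemma words_PS: "words n \<subseteq> PS n"
  by (auto simp: words_def intro: creates_indices_PS ess_PS)

lemma ess_words: "E n \<subseteq> words n"
proof
  fix x assume "x \<in> E n"
  then show "x \<in> words n"
    unfolding words_def by (intro CollectI exI[of _ "[]"] exI[of _ x]) (simp add: create_indices_def)
qed

lemma cre_words:
  assumes "x \<in> words n" "i \<le> n"
  shows "cre i x \<in> words (n + 2)"
proof -
  obtain js y where js: "js \<in> create_indices n" and y: "y \<in> E (n - 2 * length js)" and x: "x = creates G \<mu> js y"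
    using assms(1) by (auto simp: words_def)
  have "sorted_wrt (<) js" using js by (simp add: create_indices_def)
  from cre_creates_sorted[OF this ess_FS[OF y], of i]
  obtain js' where js': "sorted_wrt (<) js'" "length js' = Suc (length js)"
    "\<forall>M. i \<le> M \<longrightarrow> (\<forall>a\<in>set js. a + 2 \<le> M) \<longrightarrow> (\<forall>a\<in>set js'. a \<le> M)" "cre i x = creates G \<mu> js' y"
    using x by auto
  have "\<forall>a\<in>set js'. a \<le> n" using js'(3) assms(2) js by (simp add: create_indices_def)
  then have "js' \<in> create_indices (n + 2)" using js js'(1,2) by (simp add: create_indices_def)
  moreover have "y \<in> E (n + 2 - 2 * length js')" using y js'(2) by simp
  ultimately show ?thesis using js'(4) unfolding words_def by blast
qed

text \<open>By induction on the length: the essential part is the empty word, and each creation part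
  is one more creation on a shorter word, which \<open>cre_words\<close> brings into sorted
  form.\<close>

lemma span_words: "PS n \<subseteq> cfun.span (words n)"
proof (induction n rule: less_induct)
  case (less n)
  show ?case
  proof (cases "n < 2")
    case True
    then show ?thesis using ess_words cfun.span_superset[of "words n"] ess_space_small by blast
  next
    case False
    then obtain m where n: "n = m + 2" by (intro that[of "n - 2"]) simp
    have WF: "words k \<subseteq> FS" for k using words_PS PS_FS by blast
    show ?thesis
    proof
      fix x assume "x \<in> PS n"
      then have x: "x \<in> PS (m + 2)" using n by simp
      have "cre i (cre_part i x) \<in> cfun.span (words n)" if "i \<le> m" for i
        using span_lin_image[OF lin_cre WF cfun.subspace_span, of m i "words n" "cre_part i x"]
          cre_words[OF _ that] less.IH[of m] cre_part_PS[OF x, of i] n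
        by (auto intro: cfun.span_base simp del: add_2_eq_Suc')
      moreover have "ess_part x \<in> cfun.span (words n)"
        using ess_part_ess[OF x] ess_words[of n] n by (auto intro: cfun.span_base simp del: add_2_eq_Suc')
      ultimately show "x \<in> cfun.span (words n)"
        by (subst ess_cre_parts[OF x]) (intro cfun.span_add cfun.span_sum, auto)
    qed
  qed
qed

lemma is_ess_projD:
  assumes "is_ess_proj G \<mu> P" "js \<in> create_indices n" "is \<in> create_indices n"
    "a \<in> E (n - 2 * length js)" "b \<in> E (n - 2 * length is)"
  shows "length js = length is \<Longrightarrow> ess_onb G \<mu> (n - 2 * length js) B \<Longrightarrow>
      P (creates G \<mu> js a \<otimes>\<^sub>C creates G \<mu> is b) =
      (\<Sum>c\<in>B. inner_prod (annihs \<mu> is (creates G \<mu> js a)) c *\<^sub>C (c \<otimes>\<^sub>C b))"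
    and "length js \<noteq> length is \<Longrightarrow> P (creates G \<mu> js a \<otimes>\<^sub>C creates G \<mu> is b) = 0"
proof -
  note * = assms(1)[unfolded is_ess_proj_def, THEN conjunct2, THEN conjunct1,
      THEN spec, THEN bspec, OF assms(2), THEN bspec, OF assms(3), THEN bspec, OF assms(4),
      THEN bspec, OF assms(5)]
  show "P (creates G \<mu> js a \<otimes>\<^sub>C creates G \<mu> is b) =
      (\<Sum>c\<in>B. inner_prod (annihs \<mu> is (creates G \<mu> js a)) c *\<^sub>C (c \<otimes>\<^sub>C b))"
    if "length js = length is" "ess_onb G \<mu> (n - 2 * length js) B"
    using *[THEN conjunct1, rule_format, OF that] .
  show "P (creates G \<mu> js a \<otimes>\<^sub>C creates G \<mu> is b) = 0" if "length js \<noteq> length is"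
    using *[THEN conjunct2, rule_format, OF that] .
qed

text \<open>Tensors of sorted words span \<open>Q\<close>, so the prescribed values determine the
  map. They are prescribed relative to an orthonormal basis, which must exist in each degree for
  them to be binding.\<close>

lemma is_ess_proj_unique:
  assumes onb: "\<And>n. \<exists>B. ess_onb G \<mu> n B" and P: "is_ess_proj G \<mu> P" "is_ess_proj G \<mu> P'"
  shows "P = P'"
proof
  fix X
  have lin: "linear_on Q P" "linear_on Q P'" using P by (auto simp: is_ess_proj_def)
  have words: "P (u \<otimes>\<^sub>C v) = P' (u \<otimes>\<^sub>C v)" if uv: "u \<in> words n" "v \<in> words n" for u v n
  proof -
    obtain js a "is" b where *: "js \<in> create_indices n" "is \<in> create_indices n"
      "a \<in> E (n - 2 * length js)" "b \<in> E (n - 2 * length is)"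
      "u = creates G \<mu> js a" "v = creates G \<mu> is b"
      using uv by (auto simp: words_def)
    obtain B where B: "ess_onb G \<mu> (n - 2 * length js) B" using onb by blast
    show ?thesis
    proof (cases "length js = length is")
      case True
      then show ?thesis
        using is_ess_projD(1)[OF P(1) *(1-4) True B] is_ess_projD(1)[OF P(2) *(1-4) True B]
        by (simp add: *(5,6))
    next
      case False
      then show ?thesis
        using is_ess_projD(2)[OF P(1) *(1-4) False] is_ess_projD(2)[OF P(2) *(1-4) False]
        by (simp add: *(5,6))
    qed
  qed
  have linl: "linear_on (PS n) (\<lambda>x. R (x \<otimes>\<^sub>C y))" and linr: "linear_on (PS n) (\<lambda>x. R (y \<otimes>\<^sub>C x))"
    if "linear_on Q R" "y \<in> PS n" for R y n
    using that(2)
    by (auto intro!: linear_onI simp: tensor_add_left tensor_scale_left tensor_add_right tensor_scale_right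
        linear_on_add[OF that(1)] linear_on_scale[OF that(1)] tensor_end_gr[of _ PS n])
  have tensors: "P (x \<otimes>\<^sub>C y) = P' (x \<otimes>\<^sub>C y)" if xy: "x \<in> PS n" "y \<in> PS n" for x y n
  proof -
    have 1: "P (u \<otimes>\<^sub>C y) = P' (u \<otimes>\<^sub>C y)" if u: "u \<in> words n" for u
      using words[OF u] words_PS[of n] u xy(2) span_words[of n]
      by (intro linear_on_eq_span[OF linr[OF lin(1)] linr[OF lin(2)] PS_subspace words_PS, of u n u y]) auto
    show ?thesis
      using 1 xy span_words[of n]
      by (intro linear_on_eq_span[OF linl[OF lin(1)] linl[OF lin(2)] PS_subspace words_PS, of y n y x]) auto
  qed
  show "P X = P' X"
  proof (cases "X \<in> Q")
    case True
    then show ?thesis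
      by (rule end_gr_eqI[OF lin end_gr_subspace]) (auto intro: tensors tensor_end_gr)
  next
    case False
    then show ?thesis using P by (simp add: is_ess_proj_def)
  qed
qed


section \<open>Concatenation, reversal and endpoint weights\<close>

lemma conc_basis: "path_conc (basis_vec p) (basis_vec q) = (if joinable p q then basis_vec (p @ tl q) else 0)"
  by (simp add: path_conc_def vwalk_join_def)

lemma bilinear_conc [simp]: "bilinear_FS path_conc"
  unfolding path_conc_def by (rule bilinear_FS_lin_ext)

lemmas conc_left = bilinear_FS_left[OF bilinear_conc]
lemmas conc_right = bilinear_FS_right[OF bilinear_conc]

lemma FS_conc [simp]: "x \<in> FS \<Longrightarrow> y \<in> FS \<Longrightarrow> path_conc x y \<in> FS"
  unfolding path_conc_def by (intro FS_lin_ext) auto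

lemma joinable_Cons: "joinable p (v # q) \<longleftrightarrow> p \<noteq> [] \<and> last p = v"
  by (auto simp: joinable_def)

lemma walks_join: "p \<in> walks n \<Longrightarrow> q \<in> walks m \<Longrightarrow> joinable p q \<Longrightarrow> p @ tl q \<in> walks (n + m)"
proof (induction p arbitrary: n)
  case (Cons u p)
  show ?case
  proof (cases p)
    case Nil
    then have "n = 0" "u # tl q = q"
      using Cons.prems walksD[OF Cons.prems(1)] by (auto simp: joinable_def)
    with Nil Cons.prems show ?thesis by simp
  next
    case p: (Cons v r)
    then obtain k where n: "n = Suc k" using walksD[OF Cons.prems(1)] by (cases n) auto
    with Cons p show ?thesis using Cons.IH[of k] by (simp add: walks_Cons)
  qed
qed simp

lemma conc_basis_PS: "p \<in> walks n \<Longrightarrow> q \<in> walks m \<Longrightarrow> path_conc (basis_vec p) (basis_vec q) \<in> PS (n + m)"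
  by (simp add: conc_basis basis_PS walks_join cfun.subspace_0[OF PS_subspace])

lemma conc_PS:
  assumes "x \<in> PS n" "y \<in> PS m"
  shows "path_conc x y \<in> PS (n + m)"
proof (rule PS_lin_closed[OF conc_left PS_subspace assms(1)])
  show "y \<in> FS" using assms(2) by (rule PS_FS)
  fix p assume "p \<in> walks n"
  then show "path_conc (basis_vec p) y \<in> PS (n + m)"
    by (intro PS_lin_closed[OF conc_right PS_subspace assms(2)] conc_basis_PS) auto
qed

lemma conc_assoc:
  assumes "x \<in> FS" "y \<in> FS" "z \<in> FS"
  shows "path_conc (path_conc x y) z = path_conc x (path_conc y z)"
proof (rule bilinear_eqI[of "\<lambda>x y. path_conc (path_conc x y) z" "\<lambda>x y. path_conc x (path_conc y z)"])
  show "bilinear_FS (\<lambda>x y. path_conc (path_conc x y) z)"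
    by (rule bilinear_FS_post[OF bilinear_conc conc_left]) (simp_all add: assms)
  show "bilinear_FS (\<lambda>x y. path_conc x (path_conc y z))"
    by (rule bilinear_FS_compose[OF bilinear_conc linear_on_id conc_left]) (simp_all add: assms)
  fix p q
  show "path_conc (path_conc (basis_vec p) (basis_vec q)) z = path_conc (basis_vec p) (path_conc (basis_vec q) z)"
  proof (rule lin_eqI[OF conc_right linear_on_compose[OF conc_right conc_right]])
    fix r
    show "path_conc (path_conc (basis_vec p) (basis_vec q)) (basis_vec r) =
        path_conc (basis_vec p) (path_conc (basis_vec q) (basis_vec r))"
      by (cases p; cases q; cases r)
        (auto simp: conc_basis joinable_Cons lin_zero[OF conc_left] lin_zero[OF conc_right])
  qed (simp_all add: assms)
qed (simp_all add: assms)

lemma conc_push: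
  assumes x: "x \<in> starts v" and y: "y \<in> FS"
  shows "path_conc (push u x) y = push u (path_conc x y)"
proof (rule bilinear_eqI[of "\<lambda>x y. path_conc (push u x) y" "\<lambda>x y. push u (path_conc x y)"])
  show "bilinear_FS (\<lambda>x y. path_conc (push u x) y)"
    by (rule bilinear_FS_compose[OF bilinear_conc lin_push linear_on_id]) simp_all
  show "bilinear_FS (\<lambda>x y. push u (path_conc x y))"
    by (rule bilinear_FS_post[OF bilinear_conc lin_push]) simp
  fix p q assume "p \<in> supp x"
  then have "p \<noteq> []" using x by (auto simp: starts_def)
  then show "path_conc (push u (basis_vec p)) (basis_vec q) = push u (path_conc (basis_vec p) (basis_vec q))"
    by (simp add: conc_basis lin_zero[OF lin_push])
qed (use x y in \<open>auto intro: starts_FS\<close>)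

lemma conc_starts_basis:
  assumes y: "y \<in> FS"
  shows "path_conc (basis_vec (v # p)) y \<in> starts v"
proof (rule lin_closed[OF conc_right starts_subspace y])
  fix q show "path_conc (basis_vec (v # p)) (basis_vec q) \<in> starts v"
    by (simp add: conc_basis cfun.subspace_0[OF starts_subspace])
qed simp

lemma conc_single:
  assumes y: "y \<in> starts v"
  shows "path_conc (basis_vec [u]) y = (if u = v then y else 0)"
proof (rule lin_eqI[OF conc_right])
  show "linear_on FS (\<lambda>y. if u = v then y else 0)"
    by (cases "u = v") (simp_all add: linear_on_id linear_on_zero_map)
  fix q assume "q \<in> supp y"
  then show "path_conc (basis_vec [u]) (basis_vec q) = (if u = v then basis_vec q else 0)"
    using y by (cases q) (auto simp: starts_def conc_basis joinable_Cons)
qed (use y in \<open>auto intro: starts_FS\<close>)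

text \<open>A contraction whose three vertices all lie in the first path does not see the second
  one.\<close>

lemma ann_conc_left_basis:
  assumes "i + 2 < length p" "y \<in> FS"
  shows "ann i (path_conc (basis_vec p) y) = path_conc (ann i (basis_vec p)) y"
  using assms(1)
proof (induction i arbitrary: p)
  case 0
  then obtain k where "length p = Suc (Suc (Suc k))" by (auto simp: less_iff_Suc_add)
  then obtain u w v q where p: "p = u # w # v # q" by (auto simp: length_Suc_conv)
  have "path_conc (basis_vec p) y = push u (push w (path_conc (basis_vec (v # q)) y))"
    using conc_push[of "basis_vec (w # v # q)" w y u] conc_push[of "basis_vec (v # q)" v y w] assms(2)
    by (simp add: p)
  then show ?case
    using ann_0_push_push[OF conc_starts_basis[OF assms(2)], of u w v q] assms(2)
    by (simp add: p ann_basis_0 lin_scale[OF conc_left] lin_zero[OF conc_left])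
next
  case (Suc i)
  then obtain u v q where p: "p = u # v # q" by (cases p; cases "tl p") auto
  have "ann (Suc i) (path_conc (basis_vec p) y) = push u (ann i (path_conc (basis_vec (v # q)) y))"
    using conc_push[of "basis_vec (v # q)" v y u] assms(2) by (simp add: p ann_Suc_push)
  also have "\<dots> = path_conc (push u (ann i (basis_vec (v # q)))) y"
    using Suc p by (simp add: conc_push[OF ann_starts_basis assms(2)])
  finally show ?case by (simp add: p ann_Suc_basis)
qed

text \<open>The vertex at the joint belongs to both paths, so a detour inserted there may be
  attributed to the first; hence the last index of \<open>p\<close> is allowed.\<close>

lemma cre_conc_left_basis:
  assumes "i < length p" "y \<in> FS"
  shows "cre i (path_conc (basis_vec p) y) = path_conc (cre i (basis_vec p)) y"
  using assms(1)
proof (induction i arbitrary: p)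
  case 0
  then obtain v q where p: "p = v # q" by (cases p) auto
  have "cre 0 (path_conc (basis_vec p) y) = (\<Sum>w\<in>nbs v. wt w v *\<^sub>C push v (push w (path_conc (basis_vec p) y)))"
    unfolding p by (rule cre_0_starts[OF conc_starts_basis[OF assms(2)]])
  also have "\<dots> = (\<Sum>w\<in>nbs v. wt w v *\<^sub>C path_conc (basis_vec (v # w # p)) y)"
  proof (rule sum.cong[OF refl])
    fix w
    show "wt w v *\<^sub>C push v (push w (path_conc (basis_vec p) y)) = wt w v *\<^sub>C path_conc (basis_vec (v # w # p)) y"
      using conc_push[of "basis_vec (w # p)" w y v] conc_push[of "basis_vec p" v y w] assms(2)
      by (simp add: p)
  qed
  finally show ?case
    using assms(2) by (simp add: p cre_basis_0 lin_sum[OF conc_left] lin_scale[OF conc_left])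
next
  case (Suc i)
  then obtain u v q where p: "p = u # v # q" by (cases p; cases "tl p") auto
  have "cre (Suc i) (path_conc (basis_vec p) y) = push u (cre i (path_conc (basis_vec (v # q)) y))"
    using conc_push[of "basis_vec (v # q)" v y u] assms(2) by (simp add: p cre_Suc_push)
  also have "\<dots> = path_conc (push u (cre i (basis_vec (v # q)))) y"
    using Suc p by (simp add: conc_push[OF cre_starts_basis assms(2)])
  finally show ?case by (simp add: p cre_Suc_basis)
qed

lemma ann_conc_left:
  assumes "x \<in> PS (n + 2)" "i \<le> n" "y \<in> FS"
  shows "ann i (path_conc x y) = path_conc (ann i x) y"
proof (rule PS_eqI[OF linear_on_compose[OF conc_left lin_ann] linear_on_compose[OF lin_ann conc_left] assms(1)])
  fix p assume "p \<in> walks (n + 2)"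
  then show "ann i (path_conc (basis_vec p) y) = path_conc (ann i (basis_vec p)) y"
    using assms(2,3) walksD[of p "n + 2"] by (intro ann_conc_left_basis) auto
qed (simp_all add: assms)

lemma cre_conc_left:
  assumes "x \<in> PS n" "i \<le> n" "y \<in> FS"
  shows "cre i (path_conc x y) = path_conc (cre i x) y"
proof (rule PS_eqI[OF linear_on_compose[OF conc_left lin_cre] linear_on_compose[OF lin_cre conc_left] assms(1)])
  fix p assume "p \<in> walks n"
  then show "cre i (path_conc (basis_vec p) y) = path_conc (cre i (basis_vec p)) y"
    using assms(2,3) walksD[of p n] by (intro cre_conc_left_basis) auto
qed (simp_all add: assms)

lemma conc_Nil [simp]: "path_conc (basis_vec p) (basis_vec []) = 0"
  by (simp add: conc_basis)

lemma ann_conc_right_basis: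
  "length p = Suc n \<Longrightarrow> ann (n + i) (path_conc (basis_vec p) (basis_vec q)) = path_conc (basis_vec p) (ann i (basis_vec q))"
proof (induction n arbitrary: p)
  case 0
  then obtain u where p: "p = [u]" by (auto simp: length_Suc_conv)
  show ?case
  proof (cases q)
    case Nil
    then show ?thesis by (simp add: ann_basis_short lin_zero[OF lin_ann] lin_zero[OF conc_right])
  next
    case (Cons v r)
    then show ?thesis
      using conc_single[of "basis_vec q" v u] conc_single[OF ann_starts_basis, of u i v r]
      by (simp add: p lin_zero[OF lin_ann])
  qed
next
  case (Suc n)
  then obtain u v r where p: "p = u # v # r" by (auto simp: length_Suc_conv)
  have "path_conc (basis_vec p) y = push u (path_conc (basis_vec (v # r)) y)" if "y \<in> FS" for y
    using conc_push[of "basis_vec (v # r)" v y u] that by (simp add: p)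
  then show ?case using Suc p by (simp add: ann_Suc_push)
qed

lemma cre_conc_right_basis:
  "length p = Suc n \<Longrightarrow> cre (n + i) (path_conc (basis_vec p) (basis_vec q)) = path_conc (basis_vec p) (cre i (basis_vec q))"
proof (induction n arbitrary: p)
  case 0
  then obtain u where p: "p = [u]" by (auto simp: length_Suc_conv)
  show ?case
  proof (cases q)
    case Nil
    then show ?thesis by (simp add: cre_basis_short lin_zero[OF lin_cre] lin_zero[OF conc_right])
  next
    case (Cons v r)
    then show ?thesis
      using conc_single[of "basis_vec q" v u] conc_single[OF cre_starts_basis, of u i v r]
      by (simp add: p lin_zero[OF lin_cre])
  qed
next
  case (Suc n)
  then obtain u v r where p: "p = u # v # r" by (auto simp: length_Suc_conv)
  have "path_conc (basis_vec p) y = push u (path_conc (basis_vec (v # r)) y)" if "y \<in> FS" for y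
    using conc_push[of "basis_vec (v # r)" v y u] that by (simp add: p)
  then show ?case using Suc p by (simp add: cre_Suc_push)
qed

lemma ann_conc_right:
  assumes "x \<in> PS n" "y \<in> FS"
  shows "ann (n + i) (path_conc x y) = path_conc x (ann i y)"
proof (rule bilinear_eqI[of "\<lambda>x y. ann (n + i) (path_conc x y)" "\<lambda>x y. path_conc x (ann i y)"])
  show "bilinear_FS (\<lambda>x y. ann (n + i) (path_conc x y))"
    by (rule bilinear_FS_post[OF bilinear_conc lin_ann]) simp
  show "bilinear_FS (\<lambda>x y. path_conc x (ann i y))"
    by (rule bilinear_FS_compose[OF bilinear_conc linear_on_id lin_ann]) simp_all
  fix p q assume "p \<in> supp x"
  then show "ann (n + i) (path_conc (basis_vec p) (basis_vec q)) = path_conc (basis_vec p) (ann i (basis_vec q))"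
    using assms(1) by (intro ann_conc_right_basis) (auto simp: path_space_iff dest: walksD)
qed (use assms in \<open>auto intro: PS_FS\<close>)

lemma cre_conc_right:
  assumes "x \<in> PS n" "y \<in> FS"
  shows "cre (n + i) (path_conc x y) = path_conc x (cre i y)"
proof (rule bilinear_eqI[of "\<lambda>x y. cre (n + i) (path_conc x y)" "\<lambda>x y. path_conc x (cre i y)"])
  show "bilinear_FS (\<lambda>x y. cre (n + i) (path_conc x y))"
    by (rule bilinear_FS_post[OF bilinear_conc lin_cre]) simp
  show "bilinear_FS (\<lambda>x y. path_conc x (cre i y))"
    by (rule bilinear_FS_compose[OF bilinear_conc linear_on_id lin_cre]) simp_all
  fix p q assume "p \<in> supp x"
  then show "cre (n + i) (path_conc (basis_vec p) (basis_vec q)) = path_conc (basis_vec p) (cre i (basis_vec q))"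
    using assms(1) by (intro cre_conc_right_basis) (auto simp: path_space_iff dest: walksD)
qed (use assms in \<open>auto intro: PS_FS\<close>)

text \<open>The unit of the path algebra; by \<open>ess_one_eq\<close> the unit of the weak Hopf
  algebra is its tensor square.\<close>

definition vertex_sum :: "'v list \<Rightarrow> complex"
  where "vertex_sum = (\<Sum>v\<in>pverts G. basis_vec [v])"

lemma vertex_sum_PS: "vertex_sum \<in> PS 0"
  unfolding vertex_sum_def by (intro cfun.subspace_sum PS_subspace) (simp add: basis_PS walks_single)

lemma FS_vertex_sum [simp]: "vertex_sum \<in> FS"
  by (rule PS_FS[OF vertex_sum_PS])

lemma conc_vertex_left:
  assumes "x \<in> PS n"
  shows "path_conc vertex_sum x = x"
proof (rule PS_eqI[OF conc_right linear_on_id assms])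
  fix p assume p: "p \<in> walks n"
  then have "path_conc vertex_sum (basis_vec p) = (\<Sum>v\<in>pverts G. if v = hd p then basis_vec p else 0)"
    unfolding vertex_sum_def by (cases p) (auto simp: lin_sum[OF conc_left] conc_basis joinable_Cons dest: walksD intro!: sum.cong)
  also have "\<dots> = basis_vec p"
    using walksD[OF p] hd_in_set[of p] by (simp add: finite_verts subset_iff)
  finally show "path_conc vertex_sum (basis_vec p) = basis_vec p" .
qed simp

lemma conc_vertex_right:
  assumes "x \<in> PS n"
  shows "path_conc x vertex_sum = x"
proof (rule PS_eqI[OF conc_left linear_on_id assms])
  fix p assume p: "p \<in> walks n"
  then have "path_conc (basis_vec p) vertex_sum = (\<Sum>v\<in>pverts G. if v = last p then basis_vec p else 0)"
    unfolding vertex_sum_def using walksD[OF p]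
    by (auto simp: lin_sum[OF conc_right] conc_basis joinable_def intro!: sum.cong)
  also have "\<dots> = basis_vec p"
    using walksD[OF p] last_in_set[of p] by (simp add: finite_verts subset_iff)
  finally show "path_conc (basis_vec p) vertex_sum = basis_vec p" .
qed simp

subsection \<open>Reversal\<close>

text \<open>The antilinear \<open>path_star\<close> is split into this linear reversal and the
  conjugation \<open>cj\<close>, so that arguments on basis vectors apply. The antipode uses the
  reversal alone.\<close>

definition rv :: "('v list \<Rightarrow> complex) \<Rightarrow> ('v list \<Rightarrow> complex)"
  where "rv x = (\<lambda>p. x (rev p))"

definition cj :: "('b \<Rightarrow> complex) \<Rightarrow> ('b \<Rightarrow> complex)"
  where "cj x = (\<lambda>p. cnj (x p))"

lemma path_star_eq: "path_star x = cj (rv x)"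
  by (simp add: path_star_def rv_def cj_def)

lemma lin_rv [simp]: "linear_on FS rv"
  by (rule linear_onI) (auto simp: rv_def fun_eq_iff pointwise)

lemma rv_basis [simp]: "rv (basis_vec p) = basis_vec (rev p)"
  by (auto simp: rv_def basis_vec_def fun_eq_iff)

lemma rv_rv [simp]: "rv (rv x) = x"
  by (simp add: rv_def)

lemma supp_rv: "supp (rv x) = rev ` supp x"
  by (auto simp: supp_def rv_def image_iff) (metis rev_rev_ident)

lemma FS_rv [simp]: "x \<in> FS \<Longrightarrow> rv x \<in> FS"
  by (simp add: FS_def supp_rv)

lemma supp_cj [simp]: "supp (cj x) = supp x"
  by (simp add: supp_def cj_def)

lemma FS_cj [simp]: "x \<in> FS \<Longrightarrow> cj x \<in> FS"
  by (simp add: FS_def)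

lemma cj_cj [simp]: "cj (cj x) = x"
  by (simp add: cj_def)

lemma cj_rv: "cj (rv x) = rv (cj x)"
  by (simp add: cj_def rv_def)

lemma rev_walks: "p \<in> walks n \<Longrightarrow> rev p \<in> walks n"
proof -
  have "set (vwalk_arcs p) \<subseteq> parcs G \<Longrightarrow> set (vwalk_arcs (rev p)) \<subseteq> parcs G" for p
  proof (induction p rule: vwalk_arcs.induct)
    case (3 x y xs)
    have "vwalk_arcs (rev (y # xs) @ [x]) = vwalk_arcs (rev (y # xs)) @ [(y, x)]"
      by (subst vwalk_arcs_append) (simp_all add: last_rev)
    with 3 show ?case by (auto simp: arcs_sym[of y x])
  qed auto
  then show "p \<in> walks n \<Longrightarrow> rev p \<in> walks n" by (simp add: walks_def vwalk_def)
qed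

lemma rv_PS: "x \<in> PS n \<Longrightarrow> rv x \<in> PS n"
  by (auto simp: path_space_iff supp_rv rev_walks)

lemma cj_PS: "x \<in> PS n \<Longrightarrow> cj x \<in> PS n"
  by (simp add: path_space_iff)

lemma ann_split: "ann (length a) (basis_vec (a @ u # w # v # b)) = (if u = v then wt w v *\<^sub>C basis_vec (a @ v # b) else 0)"
  by (simp add: ann_basis nth_append)

lemma cre_split: "cre (length a) (basis_vec (a @ v # b)) = (\<Sum>w\<in>nbs v. wt w v *\<^sub>C basis_vec (a @ v # w # v # b))"
  by (simp add: cre_basis nth_append)

text \<open>Reversal moves the triple at \<open>i\<close> in a list of \<open>n + 3\<close> vertices
  to \<open>n - i\<close>. The middle vertex is kept and the outer two are equal when the
  contraction is nonzero, so the weight does not change.\<close>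

lemma rv_ann:
  assumes "x \<in> PS (n + 2)" "i \<le> n"
  shows "rv (ann i x) = ann (n - i) (rv x)"
proof (rule PS_eqI[OF linear_on_compose[OF lin_ann lin_rv] linear_on_compose[OF lin_rv lin_ann] assms(1)])
  fix p assume "p \<in> walks (n + 2)"
  then have len: "length p = n + 3" using walksD by auto
  define a b where "a = take i p" and "b = drop (i + 3) p"
  have "drop i p = p ! i # p ! (i + 1) # p ! (i + 2) # b"
    using Cons_nth_drop_Suc[of i p] Cons_nth_drop_Suc[of "i + 1" p] Cons_nth_drop_Suc[of "i + 2" p] len assms(2)
    by (simp add: b_def eval_nat_numeral)
  then have "p = a @ p ! i # p ! (i + 1) # p ! (i + 2) # b"
    using append_take_drop_id[of i p] by (simp add: a_def)
  moreover have "length a = i" "length b = n - i" using len assms(2) by (auto simp: a_def b_def)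
  ultimately obtain u w v where p: "p = a @ u # w # v # b" and l: "length a = i" "length b = n - i" by blast
  show "rv (ann i (basis_vec p)) = ann (n - i) (rv (basis_vec p))"
    using ann_split[of a u w v b] ann_split[of "rev b" v w u "rev a"] l
    by (auto simp: p lin_scale[OF lin_rv] lin_zero[OF lin_rv])
qed (simp_all add: assms)

lemma rv_cre:
  assumes "x \<in> PS n" "i \<le> n"
  shows "rv (cre i x) = cre (n - i) (rv x)"
proof (rule PS_eqI[OF linear_on_compose[OF lin_cre lin_rv] linear_on_compose[OF lin_rv lin_cre] assms(1)])
  fix p assume "p \<in> walks n"
  then have len: "length p = n + 1" using walksD by auto
  define a b where "a = take i p" and "b = drop (i + 1) p"
  have "p = a @ p ! i # b"
    using len assms(2) unfolding a_def b_def by (simp add: id_take_nth_drop[of i p, symmetric])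
  moreover have "length a = i" "length b = n - i" using len assms(2) by (auto simp: a_def b_def)
  ultimately obtain v where p: "p = a @ v # b" and l: "length a = i" "length b = n - i" by blast
  show "rv (cre i (basis_vec p)) = cre (n - i) (rv (basis_vec p))"
    using cre_split[of a v b] cre_split[of "rev b" v "rev a"] l
    by (simp add: p lin_scale[OF lin_rv] lin_sum[OF lin_rv])
qed (simp_all add: assms)

lemma rv_conc:
  assumes "x \<in> FS" "y \<in> FS"
  shows "rv (path_conc x y) = path_conc (rv y) (rv x)"
proof (rule bilinear_eqI[of "\<lambda>x y. rv (path_conc x y)" "\<lambda>x y. path_conc (rv y) (rv x)"])
  show "bilinear_FS (\<lambda>x y. rv (path_conc x y))"
    by (rule bilinear_FS_post[OF bilinear_conc lin_rv]) simp
  have "bilinear_FS (\<lambda>y x. path_conc (rv y) (rv x))"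
    by (rule bilinear_FS_compose[OF bilinear_conc lin_rv lin_rv]) simp_all
  then show "bilinear_FS (\<lambda>x y. path_conc (rv y) (rv x))" by (simp add: bilinear_FS_def)
  fix p q :: "'v list"
  have "joinable p q \<longleftrightarrow> joinable (rev q) (rev p)" by (auto simp: joinable_def last_rev hd_rev)
  moreover have "rev (p @ tl q) = rev q @ tl (rev p)" if "joinable p q"
  proof -
    have "p = butlast p @ [hd q]" "q = hd q # tl q" using that by (auto simp: joinable_def) (metis append_butlast_last_id)
    then obtain a v b where "p = a @ [v]" "q = v # b" by metis
    then show ?thesis by simp
  qed
  ultimately show "rv (path_conc (basis_vec p) (basis_vec q)) = path_conc (rv (basis_vec q)) (rv (basis_vec p))"
    by (simp add: conc_basis lin_zero[OF lin_rv])
qed (simp_all add: assms)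

lemma cj_lin_ext: "cj (lin_ext f x) = lin_ext (\<lambda>b. cj (f b)) (cj x)"
  unfolding lin_ext_def supp_cj by (auto simp: cj_def fun_eq_iff pointwise)

lemma cj_basis [simp]: "cj (basis_vec p) = basis_vec p"
  by (auto simp: cj_def basis_vec_def fun_eq_iff)

lemma cj_ann: "x \<in> FS \<Longrightarrow> cj (ann i x) = ann i (cj x)"
  using lin_expand[OF lin_ann, of x i] lin_expand[OF lin_ann, of "cj x" i]
  by (simp add: cj_lin_ext) (simp add: cj_def ann_basis_real)

lemma cj_cre: "x \<in> FS \<Longrightarrow> cj (cre i x) = cre i (cj x)"
  using lin_expand[OF lin_cre, of x i] lin_expand[OF lin_cre, of "cj x" i]
  by (simp add: cj_lin_ext) (simp add: cj_def cre_basis_real)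

lemma cj_conc: "cj (path_conc x y) = path_conc (cj x) (cj y)"
  unfolding path_conc_def cj_lin_ext
  by (intro arg_cong2[of _ _ _ _ lin_ext] ext refl) (auto simp: cj_lin_ext if_distrib cj_def pointwise fun_eq_iff basis_vec_def intro!: arg_cong2[of _ _ _ _ lin_ext])

subsection \<open>Weights depending on the endpoints\<close>

definition between :: "'v \<Rightarrow> 'v \<Rightarrow> ('v list \<Rightarrow> complex) set"
  where "between s t = {x \<in> FS. \<forall>p\<in>supp x. hd p = s \<and> last p = t}"

lemma between_subspace: "cfun.subspace (between s t)"
  unfolding between_def cfun.subspace_def
  by (auto dest!: subsetD[OF supp_add] subsetD[OF supp_scale])

text \<open>The square root in the antipode consists of such diagonal factors. They commute with
  annihilation and creation, because these preserve both ends of a path.\<close>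

definition wgt :: "('v \<Rightarrow> 'v \<Rightarrow> complex) \<Rightarrow> ('v list \<Rightarrow> complex) \<Rightarrow> ('v list \<Rightarrow> complex)"
  where "wgt f x = (\<lambda>p. f (hd p) (last p) * x p)"

lemma lin_wgt [simp]: "linear_on FS (wgt f)"
  by (rule linear_onI) (auto simp: wgt_def fun_eq_iff pointwise algebra_simps)

lemma supp_wgt: "supp (wgt f x) \<subseteq> supp x"
  by (auto simp: supp_def wgt_def)

lemma FS_wgt [simp]: "x \<in> FS \<Longrightarrow> wgt f x \<in> FS"
  using supp_wgt[of f x] by (auto simp: FS_def intro: finite_subset)

lemma wgt_PS: "x \<in> PS n \<Longrightarrow> wgt f x \<in> PS n"
  using supp_wgt[of f x] by (auto simp: path_space_iff)

lemma wgt_between: "x \<in> between s t \<Longrightarrow> wgt f x = f s t *\<^sub>C x"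
  by (fastforce simp: between_def supp_def wgt_def fun_eq_iff pointwise)

lemma wgt_basis: "wgt f (basis_vec p) = f (hd p) (last p) *\<^sub>C basis_vec p"
  by (auto simp: wgt_def basis_vec_def fun_eq_iff pointwise)

lemma basis_between: "hd p = s \<Longrightarrow> last p = t \<Longrightarrow> basis_vec p \<in> between s t"
  by (simp add: between_def)

lemma ann_between: "ann i (basis_vec p) \<in> between (hd p) (last p)"
proof (cases "i + 2 < length p \<and> p ! i = p ! (i + 2)")
  case True
  have "last (take (i + 1) p @ drop (i + 3) p) = last p"
  \<comment> \<open>If the contracted triple ends the path, the last vertex is removed, but it
    equals the vertex \<open>p ! i\<close> that stays.\<close>
  proof (cases "length p = i + 3")
    case True
    then have "last (take (i + 1) p) = p ! i" by (simp add: take_Suc_conv_app_nth)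
    moreover have "last p = p ! (i + 2)" using True by (simp add: last_conv_nth flip: length_greater_0_conv)
    ultimately show ?thesis using \<open>i + 2 < length p \<and> _\<close> True by simp
  next
    case False
    then show ?thesis using \<open>i + 2 < length p \<and> _\<close> by (simp add: last_append)
  qed
  moreover have "hd (take (i + 1) p @ drop (i + 3) p) = hd p" using True by (cases p) auto
  ultimately show ?thesis
    by (simp add: ann_basis cfun.subspace_0[OF between_subspace] cfun.subspace_scale[OF between_subspace] basis_between)
qed (auto simp: ann_basis cfun.subspace_0[OF between_subspace])

lemma cre_between: "cre i (basis_vec p) \<in> between (hd p) (last p)"
proof (cases "i < length p")
  case True
  have "hd (take (i + 1) p @ v # drop i p) = hd p" "last (take (i + 1) p @ v # drop i p) = last p" for v
    using True by (cases p; simp)+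
  then show ?thesis
    by (auto simp: cre_basis cfun.subspace_0[OF between_subspace]
        intro!: cfun.subspace_sum[OF between_subspace] cfun.subspace_scale[OF between_subspace] basis_between)
qed (simp add: cre_basis cfun.subspace_0[OF between_subspace])

lemma wgt_ann: "x \<in> FS \<Longrightarrow> wgt f (ann i x) = ann i (wgt f x)"
  by (rule lin_eqI[OF linear_on_compose[OF lin_ann lin_wgt] linear_on_compose[OF lin_wgt lin_ann]])
    (simp_all add: wgt_between[OF ann_between] wgt_basis lin_scale[OF lin_ann])

lemma wgt_cre: "x \<in> FS \<Longrightarrow> wgt f (cre i x) = cre i (wgt f x)"
  by (rule lin_eqI[OF linear_on_compose[OF lin_cre lin_wgt] linear_on_compose[OF lin_wgt lin_cre]])
    (simp_all add: wgt_between[OF cre_between] wgt_basis lin_scale[OF lin_cre])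

end

lemma bilinear_FSI:
  assumes "\<And>x x' y. x \<in> FS \<Longrightarrow> x' \<in> FS \<Longrightarrow> y \<in> FS \<Longrightarrow> f (x + x') y = f x y + f x' y"
    and "\<And>k x y. x \<in> FS \<Longrightarrow> y \<in> FS \<Longrightarrow> f (k *\<^sub>C x) y = k *\<^sub>C f x y"
    and "\<And>x y y'. x \<in> FS \<Longrightarrow> y \<in> FS \<Longrightarrow> y' \<in> FS \<Longrightarrow> f x (y + y') = f x y + f x y'"
    and "\<And>k x y. x \<in> FS \<Longrightarrow> y \<in> FS \<Longrightarrow> f x (k *\<^sub>C y) = k *\<^sub>C f x y"
  shows "bilinear_FS f"
  using assms by (auto simp: bilinear_FS_def intro!: linear_onI)

lemma end_conc_eq: "end_conc = (\<lambda>a b. lin_ext (\<lambda>z. lin_ext (\<lambda>z'.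
    path_conc (basis_vec (fst z)) (basis_vec (fst z')) \<otimes>\<^sub>C
    path_conc (basis_vec (snd z)) (basis_vec (snd z'))) b) a)"
  by (simp add: end_conc_def fun_eq_iff case_prod_unfold)

lemma bilinear_FS_end_conc [simp]: "bilinear_FS end_conc"
  unfolding end_conc_eq by (rule bilinear_FS_lin_ext)

lemma FS_ess_star [simp]: "a \<in> FS \<Longrightarrow> ess_star a \<in> FS"
proof -
  assume "a \<in> FS"
  have "supp (ess_star a) = (\<lambda>(p, q). (rev p, rev q)) ` supp a"
    by (force simp: supp_def ess_star_def image_iff)
  with \<open>a \<in> FS\<close> show ?thesis by (simp add: FS_def)
qed

lemma ess_star_add: "ess_star (a + b) = ess_star a + ess_star b"
  and ess_star_scale: "ess_star (k *\<^sub>C a) = cnj k *\<^sub>C ess_star a"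
  and ess_star_zero [simp]: "ess_star 0 = 0"
  and ess_star_star [simp]: "ess_star (ess_star a) = a"
  by (auto simp: ess_star_def fun_eq_iff pointwise)

context perron_graph
begin

lemma FS_end_conc [simp]: "a \<in> FS \<Longrightarrow> b \<in> FS \<Longrightarrow> end_conc a b \<in> FS"
  unfolding end_conc_def by (intro FS_lin_ext) (auto intro!: FS_lin_ext FS_tensor)

lemma linear_antipode [simp]: "linear_on FS (ess_antipode \<mu>)"
  by (simp add: ess_antipode_def)

lemmas linear_simps = tensor_add_left tensor_add_right tensor_scale_left tensor_scale_right
  lin_add[OF lin_PP] lin_scale[OF lin_PP] lin_add[OF lin_rv] lin_scale[OF lin_rv]
  lin_add[OF lin_wgt] lin_scale[OF lin_wgt] lin_add[OF lin_ann] lin_scale[OF lin_ann]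
  lin_add[OF lin_cre] lin_scale[OF lin_cre]
  lin_add[OF conc_left] lin_scale[OF conc_left] lin_add[OF conc_right] lin_scale[OF conc_right]
  lin_add[OF bilinear_FS_left[OF bilinear_FS_end_conc]] lin_scale[OF bilinear_FS_left[OF bilinear_FS_end_conc]]
  lin_add[OF bilinear_FS_right[OF bilinear_FS_end_conc]] lin_scale[OF bilinear_FS_right[OF bilinear_FS_end_conc]]
  lin_add[OF linear_antipode] lin_scale[OF linear_antipode]

section \<open>Products\<close>

lemma end_conc_Q:
  assumes "a \<in> Q" "b \<in> Q"
  shows "end_conc a b \<in> Q"
proof -
  have FSab: "a \<in> FS" "b \<in> FS" using assms Q_FS by auto
  have "cfun.subspace {b \<in> FS. end_conc (x \<otimes>\<^sub>C y) b \<in> Q}" if "x \<in> FS" "y \<in> FS" for x y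
    using that cfun.subspace_add[OF end_gr_subspace] cfun.subspace_scale[OF end_gr_subspace]
    by (auto simp: cfun.subspace_def linear_simps cfun.subspace_0[OF end_gr_subspace]
        lin_zero[OF bilinear_FS_right[OF bilinear_FS_end_conc]])
  then have 1: "Q \<subseteq> {b \<in> FS. end_conc (x \<otimes>\<^sub>C y) b \<in> Q}" if "x \<in> PS n" "y \<in> PS n" for x y n
    using that by (intro end_gr_minimal)
      (auto simp: end_conc_tensor intro: PS_FS FS_tensor intro!: tensor_end_gr[of _ PS "n + _"] conc_PS)
  have "cfun.subspace {a \<in> FS. end_conc a b \<in> Q}"
    using FSab cfun.subspace_add[OF end_gr_subspace] cfun.subspace_scale[OF end_gr_subspace]
    by (auto simp: cfun.subspace_def linear_simps cfun.subspace_0[OF end_gr_subspace]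
        lin_zero[OF bilinear_FS_left[OF bilinear_FS_end_conc]])
  then have "Q \<subseteq> {a \<in> FS. end_conc a b \<in> Q}"
    using 1 assms(2) by (intro end_gr_minimal) (auto intro: PS_FS FS_tensor)
  with assms(1) show ?thesis by blast
qed

lemma bilinear_end_gr_eqI:
  assumes fg: "bilinear_FS f" "bilinear_FS g" and W: "\<And>n. W n \<subseteq> FS" and ab: "a \<in> end_gr W" "b \<in> end_gr W"
    and eq: "\<And>n m x y z w. x \<in> W n \<Longrightarrow> y \<in> W n \<Longrightarrow> z \<in> W m \<Longrightarrow> w \<in> W m \<Longrightarrow>
      f (x \<otimes>\<^sub>C y) (z \<otimes>\<^sub>C w) = g (x \<otimes>\<^sub>C y) (z \<otimes>\<^sub>C w)"
  shows "f a b = g a b"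
proof -
  have WF: "end_gr W \<subseteq> FS" using W by (intro end_gr_minimal FS_subspace) (auto intro!: FS_tensor)
  then have b: "b \<in> FS" using ab by blast
  show ?thesis
  proof (rule end_gr_eqI[OF bilinear_FS_left[OF fg(1) b] bilinear_FS_left[OF fg(2) b] FS_subspace ab(1)])
    fix n x y assume xy: "x \<in> W n" "y \<in> W n"
    then show F: "x \<otimes>\<^sub>C y \<in> FS" using W by (auto intro!: FS_tensor)
    show "f (x \<otimes>\<^sub>C y) b = g (x \<otimes>\<^sub>C y) b"
    proof (rule end_gr_eqI[OF bilinear_FS_right[OF fg(1) F] bilinear_FS_right[OF fg(2) F] FS_subspace ab(2)])
      fix m z w assume "z \<in> W m" "w \<in> W m"
      then show "z \<otimes>\<^sub>C w \<in> FS" "f (x \<otimes>\<^sub>C y) (z \<otimes>\<^sub>C w) = g (x \<otimes>\<^sub>C y) (z \<otimes>\<^sub>C w)"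
        using W eq[OF xy] by (auto intro!: FS_tensor)
    qed
  qed
qed

lemma PS_sub_FS: "PS n \<subseteq> FS" and ess_sub_FS: "E n \<subseteq> FS"
  using PS_FS ess_FS by auto

lemmas bilinear_Q_eqI = bilinear_end_gr_eqI[where W = PS, OF _ _ PS_sub_FS]

lemma bilinear_A_eqI:
  assumes "bilinear_FS f" "bilinear_FS g" "a \<in> A" "b \<in> A"
    and "\<And>n m x y z w. x \<in> E n \<Longrightarrow> y \<in> E n \<Longrightarrow> z \<in> E m \<Longrightarrow> w \<in> E m \<Longrightarrow>
      f (x \<otimes>\<^sub>C y) (z \<otimes>\<^sub>C w) = g (x \<otimes>\<^sub>C y) (z \<otimes>\<^sub>C w)"
  shows "f a b = g a b"
  using assms(3,4) unfolding ess_algebra_def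
  by (rule bilinear_end_gr_eqI[OF assms(1,2) ess_sub_FS]) (rule assms(5))

lemma A_eqI:
  assumes "linear_on FS f" "linear_on FS g" "a \<in> A"
    and "\<And>n x y. x \<in> E n \<Longrightarrow> y \<in> E n \<Longrightarrow> f (x \<otimes>\<^sub>C y) = g (x \<otimes>\<^sub>C y)"
  shows "f a = g a"
  using assms(3) unfolding ess_algebra_def
  by (rule end_gr_eqI[OF assms(1,2) FS_subspace]) (auto intro: FS_tensor ess_FS assms(4))

lemma Q_eqI:
  assumes "linear_on FS f" "linear_on FS g" "a \<in> Q"
    and "\<And>n x y. x \<in> PS n \<Longrightarrow> y \<in> PS n \<Longrightarrow> f (x \<otimes>\<^sub>C y) = g (x \<otimes>\<^sub>C y)"
  shows "f a = g a"
  using assms(3)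
  by (rule end_gr_eqI[OF assms(1,2) FS_subspace]) (auto intro: FS_tensor PS_FS assms(4))

text \<open>The product with \<open>PP\<close> in place of \<open>ess_proj\<close>. It is bilinear
  on all of \<open>FS\<close> and can be studied before the choice in \<open>ess_proj\<close> is
  resolved.\<close>

definition mul :: "('v list \<times> 'v list \<Rightarrow> complex) \<Rightarrow> ('v list \<times> 'v list \<Rightarrow> complex) \<Rightarrow> ('v list \<times> 'v list \<Rightarrow> complex)"
  where "mul a b = PP (end_conc a b)"

lemma bilinear_mul [simp]: "bilinear_FS mul"
  unfolding mul_def by (rule bilinear_FS_post[OF bilinear_FS_end_conc lin_PP]) simp

lemmas mul_simps = lin_add[OF bilinear_FS_left[OF bilinear_mul]] lin_scale[OF bilinear_FS_left[OF bilinear_mul]]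
  lin_add[OF bilinear_FS_right[OF bilinear_mul]] lin_scale[OF bilinear_FS_right[OF bilinear_mul]]

lemma FS_mul [simp]: "a \<in> FS \<Longrightarrow> b \<in> FS \<Longrightarrow> mul a b \<in> FS"
  by (simp add: mul_def)

lemma mul_tensor: "mul (x \<otimes>\<^sub>C y) (z \<otimes>\<^sub>C w) = PP (path_conc x z \<otimes>\<^sub>C path_conc y w)"
  by (simp add: mul_def end_conc_tensor)

lemma mul_closed: "a \<in> FS \<Longrightarrow> b \<in> FS \<Longrightarrow> mul a b \<in> A"
  by (simp add: mul_def PP_closed)

text \<open>Concatenation with a fixed path carries a relation to a relation, at the same position
  here and shifted by the length of the prefix in \<open>invariant_mul_right\<close>. Together they
  say that the kernel of the projection on \<open>Q\<close> is a two-sided ideal.\<close>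

lemma invariant_mul_left:
  assumes c: "c \<in> Q"
  shows "invariant (\<lambda>X. mul X c)"
proof -
  have cF: "c \<in> FS" using c Q_FS by blast
  have *: "mul (u \<otimes>\<^sub>C v) c = mul (u' \<otimes>\<^sub>C v') c" if FS: "u \<in> FS" "v \<in> FS" "u' \<in> FS" "v' \<in> FS"
    and eq: "\<And>m z w. z \<in> PS m \<Longrightarrow> w \<in> PS m \<Longrightarrow> mul (u \<otimes>\<^sub>C v) (z \<otimes>\<^sub>C w) = mul (u' \<otimes>\<^sub>C v') (z \<otimes>\<^sub>C w)"
    for u v u' v'
    by (rule Q_eqI[OF bilinear_FS_right[OF bilinear_mul] bilinear_FS_right[OF bilinear_mul] c])
      (auto intro!: FS_tensor FS eq)
  show ?thesis
  proof (rule invariantI[OF bilinear_FS_left[OF bilinear_mul cF]])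
    fix n i x y assume xy: "x \<in> PS n" "y \<in> PS (n + 2)"
    then have FS: "x \<in> FS" "y \<in> FS" by (auto intro: PS_FS)
    show "mul (cre i x \<otimes>\<^sub>C y) c = mul (x \<otimes>\<^sub>C ann i y) c"
    proof (rule *)
      fix m z w assume zw: "z \<in> PS m" "w \<in> PS m"
      then have zwF: "z \<in> FS" "w \<in> FS" by (auto intro: PS_FS)
      show "mul (cre i x \<otimes>\<^sub>C y) (z \<otimes>\<^sub>C w) = mul (x \<otimes>\<^sub>C ann i y) (z \<otimes>\<^sub>C w)"
      proof (cases "i \<le> n")
        case True
        then show ?thesis
          using PP_cre_left[OF conc_PS[OF xy(1) zw(1)], of "path_conc y w" i] conc_PS[OF xy(2) zw(2)]
          by (simp add: mul_tensor ann_conc_left[OF xy(2) True zwF(2)] flip: cre_conc_left[OF xy(1) True zwF(1)])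
      next
        case False
        then show ?thesis using cre_PS_short[OF xy(1)] ann_PS_short[OF xy(2)] by simp
      qed
    qed (simp_all add: FS)
    show "mul (y \<otimes>\<^sub>C cre i x) c = mul (ann i y \<otimes>\<^sub>C x) c"
    proof (rule *)
      fix m z w assume zw: "z \<in> PS m" "w \<in> PS m"
      then have zwF: "z \<in> FS" "w \<in> FS" by (auto intro: PS_FS)
      show "mul (y \<otimes>\<^sub>C cre i x) (z \<otimes>\<^sub>C w) = mul (ann i y \<otimes>\<^sub>C x) (z \<otimes>\<^sub>C w)"
      proof (cases "i \<le> n")
        case True
        then show ?thesis
          using PP_cre_right[OF conc_PS[OF xy(1) zw(2)], of "path_conc y z" i] conc_PS[OF xy(2) zw(1)]
          by (simp add: mul_tensor ann_conc_left[OF xy(2) True zwF(1)] flip: cre_conc_left[OF xy(1) True zwF(2)])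
      next
        case False
        then show ?thesis using cre_PS_short[OF xy(1)] ann_PS_short[OF xy(2)] by simp
      qed
    qed (simp_all add: FS)
  qed
qed

lemma invariant_mul_right:
  assumes c: "c \<in> Q"
  shows "invariant (\<lambda>X. mul c X)"
proof -
  have cF: "c \<in> FS" using c Q_FS by blast
  have *: "mul c (u \<otimes>\<^sub>C v) = mul c (u' \<otimes>\<^sub>C v')" if FS: "u \<in> FS" "v \<in> FS" "u' \<in> FS" "v' \<in> FS"
    and eq: "\<And>m z w. z \<in> PS m \<Longrightarrow> w \<in> PS m \<Longrightarrow> mul (z \<otimes>\<^sub>C w) (u \<otimes>\<^sub>C v) = mul (z \<otimes>\<^sub>C w) (u' \<otimes>\<^sub>C v')"
    for u v u' v'
    by (rule Q_eqI[OF bilinear_FS_left[OF bilinear_mul] bilinear_FS_left[OF bilinear_mul] c])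
      (auto intro!: FS_tensor FS eq)
  show ?thesis
  proof (rule invariantI[OF bilinear_FS_right[OF bilinear_mul cF]])
    fix n i x y assume xy: "x \<in> PS n" "y \<in> PS (n + 2)"
    then have FS: "x \<in> FS" "y \<in> FS" by (auto intro: PS_FS)
    show "mul c (cre i x \<otimes>\<^sub>C y) = mul c (x \<otimes>\<^sub>C ann i y)"
    proof (rule *)
      fix m z w assume zw: "z \<in> PS m" "w \<in> PS m"
      have "path_conc w y \<in> PS (m + n + 2)" using conc_PS[OF zw(2) xy(2)] by simp
      then show "mul (z \<otimes>\<^sub>C w) (cre i x \<otimes>\<^sub>C y) = mul (z \<otimes>\<^sub>C w) (x \<otimes>\<^sub>C ann i y)"
        using PP_cre_left[OF conc_PS[OF zw(1) xy(1)], of "path_conc w y" "m + i"]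
        by (simp add: mul_tensor ann_conc_right[OF zw(2) FS(2)] flip: cre_conc_right[OF zw(1) FS(1)])
    qed (simp_all add: FS)
    show "mul c (y \<otimes>\<^sub>C cre i x) = mul c (ann i y \<otimes>\<^sub>C x)"
    proof (rule *)
      fix m z w assume zw: "z \<in> PS m" "w \<in> PS m"
      have "path_conc z y \<in> PS (m + n + 2)" using conc_PS[OF zw(1) xy(2)] by simp
      then show "mul (z \<otimes>\<^sub>C w) (y \<otimes>\<^sub>C cre i x) = mul (z \<otimes>\<^sub>C w) (ann i y \<otimes>\<^sub>C x)"
        using PP_cre_right[OF conc_PS[OF zw(2) xy(1)], of "path_conc z y" "m + i"]
        by (simp add: mul_tensor ann_conc_right[OF zw(1) FS(2)] flip: cre_conc_right[OF zw(2) FS(1)])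
    qed (simp_all add: FS)
  qed
qed

lemma end_conc_assoc:
  assumes "a \<in> Q" "b \<in> Q" "c \<in> Q"
  shows "end_conc (end_conc a b) c = end_conc a (end_conc b c)"
proof -
  have FS: "a \<in> FS" "b \<in> FS" "c \<in> FS" using assms Q_FS by auto
  show ?thesis
  proof (rule bilinear_Q_eqI[OF _ _ assms(1,2), of "\<lambda>a b. end_conc (end_conc a b) c" "\<lambda>a b. end_conc a (end_conc b c)"])
    show "bilinear_FS (\<lambda>a b. end_conc (end_conc a b) c)" "bilinear_FS (\<lambda>a b. end_conc a (end_conc b c))"
      by (rule bilinear_FSI; simp add: linear_simps FS)+
    fix n m x y z w assume "x \<in> PS n" "y \<in> PS n" "z \<in> PS m" "w \<in> PS m"
    then have *: "x \<in> FS" "y \<in> FS" "z \<in> FS" "w \<in> FS" by (auto intro: PS_FS)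
    show "end_conc (end_conc (x \<otimes>\<^sub>C y) (z \<otimes>\<^sub>C w)) c = end_conc (x \<otimes>\<^sub>C y) (end_conc (z \<otimes>\<^sub>C w) c)"
    proof (rule Q_eqI[OF _ _ assms(3), of "\<lambda>c. end_conc (end_conc (x \<otimes>\<^sub>C y) (z \<otimes>\<^sub>C w)) c"])
      show "linear_on FS (\<lambda>c. end_conc (end_conc (x \<otimes>\<^sub>C y) (z \<otimes>\<^sub>C w)) c)"
        "linear_on FS (\<lambda>c. end_conc (x \<otimes>\<^sub>C y) (end_conc (z \<otimes>\<^sub>C w) c))"
        by (rule linear_onI; simp add: linear_simps *)+
    qed (simp add: end_conc_tensor conc_assoc * PS_FS)
  qed
qed

lemma mul_assoc:
  assumes "a \<in> A" "b \<in> A" "c \<in> A"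
  shows "mul (mul a b) c = mul a (mul b c)"
proof -
  have Q: "a \<in> Q" "b \<in> Q" "c \<in> Q" using assms A_Q by auto
  have "mul (mul a b) c = mul (end_conc a b) c"
    unfolding mul_def[of a b] by (rule invariant_PP_eq[OF invariant_mul_left[OF Q(3)] end_conc_Q[OF Q(1,2)]])
  also have "\<dots> = mul a (end_conc b c)"
    by (simp add: mul_def end_conc_assoc Q)
  also have "\<dots> = mul a (mul b c)"
    unfolding mul_def[of b c] by (rule invariant_PP_eq[OF invariant_mul_right[OF Q(1)] end_conc_Q[OF Q(2,3)], symmetric])
  finally show ?thesis .
qed

lemma ess_one_eq: "ess_one G = vertex_sum \<otimes>\<^sub>C vertex_sum"
  by (simp add: ess_one_def vertex_sum_def tensor_sum_left tensor_sum_right) (rule sum.swap)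

lemma vertex_sum_ess: "vertex_sum \<in> E 0"
  using vertex_sum_PS by (simp add: ess_space_small)

lemma one_closed: "ess_one G \<in> A"
  unfolding ess_one_eq by (intro tensor_A[of _ 0] vertex_sum_ess)

lemma mul_one:
  assumes "a \<in> A"
  shows "mul (ess_one G) a = a" "mul a (ess_one G) = a"
proof -
  have "ess_one G \<in> FS" using one_closed A_FS by blast
  then have lin: "linear_on FS (\<lambda>a. mul (ess_one G) a)" "linear_on FS (\<lambda>a. mul a (ess_one G))"
    by (simp_all add: bilinear_FS_left bilinear_FS_right)
  show "mul (ess_one G) a = a"
    by (rule A_eqI[OF lin(1) linear_on_id assms])
      (simp add: ess_one_eq mul_tensor conc_vertex_left[OF ess_PS] PP_ess_tensor)
  show "mul a (ess_one G) = a"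
    by (rule A_eqI[OF lin(2) linear_on_id assms])
      (simp add: ess_one_eq mul_tensor conc_vertex_right[OF ess_PS] PP_ess_tensor)
qed

section \<open>The star\<close>

lemma path_star_PS: "x \<in> PS n \<Longrightarrow> path_star x \<in> PS n"
  by (simp add: path_star_eq rv_PS cj_PS)

lemma FS_path_star [simp]: "(x :: 'v list \<Rightarrow> complex) \<in> FS \<Longrightarrow> path_star x \<in> FS"
  by (simp add: path_star_eq)

lemma path_star_cre: "x \<in> PS n \<Longrightarrow> i \<le> n \<Longrightarrow> path_star (cre i x) = cre (n - i) (path_star x)"
  by (simp add: path_star_eq rv_cre cj_cre PS_FS)

lemma path_star_ann: "x \<in> PS (n + 2) \<Longrightarrow> i \<le> n \<Longrightarrow> path_star (ann i x) = ann (n - i) (path_star x)"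
  by (simp add: path_star_eq rv_ann cj_ann PS_FS del: add_2_eq_Suc')

lemma path_star_conc: "(x :: 'v list \<Rightarrow> complex) \<in> FS \<Longrightarrow> y \<in> FS \<Longrightarrow> path_star (path_conc x y) = path_conc (path_star y) (path_star x)"
  by (simp add: path_star_eq rv_conc cj_conc)

lemma path_star_star [simp]: "path_star (path_star x) = x"
  by (simp add: path_star_def)

lemma rv_ess:
  assumes "x \<in> E n"
  shows "rv x \<in> E n"
proof (cases "n < 2")
  case True
  then show ?thesis using assms rv_PS by (simp add: ess_space_small)
next
  case False
  then obtain m where n: "n = m + 2" by (intro that[of "n - 2"]) simp
  have x: "x \<in> PS (m + 2)" using assms n ess_PS by blast
  have "ann i (rv x) = 0" for i
  proof (cases "i \<le> m")
    case True
    then show ?thesis using rv_ann[OF x, of "m - i"] assms by (simp add: ess_ann lin_zero[OF lin_rv])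
  next
    case False
    then show ?thesis using ann_PS_short[OF rv_PS[OF x]] by simp
  qed
  then show ?thesis using rv_PS[OF x] by (simp add: ess_space_iff n)
qed

lemma cj_ess: "x \<in> E n \<Longrightarrow> cj x \<in> E n"
  by (auto simp: ess_space_iff cj_PS PS_FS simp flip: cj_ann) (simp add: cj_def fun_eq_iff pointwise)

lemma wgt_ess: "x \<in> E n \<Longrightarrow> wgt f x \<in> E n"
  by (auto simp: ess_space_iff wgt_PS PS_FS simp flip: wgt_ann) (simp add: wgt_def fun_eq_iff pointwise)

lemma path_star_ess: "x \<in> E n \<Longrightarrow> path_star x \<in> E n"
  by (simp add: path_star_eq rv_ess cj_ess)

lemma ess_star_end_gr:
  assumes W: "\<And>n x. x \<in> W n \<Longrightarrow> path_star x \<in> W n" and X: "X \<in> end_gr W"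
  shows "ess_star X \<in> end_gr W"
proof -
  have "cfun.subspace {X. ess_star X \<in> end_gr W}"
    using cfun.subspace_add[OF end_gr_subspace] cfun.subspace_scale[OF end_gr_subspace]
    by (auto simp: cfun.subspace_def ess_star_add ess_star_scale cfun.subspace_0[OF end_gr_subspace])
  then have "end_gr W \<subseteq> {X. ess_star X \<in> end_gr W}"
    by (rule end_gr_minimal) (auto simp: ess_star_tensor intro: tensor_end_gr W)
  with X show ?thesis by blast
qed

lemma ess_star_Q: "X \<in> Q \<Longrightarrow> ess_star X \<in> Q"
  by (rule ess_star_end_gr[OF path_star_PS])

lemma ess_star_A: "X \<in> A \<Longrightarrow> ess_star X \<in> A"
  unfolding ess_algebra_def by (rule ess_star_end_gr[OF path_star_ess])

text \<open>Applying the star before and after \<open>PP\<close> gives a linear map, which can be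
  compared with \<open>PP\<close> by invariance. The involution then turns the equality into
  commutation.\<close>

lemma ess_star_PP:
  assumes "X \<in> Q"
  shows "ess_star (PP X) = PP (ess_star X)"
proof -
  have "ess_star (PP (ess_star Y)) = PP Y" if "Y \<in> Q" for Y
  proof (rule invariant_eqI[OF _ invariant_PP _ that, of "\<lambda>Y. ess_star (PP (ess_star Y))"])
    show "invariant (\<lambda>Y. ess_star (PP (ess_star Y)))"
    proof (rule invariantI)
      show "linear_on FS (\<lambda>Y. ess_star (PP (ess_star Y)))"
        by (rule linear_onI) (simp_all add: ess_star_add ess_star_scale linear_simps)
      fix n i x y assume xy: "x \<in> PS n" "y \<in> PS (n + 2)"
      note * = path_star_PS[OF xy(1)] path_star_PS[OF xy(2)]
      show "ess_star (PP (ess_star (cre i x \<otimes>\<^sub>C y))) = ess_star (PP (ess_star (x \<otimes>\<^sub>C ann i y)))"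
        "ess_star (PP (ess_star (y \<otimes>\<^sub>C cre i x))) = ess_star (PP (ess_star (ann i y \<otimes>\<^sub>C x)))"
        using PP_cre_left[OF *, of "n - i"] PP_cre_right[OF *, of "n - i"]
          path_star_cre[OF xy(1), of i] path_star_ann[OF xy(2), of i] cre_PS_short[OF xy(1), of i] ann_PS_short[OF xy(2), of i]
        by (cases "i \<le> n"; simp add: ess_star_tensor)+
    qed
  qed (simp add: ess_star_tensor PP_ess_tensor[OF path_star_ess path_star_ess] PP_ess_tensor)
  from this[OF ess_star_Q[OF assms]] show ?thesis by (metis ess_star_star)
qed

lemma ess_star_end_conc:
  assumes "a \<in> Q" "b \<in> Q"
  shows "ess_star (end_conc a b) = end_conc (ess_star b) (ess_star a)"
proof -
  have "ess_star (end_conc (ess_star c) (ess_star d)) = end_conc d c" if "c \<in> Q" "d \<in> Q" for c d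
  proof (rule bilinear_Q_eqI[OF _ _ that, of "\<lambda>c d. ess_star (end_conc (ess_star c) (ess_star d))" "\<lambda>c d. end_conc d c"])
    show "bilinear_FS (\<lambda>c d. ess_star (end_conc (ess_star c) (ess_star d)))" "bilinear_FS (\<lambda>c d :: 'v list \<times> 'v list \<Rightarrow> complex. end_conc d c)"
      by (rule bilinear_FSI; simp add: linear_simps ess_star_add ess_star_scale)+
  qed (simp add: ess_star_tensor end_conc_tensor path_star_conc PS_FS)
  from this[OF ess_star_Q[OF assms(1)] ess_star_Q[OF assms(2)]] show ?thesis by simp
qed

lemma ess_star_mul:
  assumes "a \<in> A" "b \<in> A"
  shows "ess_star (mul a b) = mul (ess_star b) (ess_star a)"
proof -
  have "a \<in> Q" "b \<in> Q" using assms A_Q by auto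
  then show ?thesis by (simp add: mul_def ess_star_PP end_conc_Q ess_star_end_conc)
qed

section \<open>The counit\<close>

text \<open>Scalars are encoded as functions on a one-element type, so that the linear methods for
  function spaces apply to the counit.\<close>

definition counit :: "('v list \<times> 'v list \<Rightarrow> complex) \<Rightarrow> (unit \<Rightarrow> complex)"
  where "counit = lin_ext (\<lambda>(p, q) _. inner_prod (basis_vec p) (basis_vec q))"

lemma lin_counit [simp]: "linear_on FS counit"
  by (simp add: counit_def)

lemma FS_unit [simp]: "(x :: unit \<Rightarrow> complex) \<in> FS"
  by (simp add: FS_def)

lemma ess_counit_eq: "ess_counit a = counit a ()"
  by (simp add: ess_counit_def counit_def lin_ext_apply case_prod_unfold)

text \<open>The counit extends its formula bilinearly, whereas \<open>inner_prod\<close> is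
  antilinear in the second argument; \<open>cj\<close> compensates.\<close>

lemma counit_tensor:
  assumes "x \<in> FS" "y \<in> FS"
  shows "counit (x \<otimes>\<^sub>C y) = (\<lambda>_. inner_prod x (cj y))"
proof (rule bilinear_eqI[of "\<lambda>x y. counit (x \<otimes>\<^sub>C y)" "\<lambda>x y _. inner_prod x (cj y)", OF _ _ assms])
  show "bilinear_FS (\<lambda>x y :: 'v list \<Rightarrow> complex. counit (x \<otimes>\<^sub>C y))"
    by (rule bilinear_FS_post[OF bilinear_FS_tensor lin_counit]) simp
  have "inner_prod x (cj (y + z)) = inner_prod x (cj y) + inner_prod x (cj z)"
    "inner_prod x (cj (k *\<^sub>C y)) = k * inner_prod x (cj y)" for x y z :: "'v list \<Rightarrow> complex" and k
    by (simp_all add: inner_prod_def cj_def pointwise distrib_left sum.distrib sum_distrib_left mult_ac)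
  then show "bilinear_FS (\<lambda>(x :: 'v list \<Rightarrow> complex) y (u :: unit). inner_prod x (cj y))"
    by (intro bilinear_FSI)
      (simp_all add: fun_eq_iff pointwise inner_prod_add_left inner_prod_scale_left)
qed (simp add: counit_def tensor_basis_vec)

lemma counit_symmetric: "x \<in> FS \<Longrightarrow> y \<in> FS \<Longrightarrow> counit (x \<otimes>\<^sub>C y) = counit (y \<otimes>\<^sub>C x)"
  by (simp add: counit_tensor fun_eq_iff inner_prod_eq_sum[of "supp x \<union> supp y"] FS_def cj_def mult.commute)

text \<open>One relation is the adjointness of \<open>ann i\<close> and \<open>cre i\<close>, and
  the other follows from the symmetry of the bilinear pairing.\<close>

lemma invariant_counit: "invariant counit"
proof (rule invariantI[OF lin_counit])
  fix n i x y assume xy: "x \<in> PS n" "y \<in> PS (n + 2)"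
  then have FS: "x \<in> FS" "y \<in> FS" by (auto intro: PS_FS)
  show right: "counit (y \<otimes>\<^sub>C cre i x) = counit (ann i y \<otimes>\<^sub>C x)"
    using ann_cre_inner_prod[OF xy(2) cj_PS[OF xy(1)], of i] FS by (simp add: counit_tensor cj_cre)
  show "counit (cre i x \<otimes>\<^sub>C y) = counit (x \<otimes>\<^sub>C ann i y)"
    using right FS counit_symmetric[of "cre i x" y] counit_symmetric[of x "ann i y"] by simp
qed

lemma counit_mul: "a \<in> Q \<Longrightarrow> b \<in> Q \<Longrightarrow> counit (mul a b) = counit (end_conc a b)"
  unfolding mul_def by (rule invariant_PP_eq[OF invariant_counit end_conc_Q])

end

lemma inner_prod_scale_right: "inner_prod x (c *\<^sub>C y) = cnj c * inner_prod x y"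
  by (simp add: inner_prod_def pointwise sum_distrib_left mult_ac)

lemma inner_prod_sum_right: "inner_prod x (\<Sum>i\<in>I. y i) = (\<Sum>i\<in>I. inner_prod x (y i))"
  unfolding inner_prod_def pointwise cnj_sum sum_distrib_left by (rule sum.swap)

lemma inner_prod_basis_right: "x \<in> FS \<Longrightarrow> inner_prod x (basis_vec p) = x p"
proof -
  assume "x \<in> FS"
  have "inner_prod x (basis_vec p) = (\<Sum>b\<in>supp x. x b * basis_vec b p)"
    unfolding inner_prod_def by (rule sum.cong) (auto simp: basis_vec_def)
  with \<open>x \<in> FS\<close> show ?thesis by (simp add: expand_basis FS_def)
qed

context perron_graph
begin

section \<open>Unique splitting of walks and positivity of the counit\<close>

lemma inner_prod_cj: "inner_prod (cj x) (cj y) = cnj (inner_prod x y)"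
  unfolding inner_prod_def supp_cj by (simp add: cj_def)

lemma inner_prod_rv: "inner_prod (rv x) y = inner_prod x (rv y)"
  unfolding inner_prod_def supp_rv by (subst sum.reindex) (auto simp: rv_def inj_on_def)

lemma wt_self: "v \<in> pverts G \<Longrightarrow> wt v v = 1"
  using mu_pos[of v] by (simp add: wt_def)

lemma wt_mult: "v \<in> pverts G \<Longrightarrow> wt u v * wt v w = wt u w"
  using mu_pos[of v] by (simp add: wt_def flip: of_real_mult real_sqrt_mult)

lemma walks_ends: "p \<in> walks n \<Longrightarrow> hd p \<in> pverts G \<and> last p \<in> pverts G"
  using walksD[of p n] hd_in_set[of p] last_in_set[of p] by auto

lemma join_inj:
  assumes "p \<in> walks n" "p' \<in> walks n" "joinable p q" "joinable p' q'" "p @ tl q = p' @ tl q'"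
  shows "p = p' \<and> q = q'"
proof -
  have "length p = length p'" using assms(1,2) walksD by auto
  then have *: "p = p'" "tl q = tl q'" using assms(5) by auto
  moreover have "hd q = hd q'" "q \<noteq> []" "q' \<noteq> []" using assms(3,4) * by (auto simp: joinable_def)
  ultimately show ?thesis by (metis list.exhaust_sel)
qed

lemma walks_split: "r \<in> walks (n + m) \<Longrightarrow> \<exists>p\<in>walks n. \<exists>q\<in>walks m. joinable p q \<and> r = p @ tl q"
proof (induction n arbitrary: r)
  case 0
  then show ?case using walksD[OF 0] walks_ends[OF 0]
    by (intro bexI[of _ "[hd r]"] bexI[of _ r]) (auto simp: joinable_def walks_single)
next
  case (Suc n)
  obtain u v s where r: "r = u # v # s" using walksD[OF Suc.prems] by (auto simp: length_Suc_conv)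
  then have uv: "(u, v) \<in> parcs G" "v # s \<in> walks (n + m)" using Suc.prems by (auto simp: walks_Cons)
  obtain p q where pq: "p \<in> walks n" "q \<in> walks m" "joinable p q" "v # s = p @ tl q"
    using Suc.IH[OF uv(2)] by auto
  then obtain p' where p: "p = v # p'" by (cases p) (auto simp: joinable_def)
  then have "u # p \<in> walks (Suc n)" using uv pq by (simp add: walks_Cons)
  then show ?case using pq p r by (intro bexI[of _ "u # p"] bexI[of _ q]) auto
qed

text \<open>A walk of length \<open>n + m\<close> splits in exactly one way into a walk of length
  \<open>n\<close> and one of length \<open>m\<close> that share a vertex.\<close>

lemma sum_walks_conc:
  fixes g :: "'v list \<Rightarrow> 'd::comm_monoid_add"
  shows "(\<Sum>p\<in>walks n. \<Sum>q\<in>walks m. if joinable p q then g (p @ tl q) else 0) = (\<Sum>r\<in>walks (n + m). g r)"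
proof -
  let ?J = "{z \<in> walks n \<times> walks m. joinable (fst z) (snd z)}"
  have "(\<Sum>p\<in>walks n. \<Sum>q\<in>walks m. if joinable p q then g (p @ tl q) else 0) =
      (\<Sum>z\<in>walks n \<times> walks m. if joinable (fst z) (snd z) then g (fst z @ tl (snd z)) else 0)"
    by (simp add: sum.cartesian_product case_prod_unfold)
  also have "\<dots> = (\<Sum>z\<in>?J. g (fst z @ tl (snd z)))" by (rule sum.inter_filter[symmetric]) simp
  also have "\<dots> = (\<Sum>r\<in>(\<lambda>z. fst z @ tl (snd z)) ` ?J. g r)"
    by (subst sum.reindex) (auto simp: inj_on_def dest: join_inj)
  also have "(\<lambda>z. fst z @ tl (snd z)) ` ?J = walks (n + m)"
    using walks_split by (fastforce simp: image_iff intro: walks_join)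
  finally show ?thesis .
qed

lemma conc_apply:
  assumes xy: "x \<in> PS n" "y \<in> PS m" and pq: "p \<in> walks n" "q \<in> walks m" "joinable p q"
  shows "path_conc x y (p @ tl q) = x p * y q"
proof -
  have "(\<lambda>_ :: unit. path_conc x y (p @ tl q)) = (\<lambda>_. x p * y q)"
  proof (rule bilinear_eqI[of "\<lambda>x y _. path_conc x y (p @ tl q)" "\<lambda>x y _. x p * y q"])
    show "bilinear_FS (\<lambda>x y (_ :: unit). path_conc x y (p @ tl q))"
      "bilinear_FS (\<lambda>x y (_ :: unit). x p * y q)"
      by (rule bilinear_FSI; simp add: linear_simps fun_eq_iff pointwise algebra_simps)+
    fix p' q' assume "p' \<in> supp x" "q' \<in> supp y"
    then have "p' \<in> walks n" "q' \<in> walks m" using xy by (auto simp: path_space_iff)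
    then show "(\<lambda>_ :: unit. path_conc (basis_vec p') (basis_vec q') (p @ tl q)) = (\<lambda>_. basis_vec p' p * basis_vec q' q)"
      unfolding conc_basis using join_inj[of p n p' q q'] pq by (auto simp: basis_vec_def pointwise)
  qed (use xy in \<open>auto intro: PS_FS\<close>)
  then show ?thesis by (simp add: fun_eq_iff)
qed

lemma conc_vertex_left_apply:
  assumes "y \<in> PS n" shows "path_conc (basis_vec [v]) y = (\<lambda>q. if hd q = v then y q else 0)"
proof (rule PS_eqI[OF conc_right _ assms, of "basis_vec [v]" "\<lambda>y q. if hd q = v then y q else 0"])
  show "linear_on FS (\<lambda>y q. if hd q = v then y q else 0)"
    by (rule linear_onI) (auto simp: fun_eq_iff pointwise)
  fix p assume "p \<in> walks n"
  then show "path_conc (basis_vec [v]) (basis_vec p) = (\<lambda>q. if hd q = v then basis_vec p q else 0)"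
    unfolding conc_basis by (auto simp: joinable_def basis_vec_def fun_eq_iff pointwise dest: walksD)
qed simp

lemma conc_vertex_right_apply:
  assumes "x \<in> PS n" shows "path_conc x (basis_vec [v]) = (\<lambda>p. if last p = v then x p else 0)"
proof (rule PS_eqI[OF conc_left _ assms, of "basis_vec [v]" "\<lambda>x p. if last p = v then x p else 0"])
  show "linear_on FS (\<lambda>x p. if last p = v then x p else 0)"
    by (rule linear_onI) (auto simp: fun_eq_iff pointwise)
  fix p assume "p \<in> walks n"
  then show "path_conc (basis_vec p) (basis_vec [v]) = (\<lambda>q. if last q = v then basis_vec p q else 0)"
    unfolding conc_basis by (auto simp: joinable_def basis_vec_def fun_eq_iff pointwise dest: walksD)
qed simp

lemma counit_tensor_sum:
  assumes "x \<in> PS n" "y \<in> PS n"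
  shows "counit (x \<otimes>\<^sub>C y) () = (\<Sum>p\<in>walks n. x p * y p)"
  using assms by (simp add: counit_tensor PS_FS inner_prod_eq_sum[of "walks n"] path_space_iff cj_def)

lemma counit_star:
  assumes "X \<in> Q"
  shows "counit (ess_star X) () = cnj (counit X ())"
proof -
  have "(\<lambda>_ :: unit. cnj (counit (ess_star X) ())) = counit X"
  proof (rule Q_eqI[OF _ lin_counit assms, of "\<lambda>X _. cnj (counit (ess_star X) ())"])
    show "linear_on FS (\<lambda>X (_ :: unit). cnj (counit (ess_star X) ()))"
      by (rule linear_onI) (simp_all add: ess_star_add ess_star_scale lin_add[OF lin_counit] lin_scale[OF lin_counit]
          fun_eq_iff pointwise)
    fix n x y assume "x \<in> PS n" "y \<in> PS n"
    then show "(\<lambda>_. cnj (counit (ess_star (x \<otimes>\<^sub>C y)) ())) = counit (x \<otimes>\<^sub>C y)"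
      by (simp add: ess_star_tensor counit_tensor PS_FS path_star_eq cj_rv inner_prod_rv inner_prod_cj)
        (use inner_prod_cj[of x "cj y"] in simp)
  qed
  then show ?thesis by (metis complex_cnj_cnj)
qed

text \<open>Only the diagonal matters for the counit, and a path factors uniquely at its middle vertex.\<close>
lemma counit_end_conc:
  assumes "a \<in> Q" "b \<in> Q"
  shows "counit (end_conc a b) () = (\<Sum>v\<in>pverts G.
    counit (end_conc a (vertex_sum \<otimes>\<^sub>C basis_vec [v])) () * counit (end_conc (basis_vec [v] \<otimes>\<^sub>C vertex_sum) b) ())"
proof -
  let ?R = "\<lambda>a b (_ :: unit). \<Sum>v\<in>pverts G. counit (end_conc a (vertex_sum \<otimes>\<^sub>C basis_vec [v])) () *
    counit (end_conc (basis_vec [v] \<otimes>\<^sub>C vertex_sum) b) ()"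
  have "(\<lambda>_. counit (end_conc a b) ()) = ?R a b"
  proof (rule bilinear_Q_eqI[OF _ _ assms, of "\<lambda>a b _. counit (end_conc a b) ()" ?R])
    show "bilinear_FS (\<lambda>a b (_ :: unit). counit (end_conc a b :: 'v list \<times> 'v list \<Rightarrow> complex) ())" "bilinear_FS ?R"
      by (rule bilinear_FSI; simp add: linear_simps lin_add[OF lin_counit] lin_scale[OF lin_counit] fun_eq_iff
          pointwise sum.distrib sum_distrib_left algebra_simps)+
    fix n m x x' y y' assume P: "x \<in> PS n" "x' \<in> PS n" "y \<in> PS m" "y' \<in> PS m"
    have C: "path_conc x y \<in> PS (n + m)" "path_conc x' y' \<in> PS (n + m)" using P by (auto intro: conc_PS)
    have v: "counit (x \<otimes>\<^sub>C path_conc x' (basis_vec [v])) () = (\<Sum>p\<in>walks n. if last p = v then x p * x' p else 0)"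
      "counit (path_conc (basis_vec [v]) y \<otimes>\<^sub>C y') () = (\<Sum>q\<in>walks m. if hd q = v then y q * y' q else 0)"
      if "v \<in> pverts G" for v
    proof -
      have "basis_vec [v] \<in> PS 0" using that by (simp add: basis_PS walks_single)
      then have "path_conc x' (basis_vec [v]) \<in> PS n" "path_conc (basis_vec [v]) y \<in> PS m"
        using conc_PS[OF P(2), of "basis_vec [v]" 0] conc_PS[of "basis_vec [v]" 0 y m] P(3) by auto
      then show "counit (x \<otimes>\<^sub>C path_conc x' (basis_vec [v])) () = (\<Sum>p\<in>walks n. if last p = v then x p * x' p else 0)"
        "counit (path_conc (basis_vec [v]) y \<otimes>\<^sub>C y') () = (\<Sum>q\<in>walks m. if hd q = v then y q * y' q else 0)"
        using P by (auto simp: counit_tensor_sum conc_vertex_left_apply conc_vertex_right_apply intro!: sum.cong)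
    qed
    have "counit (path_conc x y \<otimes>\<^sub>C path_conc x' y') () =
        (\<Sum>p\<in>walks n. \<Sum>q\<in>walks m. if joinable p q then path_conc x y (p @ tl q) * path_conc x' y' (p @ tl q) else 0)"
      unfolding counit_tensor_sum[OF C] by (rule sum_walks_conc[symmetric])
    also have "\<dots> = (\<Sum>p\<in>walks n. \<Sum>q\<in>walks m. \<Sum>v\<in>pverts G.
        (if last p = v then x p * x' p else 0) * (if hd q = v then y q * y' q else 0))"
    proof (intro sum.cong refl)
      fix p q assume pq: "p \<in> walks n" "q \<in> walks m"
      have "joinable p q \<longleftrightarrow> last p = hd q" using pq by (auto simp: joinable_def dest: walksD)
      \<comment> \<open>The sum over \<open>v\<close> detects joinability: its only possible term is
        the common vertex of \<open>p\<close> and \<open>q\<close>.\<close>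
      moreover have "(\<Sum>v\<in>pverts G. (if last p = v then x p * x' p else 0) * (if hd q = v then y q * y' q else 0)) =
          (\<Sum>v\<in>pverts G. if last p = v then (if hd q = v then x p * x' p * (y q * y' q) else 0) else 0)"
        by (intro sum.cong) auto
      ultimately show "(if joinable p q then path_conc x y (p @ tl q) * path_conc x' y' (p @ tl q) else 0) =
          (\<Sum>v\<in>pverts G. (if last p = v then x p * x' p else 0) * (if hd q = v then y q * y' q else 0))"
        using walks_ends[OF pq(1)] conc_apply[OF P(1,3) pq] conc_apply[OF P(2,4) pq]
        by (auto simp: finite_verts)
    qed
    also have "\<dots> = (\<Sum>v\<in>pverts G. \<Sum>p\<in>walks n. \<Sum>q\<in>walks m.
        (if last p = v then x p * x' p else 0) * (if hd q = v then y q * y' q else 0))"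
      by (rule trans[OF sum.cong[OF refl sum.swap] sum.swap])
    also have "\<dots> = (\<Sum>v\<in>pverts G. counit (x \<otimes>\<^sub>C path_conc x' (basis_vec [v])) () *
        counit (path_conc (basis_vec [v]) y \<otimes>\<^sub>C y') ())"
      by (simp add: v sum_product)
    finally show "(\<lambda>_. counit (end_conc (x \<otimes>\<^sub>C x') (y \<otimes>\<^sub>C y')) ()) = ?R (x \<otimes>\<^sub>C x') (y \<otimes>\<^sub>C y')"
      using P by (simp add: end_conc_tensor conc_vertex_left conc_vertex_right)
  qed
  then show ?thesis by (simp add: fun_eq_iff)
qed

text \<open>The counit sees only pairs of equal paths, and these start at the same vertex; fixing
  the start in one component is the same as fixing it in the other.\<close>

lemma counit_vertex_swap:
  assumes "c \<in> Q" "v \<in> pverts G"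
  shows "counit (end_conc (basis_vec [v] \<otimes>\<^sub>C vertex_sum) c) = counit (end_conc (vertex_sum \<otimes>\<^sub>C basis_vec [v]) c)"
proof (rule Q_eqI[OF _ _ assms(1), of "\<lambda>c. counit (end_conc (basis_vec [v] \<otimes>\<^sub>C vertex_sum) c)"])
  show "linear_on FS (\<lambda>c. counit (end_conc (basis_vec [v] \<otimes>\<^sub>C vertex_sum) c))"
    "linear_on FS (\<lambda>c. counit (end_conc (vertex_sum \<otimes>\<^sub>C basis_vec [v]) c))"
    by (rule linear_onI; simp add: linear_simps lin_add[OF lin_counit] lin_scale[OF lin_counit])+
  fix n x y assume P: "x \<in> PS n" "y \<in> PS n"
  have "basis_vec [v] \<in> PS 0" using assms by (simp add: basis_PS walks_single)
  then have C: "path_conc (basis_vec [v]) x \<in> PS n" "path_conc (basis_vec [v]) y \<in> PS n"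
    using conc_PS[of "basis_vec [v]" 0 _ n] P by auto
  have "counit (path_conc (basis_vec [v]) x \<otimes>\<^sub>C y) () = counit (x \<otimes>\<^sub>C path_conc (basis_vec [v]) y) ()"
    using P C by (auto simp: counit_tensor_sum conc_vertex_left_apply intro!: sum.cong)
  then have "counit (path_conc (basis_vec [v]) x \<otimes>\<^sub>C y) = counit (x \<otimes>\<^sub>C path_conc (basis_vec [v]) y)"
    by (simp add: fun_eq_iff)
  then show "counit (end_conc (basis_vec [v] \<otimes>\<^sub>C vertex_sum) (x \<otimes>\<^sub>C y)) =
      counit (end_conc (vertex_sum \<otimes>\<^sub>C basis_vec [v]) (x \<otimes>\<^sub>C y))"
    using P by (simp add: end_conc_tensor conc_vertex_left)
qed

text \<open>In the factorization of \<open>counit_end_conc\<close> the second factor at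
  \<open>v\<close> is the conjugate of the first, by \<open>counit_vertex_swap\<close> and the star.
  The result is a sum of squared moduli.\<close>

lemma counit_nonneg:
  assumes "a \<in> A"
  shows "Im (counit (mul a (ess_star a)) ()) = 0 \<and> Re (counit (mul a (ess_star a)) ()) \<ge> 0"
proof -
  have Q: "a \<in> Q" "ess_star a \<in> Q" using assms A_Q ess_star_Q by auto
  let ?\<phi> = "\<lambda>v. counit (end_conc a (vertex_sum \<otimes>\<^sub>C basis_vec [v])) ()"
  have "counit (end_conc (basis_vec [v] \<otimes>\<^sub>C vertex_sum) (ess_star a)) () = cnj (?\<phi> v)" if v: "v \<in> pverts G" for v
  proof -
    have b: "basis_vec [v] \<in> PS 0" using v by (simp add: basis_PS walks_single)
    have vq: "vertex_sum \<otimes>\<^sub>C basis_vec [v] \<in> Q" by (rule tensor_end_gr[of _ PS 0, OF vertex_sum_PS b])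
    have "path_star vertex_sum = vertex_sum" "path_star (basis_vec [v]) = basis_vec [v]"
      by (simp_all add: path_star_eq vertex_sum_def lin_sum[OF lin_rv])
        (auto simp: cj_def pointwise fun_eq_iff basis_vec_def intro!: sum.cong)
    then have "ess_star (vertex_sum \<otimes>\<^sub>C basis_vec [v]) = vertex_sum \<otimes>\<^sub>C basis_vec [v]"
      by (simp add: ess_star_tensor)
    then show ?thesis
      using counit_star[OF end_conc_Q[OF Q(1) vq]]
      by (simp add: counit_vertex_swap[OF Q(2) v] ess_star_end_conc[OF Q(1) vq])
  qed
  then have "counit (mul a (ess_star a)) () = (\<Sum>v\<in>pverts G. ?\<phi> v * cnj (?\<phi> v))"
    using Q by (simp add: counit_mul counit_end_conc)
  also have "\<dots> = complex_of_real (\<Sum>v\<in>pverts G. (cmod (?\<phi> v))\<^sup>2)"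
    by (simp add: complex_norm_square[symmetric])
  finally show ?thesis by (simp add: sum_nonneg)
qed

section \<open>The antipode\<close>

abbreviation "wdn \<equiv> wgt wt"
abbreviation "wup \<equiv> wgt (\<lambda>s t. wt t s)"

lemma FS_antipode [simp]: "a \<in> FS \<Longrightarrow> ess_antipode \<mu> a \<in> FS"
  unfolding ess_antipode_def path_star_eq by (rule FS_lin_ext) (auto intro!: FS_scale FS_tensor)

text \<open>The square root is a product of one factor for the ends of \<open>y\<close> and one for
  the ends of \<open>x\<close>. Reversal appears without conjugation, because the formula is
  extended linearly from elementary paths.\<close>

lemma antipode_tensor:
  assumes "x \<in> FS" "y \<in> FS"
  shows "ess_antipode \<mu> (x \<otimes>\<^sub>C y) = rv (wdn y) \<otimes>\<^sub>C rv (wup x)"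
proof (rule bilinear_eqI[of "\<lambda>x y. ess_antipode \<mu> (x \<otimes>\<^sub>C y)" "\<lambda>x y. rv (wdn y) \<otimes>\<^sub>C rv (wup x)", OF _ _ assms])
  show "bilinear_FS (\<lambda>x y :: 'v list \<Rightarrow> complex. ess_antipode \<mu> (x \<otimes>\<^sub>C y))"
    "bilinear_FS (\<lambda>x y. rv (wdn y) \<otimes>\<^sub>C rv (wup x))"
    by (rule bilinear_FSI; simp add: linear_simps)+
  fix p q :: "'v list"
  have "complex_of_real (sqrt (\<mu> (hd q) * \<mu> (last p) / (\<mu> (last q) * \<mu> (hd p)))) =
      wt (hd q) (last q) * wt (last p) (hd p)"
    by (simp add: wt_def real_sqrt_mult real_sqrt_divide)
  then show "ess_antipode \<mu> (basis_vec p \<otimes>\<^sub>C basis_vec q) = rv (wdn (basis_vec q)) \<otimes>\<^sub>C rv (wup (basis_vec p))"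
    by (simp add: tensor_basis_vec ess_antipode_def path_star_eq wgt_basis linear_simps mult_ac)
qed

lemma wup_wdn: "x \<in> PS n \<Longrightarrow> wup (wdn x) = x" and wdn_wup: "x \<in> PS n \<Longrightarrow> wdn (wup x) = x"
proof -
  have "wt (hd p) (last p) * wt (last p) (hd p) * x p = x p" if "x \<in> PS n" for p
    using walks_ends[of p n] that
    by (cases "x p = 0") (auto simp: wt_mult wt_self path_space_iff supp_def)
  then show "x \<in> PS n \<Longrightarrow> wup (wdn x) = x" "x \<in> PS n \<Longrightarrow> wdn (wup x) = x"
    by (simp_all add: wgt_def fun_eq_iff mult.assoc[symmetric] mult.commute[of "wt (last _) _"])
qed

text \<open>The vertex at the joint cancels from a multiplicative weight. Applied to
  \<open>wt\<close> and its inverse, this makes the antipode antimultiplicative before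
  projection.\<close>

lemma wgt_conc:
  assumes f: "\<And>u v w. v \<in> pverts G \<Longrightarrow> f u v * f v w = f u w" and xy: "x \<in> PS n" "y \<in> PS m"
  shows "wgt f (path_conc x y) = path_conc (wgt f x) (wgt f y)"
proof (rule bilinear_eqI[of "\<lambda>x y. wgt f (path_conc x y)" "\<lambda>x y. path_conc (wgt f x) (wgt f y)"])
  show "bilinear_FS (\<lambda>x y. wgt f (path_conc x y))" "bilinear_FS (\<lambda>x y. path_conc (wgt f x) (wgt f y))"
    by (rule bilinear_FSI; simp add: linear_simps)+
  fix p q assume "p \<in> supp x" "q \<in> supp y"
  then have pq: "p \<in> walks n" "q \<in> walks m" using xy by (auto simp: path_space_iff)
  show "wgt f (path_conc (basis_vec p) (basis_vec q)) = path_conc (wgt f (basis_vec p)) (wgt f (basis_vec q))"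
  proof (cases "joinable p q")
    case True
    have "last (p @ tl q) = last q" "hd (p @ tl q) = hd p"
      using True by (cases q; auto simp: joinable_def)+
    then show ?thesis
      using True walks_ends[OF pq(1)] f[of "last p" "hd p" "last q"]
      by (simp add: conc_basis wgt_basis linear_simps joinable_def mult.commute)
  next
    case False
    then show ?thesis by (simp add: conc_basis wgt_basis linear_simps lin_zero[OF lin_wgt])
  qed
qed (use xy in \<open>auto intro: PS_FS\<close>)

lemma antipode_A_tensor: "x \<in> E n \<Longrightarrow> y \<in> E n \<Longrightarrow> ess_antipode \<mu> (x \<otimes>\<^sub>C y) \<in> A"
  by (simp add: antipode_tensor ess_FS) (intro tensor_A[of _ n] rv_ess wgt_ess)

lemma antipode_closed:
  assumes "a \<in> A"
  shows "ess_antipode \<mu> a \<in> A"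
proof -
  have "cfun.subspace {a \<in> FS. ess_antipode \<mu> a \<in> A}"
    using cfun.subspace_add[OF A_subspace] cfun.subspace_scale[OF A_subspace]
    by (auto simp: cfun.subspace_def linear_simps lin_zero[OF linear_antipode] cfun.subspace_0[OF A_subspace])
  then have "end_gr E \<subseteq> {a \<in> FS. ess_antipode \<mu> a \<in> A}"
    by (rule end_gr_minimal) (auto intro: FS_tensor ess_FS antipode_A_tensor)
  with assms show ?thesis by (auto simp: ess_algebra_def)
qed

text \<open>Reversal and weights preserve each relation, while the exchange of tensor factors
  interchanges the two families of relations.\<close>

lemma antipode_PP:
  assumes "X \<in> Q"
  shows "ess_antipode \<mu> (PP X) = PP (ess_antipode \<mu> X)"
proof (rule invariant_eqI[OF invariant_post[OF invariant_PP linear_antipode FS_PP] _ _ assms])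
  show "invariant (\<lambda>X. PP (ess_antipode \<mu> X))"
  proof (rule invariantI)
    show "linear_on FS (\<lambda>X. PP (ess_antipode \<mu> X))"
      by (rule linear_on_compose[OF linear_antipode lin_PP]) simp
    fix n i x y assume xy: "x \<in> PS n" "y \<in> PS (n + 2)"
    then have FS: "x \<in> FS" "y \<in> FS" by (auto intro: PS_FS)
    have W: "rv (wgt f x) \<in> PS n" "rv (wgt f y) \<in> PS (n + 2)" for f using xy by (auto intro: rv_PS wgt_PS simp del: add_2_eq_Suc')
    have "rv (wgt f (cre i x)) = cre (n - i) (rv (wgt f x))" "rv (wgt f (ann i y)) = ann (n - i) (rv (wgt f y))"
      if "i \<le> n" for f
      using rv_cre[OF wgt_PS[OF xy(1)] that] rv_ann[OF wgt_PS[OF xy(2)] that] FS by (simp_all add: wgt_cre wgt_ann)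
    moreover have "cre i x = 0" "ann i y = 0" if "\<not> i \<le> n"
      using that cre_PS_short[OF xy(1)] ann_PS_short[OF xy(2)] by auto
    ultimately show "PP (ess_antipode \<mu> (cre i x \<otimes>\<^sub>C y)) = PP (ess_antipode \<mu> (x \<otimes>\<^sub>C ann i y))"
      "PP (ess_antipode \<mu> (y \<otimes>\<^sub>C cre i x)) = PP (ess_antipode \<mu> (ann i y \<otimes>\<^sub>C x))"
      using FS PP_cre_left[OF W] PP_cre_right[OF W]
      by (cases "i \<le> n"; simp add: antipode_tensor)+
  qed
  fix n x y assume "x \<in> E n" "y \<in> E n"
  then show "ess_antipode \<mu> (PP (x \<otimes>\<^sub>C y)) = PP (ess_antipode \<mu> (x \<otimes>\<^sub>C y))"
    by (simp add: PP_ess_tensor PP_ess antipode_A_tensor)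
qed simp

lemma antipode_end_conc:
  assumes "a \<in> Q" "b \<in> Q"
  shows "ess_antipode \<mu> (end_conc a b) = end_conc (ess_antipode \<mu> b) (ess_antipode \<mu> a)"
proof (rule bilinear_Q_eqI[OF _ _ assms, of "\<lambda>a b. ess_antipode \<mu> (end_conc a b)"])
  show "bilinear_FS (\<lambda>a b :: 'v list \<times> 'v list \<Rightarrow> complex. ess_antipode \<mu> (end_conc a b))"
    "bilinear_FS (\<lambda>a b. end_conc (ess_antipode \<mu> b) (ess_antipode \<mu> a))"
    by (rule bilinear_FSI; simp add: linear_simps)+
  fix n m x y z w assume P: "x \<in> PS n" "y \<in> PS n" "z \<in> PS m" "w \<in> PS m"
  then have FS: "x \<in> FS" "y \<in> FS" "z \<in> FS" "w \<in> FS" by (auto intro: PS_FS)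
  have "wdn (path_conc y w) = path_conc (wdn y) (wdn w)"
    by (rule wgt_conc[OF _ P(2,4)]) (rule wt_mult)
  moreover have "wup (path_conc x z) = path_conc (wup x) (wup z)"
    by (rule wgt_conc[OF _ P(1,3)]) (subst mult.commute, rule wt_mult)
  ultimately show "ess_antipode \<mu> (end_conc (x \<otimes>\<^sub>C y) (z \<otimes>\<^sub>C w)) =
      end_conc (ess_antipode \<mu> (z \<otimes>\<^sub>C w)) (ess_antipode \<mu> (x \<otimes>\<^sub>C y))"
    using FS by (simp add: end_conc_tensor antipode_tensor rv_conc)
qed

lemma antipode_mul:
  assumes "a \<in> A" "b \<in> A"
  shows "ess_antipode \<mu> (mul a b) = mul (ess_antipode \<mu> b) (ess_antipode \<mu> a)"
proof -
  have "a \<in> Q" "b \<in> Q" using assms A_Q by auto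
  then show ?thesis by (simp add: mul_def antipode_PP end_conc_Q antipode_end_conc)
qed

lemma cj_wgt: "(\<And>s t. cnj (f s t) = f s t) \<Longrightarrow> cj (wgt f x) = wgt f (cj x)"
  by (simp add: cj_def wgt_def)

lemma wt_real [simp]: "cnj (wt s t) = wt s t"
  by (simp add: wt_def)

text \<open>The antipode exchanges the tensor factors, so after two applications each factor has
  received both weights, which are inverse to each other; the reversals and conjugations cancel in
  pairs.\<close>

lemma antipode_star:
  assumes "a \<in> A"
  shows "ess_antipode \<mu> (ess_star (ess_antipode \<mu> (ess_star a))) = a"
proof (rule A_eqI[OF _ linear_on_id assms, of "\<lambda>a. ess_antipode \<mu> (ess_star (ess_antipode \<mu> (ess_star a)))"])
  show "linear_on FS (\<lambda>a. ess_antipode \<mu> (ess_star (ess_antipode \<mu> (ess_star a))))"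
    by (rule linear_onI) (simp_all add: ess_star_add ess_star_scale linear_simps)
  fix n x y assume "x \<in> E n" "y \<in> E n"
  then have P: "x \<in> PS n" "y \<in> PS n" and FS: "x \<in> FS" "y \<in> FS" by (auto intro: ess_PS ess_FS)
  have star: "path_star (rv (wgt f (path_star z))) = wgt f (rv z)" if "\<And>s t. cnj (f s t) = f s t" for f z
    using that by (simp add: path_star_eq cj_wgt cj_rv)
  have "ess_antipode \<mu> (ess_star (ess_antipode \<mu> (ess_star (x \<otimes>\<^sub>C y)))) =
      rv (wdn (wup (rv x))) \<otimes>\<^sub>C rv (wup (wdn (rv y)))"
    using FS by (simp add: ess_star_tensor antipode_tensor star)
  then show "ess_antipode \<mu> (ess_star (ess_antipode \<mu> (ess_star (x \<otimes>\<^sub>C y)))) = x \<otimes>\<^sub>C y"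
    using P by (simp add: wdn_wup[OF rv_PS] wup_wdn[OF rv_PS])
qed

text \<open>Nested creation operators at the middle of a path run through all closed walks of the form
  \<open>rev p @ tl p\<close>, with exactly the weight that enters the antipode.\<close>
lemma creates_nested:
  assumes "v \<in> pverts G"
  shows "creates G \<mu> [0..<n] (basis_vec [v]) =
    (\<Sum>p\<in>{p \<in> walks n. last p = v}. wt (hd p) (last p) *\<^sub>C basis_vec (rev p @ tl p))"
proof (induction n)
  case 0
  have "{p \<in> walks 0. last p = v} = {[v]}" using assms by (auto simp: walks_0)
  then show ?case using assms by (simp add: wt_self)
next
  case (Suc n)
  let ?L = "\<lambda>n. {p \<in> walks n. last p = v}"
  have "creates G \<mu> [0..<Suc n] (basis_vec [v]) =
      (\<Sum>p\<in>?L n. wt (hd p) (last p) *\<^sub>C cre n (basis_vec (rev p @ tl p)))"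
    using Suc by (simp add: lin_sum[OF lin_cre] lin_scale[OF lin_cre])
  also have "\<dots> = (\<Sum>p\<in>?L n. \<Sum>w\<in>nbs (hd p). wt w (last p) *\<^sub>C basis_vec (rev (w # p) @ p))"
  proof (intro sum.cong refl)
    fix p assume p: "p \<in> ?L n"
    then obtain u q where q: "p = u # q" "length q = n" "u \<in> pverts G"
      using walksD[of p n] by (cases p) auto
    \<comment> \<open>Index \<open>n\<close> is the middle of \<open>rev p @ tl p\<close>, occupied
      by \<open>u\<close>, the head of \<open>p\<close>. The new weight \<open>wt w u\<close> and
      the old \<open>wt u (last p)\<close> then telescope.\<close>
    have "cre n (basis_vec (rev p @ tl p)) = (\<Sum>w\<in>nbs u. wt w u *\<^sub>C basis_vec (rev (w # p) @ p))"
      using cre_split[of "rev q" u q] q by simp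
    then show "wt (hd p) (last p) *\<^sub>C cre n (basis_vec (rev p @ tl p)) =
        (\<Sum>w\<in>nbs (hd p). wt w (last p) *\<^sub>C basis_vec (rev (w # p) @ p))"
      using q wt_mult[OF q(3)]
      by (simp add: cfun.scale_sum_right mult.commute[of "wt u _"])
  qed
  also have "\<dots> = (\<Sum>z\<in>(SIGMA p:?L n. nbs (hd p)). wt (snd z) (last (fst z)) *\<^sub>C basis_vec (rev (snd z # fst z) @ fst z))"
    by (subst sum.Sigma) (auto simp: case_prod_unfold)
  also have "\<dots> = (\<Sum>p\<in>?L (Suc n). wt (hd p) (last p) *\<^sub>C basis_vec (rev p @ tl p))"
  proof (rule sum.reindex_bij_witness[where i = "\<lambda>r. (tl r, hd r)" and j = "\<lambda>z. snd z # fst z"])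
    fix z assume "z \<in> (SIGMA p:?L n. nbs (hd p))"
    moreover obtain p w where z: "z = (p, w)" by force
    ultimately have "p \<in> walks n" "last p = v" "w \<in> nbs (hd p)" by auto
    moreover from this obtain u q where "p = u # q" using walksD[of p n] by (cases p) auto
    ultimately show "snd z # fst z \<in> ?L (Suc n)"
      "wt (hd (snd z # fst z)) (last (snd z # fst z)) *\<^sub>C basis_vec (rev (snd z # fst z) @ tl (snd z # fst z)) =
        wt (snd z) (last (fst z)) *\<^sub>C basis_vec (rev (snd z # fst z) @ fst z)"
      by (simp_all add: z walks_Cons nbs_iff arcs_sym)
  next
    fix r assume r: "r \<in> ?L (Suc n)"
    then obtain u w q where "r = u # w # q" using walksD[of r "Suc n"] by (auto simp: length_Suc_conv)
    then show "(tl r, hd r) \<in> (SIGMA p:?L n. nbs (hd p))" "snd (tl r, hd r) # fst (tl r, hd r) = r"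
      using r by (auto simp: walks_Cons nbs_iff arcs_sym)
  qed auto
  finally show ?case .
qed

lemma annihs_creates_inner_prod:
  "z \<in> PS (m + 2 * length is) \<Longrightarrow> y \<in> PS m \<Longrightarrow> inner_prod (annihs \<mu> is z) y = inner_prod z (creates G \<mu> is y)"
proof (induction "is" arbitrary: y m)
  case (Cons i "is")
  have z: "z \<in> PS (m + 2 + 2 * length is)" using Cons.prems(1) by simp
  show ?case
    using Cons.IH[OF z cre_PS[OF Cons.prems(2)], of i] ann_cre_inner_prod[OF annihs_PS[OF z] Cons.prems(2), of i]
    by simp
qed simp

text \<open>Adjointness turns the coefficient at \<open>[v]\<close> into a sum over the walks
  \<open>rev p @ tl p\<close> with \<open>p\<close> ending at \<open>v\<close>. The weight of the
  nested creations is inverse to the one in \<open>wup\<close>, so only the plain pairing of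
  \<open>x\<close> and \<open>y\<close> remains.\<close>

lemma annihs_nested_apply:
  assumes x: "x \<in> PS n" and y: "y \<in> PS n" and v: "v \<in> pverts G"
  shows "annihs \<mu> [0..<n] (path_conc (rv (wup x)) y) [v] = inner_prod (path_conc x (basis_vec [v])) (cj y)"
proof -
  let ?z = "path_conc (rv (wup x)) y" and ?L = "{p \<in> walks n. last p = v}"
  have z: "?z \<in> PS (0 + 2 * length [0..<n])" using conc_PS[OF rv_PS[OF wgt_PS[OF x]] y] by (simp add: mult_2)
  have b: "basis_vec [v] \<in> PS 0" using v by (simp add: basis_PS walks_single)
  have "annihs \<mu> [0..<n] ?z [v] = inner_prod (annihs \<mu> [0..<n] ?z) (basis_vec [v])"
    by (rule inner_prod_basis_right[symmetric]) (rule PS_FS[OF annihs_PS[OF z]])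
  also have "\<dots> = (\<Sum>p\<in>?L. wt (hd p) (last p) * ?z (rev p @ tl p))"
    unfolding annihs_creates_inner_prod[OF z b] creates_nested[OF v]
    using PS_FS[OF z] by (simp add: inner_prod_sum_right inner_prod_scale_right inner_prod_basis_right)
  also have "\<dots> = (\<Sum>p\<in>?L. x p * y p)"
  proof (intro sum.cong refl)
    fix p assume p: "p \<in> ?L"
    then have "joinable (rev p) p" by (auto simp: joinable_def last_rev dest: walksD)
    then have "?z (rev p @ tl p) = rv (wup x) (rev p) * y p"
      using p by (intro conc_apply[OF rv_PS[OF wgt_PS[OF x]] y] rev_walks) auto
    then show "wt (hd p) (last p) * ?z (rev p @ tl p) = x p * y p"
      using p walks_ends[of p n] by (simp add: rv_def wgt_def wt_inverse mult.assoc[symmetric])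
  qed
  also have "\<dots> = (\<Sum>p\<in>walks n. (if last p = v then x p else 0) * y p)"
    by (simp add: sum.inter_filter if_distrib[of "\<lambda>t. t * _"] cong: if_cong)
  also have "\<dots> = inner_prod (path_conc x (basis_vec [v])) (cj y)"
    using conc_PS[OF x b]
    by (simp add: inner_prod_eq_sum[of "walks n"] path_space_iff conc_vertex_right_apply[OF x] cj_def)
  finally show ?thesis .
qed

end

section \<open>The projection relative to given orthonormal bases\<close>

locale ess_graph = perron_graph G \<beta> \<mu>
  for G :: "'v pair_pre_digraph" and \<beta> :: real and \<mu> :: "'v \<Rightarrow> real" +
  fixes B :: "nat \<Rightarrow> ('v list \<Rightarrow> complex) set"
  assumes onb: "\<And>n. ess_onb G \<mu> n (B n)"
begin

lemma ess_proj_eq: "ess_proj G \<mu> = (\<lambda>X. if X \<in> Q then PP X else 0)"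
  unfolding ess_proj_def using onb
  by (intro the_equality is_ess_proj_PP) (auto intro: is_ess_proj_unique is_ess_proj_PP)

lemma ess_proj_Q: "X \<in> Q \<Longrightarrow> ess_proj G \<mu> X = PP X"
  by (simp add: ess_proj_eq)

section \<open>The coproduct\<close>

lemma B_ess: "b \<in> B n \<Longrightarrow> b \<in> E n"
  using ess_onb_subset[OF onb] by blast

lemma B_PS: "b \<in> B n \<Longrightarrow> b \<in> PS n" and B_FS: "b \<in> B n \<Longrightarrow> b \<in> FS"
  using B_ess ess_PS ess_FS by blast+

lemma B_cj: "b \<in> B n \<Longrightarrow> cj b = b"
  using onb[of n] by (auto simp: ess_onb_def cj_def Reals_cnj_iff)

lemma B_expand: "x \<in> E n \<Longrightarrow> (\<Sum>b\<in>B n. inner_prod x b *\<^sub>C b) = x"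
  using ess_onb_expand[OF onb] by simp

text \<open>Definite ends make a basis element an eigenvector of both weights, with inverse
  eigenvalues. This is what cancels the weights in the coproduct of the antipode.\<close>

lemma B_wgt:
  assumes b: "b \<in> B n"
  obtains k l where "wdn b = k *\<^sub>C b" "wup b = l *\<^sub>C b" "k * l = 1"
proof -
  obtain s t where "starts_at b s" "ends_at b t" and norm: "inner_prod b b = 1"
    using onb[of n] b by (auto simp: ess_onb_def)
  then have st: "b \<in> between s t"
    using B_FS[OF b] by (simp add: between_def starts_at_def ends_at_def)
  \<comment> \<open>A unit vector has a path in its support, which shows that \<open>s\<close> and
    \<open>t\<close> are vertices with positive \<open>\<mu>\<close>.\<close>
  have "supp b \<noteq> {}" using norm by (auto simp: inner_prod_def)
  then obtain p where "p \<in> walks n" "hd p = s" "last p = t"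
    using st B_PS[OF b] by (auto simp: between_def path_space_iff)
  then have "s \<in> pverts G" "t \<in> pverts G" using walks_ends by blast+
  with wgt_between[OF st] show ?thesis by (intro that[of "wt s t" "wt t s"]) (auto simp: wt_inverse)
qed

text \<open>The element \<open>\<Sum>p. p \<otimes> p\<close> agrees with \<open>\<Sum>b. b \<otimes> b\<close> up to terms with an image of a creation
  operator in the second factor.\<close>
lemma sum_walks_eq_sum_ess:
  assumes h: "bilinear_FS h"
    and kill: "\<And>m i x y. n = m + 2 \<Longrightarrow> x \<in> PS n \<Longrightarrow> y \<in> PS m \<Longrightarrow> h x (cre i y) = 0"
  shows "(\<Sum>p\<in>walks n. h (basis_vec p) (basis_vec p)) = (\<Sum>b\<in>B n. h b b)"
proof -
  have "h (basis_vec p) (basis_vec p) = (\<Sum>b\<in>B n. b p *\<^sub>C h (basis_vec p) b)" if p: "p \<in> walks n" for p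
  proof -
    have "inner_prod (basis_vec p) b = b p" if "b \<in> B n" for b
    proof -
      have "cnj (b p) = b p" using B_cj[OF that] by (metis cj_def)
      then show ?thesis by (simp add: inner_prod_def) (simp add: basis_vec_def)
    qed
    moreover have "h (basis_vec p) (basis_vec p) = (\<Sum>b\<in>B n. inner_prod (basis_vec p) b *\<^sub>C h (basis_vec p) b)"
    proof (rule lin_ess_expand[OF bilinear_FS_right[OF h] _ onb])
      show "basis_vec p \<in> PS n" using p by (simp add: basis_PS)
      then show "h (basis_vec p) (cre i y) = 0" if "n = m + 2" "y \<in> PS m" for m i y
        using kill[OF that(1) _ that(2)] by blast
    qed simp
    ultimately show ?thesis by simp
  qed
  then have "(\<Sum>p\<in>walks n. h (basis_vec p) (basis_vec p)) = (\<Sum>p\<in>walks n. \<Sum>b\<in>B n. b p *\<^sub>C h (basis_vec p) b)"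
    by simp
  also have "\<dots> = (\<Sum>b\<in>B n. \<Sum>p\<in>walks n. b p *\<^sub>C h (basis_vec p) b)" by (rule sum.swap)
  \<comment> \<open>Summing over the walks now rebuilds \<open>b\<close> in the first slot.\<close>
  also have "\<dots> = (\<Sum>b\<in>B n. h b b)"
  proof (intro sum.cong refl)
    fix b assume b: "b \<in> B n"
    have "h b b = h (\<Sum>p\<in>walks n. b p *\<^sub>C basis_vec p) b" using PS_expand[OF B_PS[OF b]] by simp
    also have "\<dots> = (\<Sum>p\<in>walks n. b p *\<^sub>C h (basis_vec p) b)"
      using B_FS[OF b] by (simp add: lin_sum[OF bilinear_FS_left[OF h]] lin_scale[OF bilinear_FS_left[OF h]])
    finally show "(\<Sum>p\<in>walks n. b p *\<^sub>C h (basis_vec p) b) = h b b" ..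
  qed
  finally show ?thesis .
qed

text \<open>Reversal is real and self-adjoint, hence has a symmetric matrix in the real orthonormal
  basis, and being an involution it preserves the canonical element. The star and the antipode
  reverse the basis elements in the coproduct.\<close>

lemma sum_ess_rv:
  assumes h: "bilinear_FS h"
  shows "(\<Sum>b\<in>B n. h (rv b) (rv b)) = (\<Sum>b\<in>B n. h b b)"
proof -
  have sym: "inner_prod (rv b) c = inner_prod (rv c) b" if "b \<in> B n" "c \<in> B n" for b c
  proof -
    have "inner_prod (rv b) c = inner_prod b (rv c)" by (rule inner_prod_rv)
    also have "\<dots> = cnj (inner_prod (rv c) b)" using that by (intro inner_prod_commute) (auto intro: B_FS FS_rv)
    also have "\<dots> = inner_prod (cj (rv c)) (cj b)" by (simp add: inner_prod_cj)
    finally show ?thesis using that by (simp add: cj_rv B_cj)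
  qed
  have "(\<Sum>b\<in>B n. h (rv b) (rv b)) = (\<Sum>b\<in>B n. \<Sum>c\<in>B n. inner_prod (rv b) c *\<^sub>C h (rv b) c)"
  proof (intro sum.cong refl)
    fix b assume b: "b \<in> B n"
    have "h (rv b) (rv b) = h (rv b) (\<Sum>c\<in>B n. inner_prod (rv b) c *\<^sub>C c)"
      using B_expand[OF rv_ess[OF B_ess[OF b]]] by simp
    then show "h (rv b) (rv b) = (\<Sum>c\<in>B n. inner_prod (rv b) c *\<^sub>C h (rv b) c)"
      using b by (simp add: lin_sum[OF bilinear_FS_right[OF h]] lin_scale[OF bilinear_FS_right[OF h]] B_FS)
  qed
  also have "\<dots> = (\<Sum>c\<in>B n. \<Sum>b\<in>B n. inner_prod (rv c) b *\<^sub>C h (rv b) c)"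
    by (subst sum.swap) (simp add: sym)
  also have "\<dots> = (\<Sum>c\<in>B n. h c c)"
  proof (intro sum.cong refl)
    fix c assume c: "c \<in> B n"
    have "h c c = h (rv (\<Sum>b\<in>B n. inner_prod (rv c) b *\<^sub>C b)) c"
      using B_expand[OF rv_ess[OF B_ess[OF c]]] by simp
    then show "(\<Sum>b\<in>B n. inner_prod (rv c) b *\<^sub>C h (rv b) c) = h c c"
      using c by (simp add: lin_sum[OF bilinear_FS_left[OF h]] lin_scale[OF bilinear_FS_left[OF h]]
          lin_sum[OF lin_rv] lin_scale[OF lin_rv] B_FS)
  qed
  finally show ?thesis .
qed

abbreviation Delta where "Delta \<equiv> ess_coproduct B"

lemma lin_Delta [simp]: "linear_on FS Delta"
  by (simp add: ess_coproduct_def)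

lemma FS_Delta [simp]: "X \<in> FS \<Longrightarrow> Delta X \<in> FS"
  unfolding ess_coproduct_def by (rule FS_lin_ext) (auto intro!: FS_sum FS_tensor FS_basis_vec intro: B_FS)

lemma Delta_tensor: "x \<in> PS n \<Longrightarrow> y \<in> PS n \<Longrightarrow> Delta (x \<otimes>\<^sub>C y) = (\<Sum>b\<in>B n. (x \<otimes>\<^sub>C b) \<otimes>\<^sub>C (b \<otimes>\<^sub>C y))"
  by (rule ess_coproduct_tensor)

lemma Delta_closed:
  assumes "a \<in> A"
  shows "Delta a \<in> tensor_square A"
proof -
  have sub: "cfun.subspace (tensor_square A)" by (simp add: tensor_square_def)
  have "cfun.subspace {a \<in> FS. Delta a \<in> tensor_square A}"
    using cfun.subspace_add[OF sub] cfun.subspace_scale[OF sub]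
    by (auto simp: cfun.subspace_def lin_add[OF lin_Delta] lin_scale[OF lin_Delta] lin_zero[OF lin_Delta]
        cfun.subspace_0[OF sub])
  then have "end_gr E \<subseteq> {a \<in> FS. Delta a \<in> tensor_square A}"
  proof (rule end_gr_minimal)
    fix n x y assume xy: "x \<in> E n" "y \<in> E n"
    have "(x \<otimes>\<^sub>C b) \<otimes>\<^sub>C (b \<otimes>\<^sub>C y) \<in> tensor_square A" if "b \<in> B n" for b
      using xy that unfolding tensor_square_def by (intro cfun.span_base) (blast intro: tensor_A B_ess)
    then show "x \<otimes>\<^sub>C y \<in> {a \<in> FS. Delta a \<in> tensor_square A}"
      using xy by (auto simp: Delta_tensor[of x n y] ess_PS ess_FS intro: cfun.subspace_sum[OF sub])
  qed
  with assms show ?thesis by (auto simp: ess_algebra_def)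
qed

lemma bext_Delta:
  assumes "bilinear_FS f" "x \<in> PS n" "y \<in> PS n"
  shows "bext f (Delta (x \<otimes>\<^sub>C y)) = (\<Sum>b\<in>B n. f (x \<otimes>\<^sub>C b) (b \<otimes>\<^sub>C y))"
  using assms by (simp add: Delta_tensor lin_sum[OF linear_on_bext] bext_tensor B_FS PS_FS)

lemma sweedler_Delta:
  assumes "bilinear_FS f" "\<And>x y. x \<in> A \<Longrightarrow> y \<in> A \<Longrightarrow> h x y = f x y" "a \<in> A"
  shows "sweedler A h (Delta a) = bext f (Delta a)"
  by (rule sweedler_eq_bext[OF A_subspace A_FS Delta_closed[OF assms(3)] assms(1,2)])

lemma lin_bext_Delta: "linear_on FS (\<lambda>a. bext f (Delta a))"
  by (rule linear_on_compose[OF lin_Delta linear_on_bext]) simp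

text \<open>The coproduct over elementary paths, followed by the projection of both factors; the set
  \<open>{n. x \<in> PS n - {0}}\<close> only recovers the length of \<open>x\<close>.\<close>
definition Phi :: "('v list \<times> 'v list \<Rightarrow> complex) \<Rightarrow> (('v list \<times> 'v list) \<times> ('v list \<times> 'v list) \<Rightarrow> complex)"
  where "Phi = bext (\<lambda>x y. \<Sum>n\<in>{n. x \<in> PS n - {0}}. \<Sum>r\<in>walks n. PP (x \<otimes>\<^sub>C basis_vec r) \<otimes>\<^sub>C PP (basis_vec r \<otimes>\<^sub>C y))"

lemma lin_Phi [simp]: "linear_on FS Phi"
  by (simp add: Phi_def)

lemma Phi_tensor:
  assumes "x \<in> PS n" "y \<in> PS n"
  shows "Phi (x \<otimes>\<^sub>C y) = (\<Sum>r\<in>walks n. PP (x \<otimes>\<^sub>C basis_vec r) \<otimes>\<^sub>C PP (basis_vec r \<otimes>\<^sub>C y))"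
proof (rule bilinear_eqI[of "\<lambda>x y. Phi (x \<otimes>\<^sub>C y)" "\<lambda>x y. \<Sum>r\<in>walks n. PP (x \<otimes>\<^sub>C basis_vec r) \<otimes>\<^sub>C PP (basis_vec r \<otimes>\<^sub>C y)"])
  show "bilinear_FS (\<lambda>x y. Phi (x \<otimes>\<^sub>C y))" by (rule bilinear_FS_post[OF bilinear_FS_tensor lin_Phi]) simp
  show "bilinear_FS (\<lambda>x y. \<Sum>r\<in>walks n. PP (x \<otimes>\<^sub>C basis_vec r) \<otimes>\<^sub>C PP (basis_vec r \<otimes>\<^sub>C y))"
    by (rule bilinear_FSI; simp add: linear_simps sum.distrib cfun.scale_sum_right)
  fix p q assume "p \<in> supp x"
  then have p: "p \<in> walks n" using assms by (auto simp: path_space_iff)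
  have "m = n" if "p \<in> walks m" for m using walksD[OF that] walksD[OF p] by simp
  then have "{m. p \<in> walks m} = {n}" using p by blast
  \<comment> \<open>The zero vector lies in every \<open>PS m\<close>; only a nonzero vector has a
    unique length.\<close>
  moreover have "basis_vec p \<noteq> (0 :: 'v list \<Rightarrow> complex)"
    by (metis insert_not_empty supp_basis_vec supp_zero)
  ultimately have "{m. basis_vec p \<in> PS m - {0}} = {n}" by (simp add: basis_PS)
  then show "Phi (basis_vec p \<otimes>\<^sub>C basis_vec q) = (\<Sum>r\<in>walks n. PP (basis_vec p \<otimes>\<^sub>C basis_vec r) \<otimes>\<^sub>C PP (basis_vec r \<otimes>\<^sub>C basis_vec q))"
    by (simp add: Phi_def tensor_basis_vec bext_def)
qed (use assms in \<open>auto intro: PS_FS\<close>)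

text \<open>A creation on the outer left factor becomes an annihilation on the middle path, by
  transposition a creation on its second copy, and finally an annihilation on the outer right
  factor. The other relation travels the opposite way.\<close>

lemma invariant_Phi: "invariant Phi"
proof (rule invariantI[OF lin_Phi])
  fix n i x y assume xy: "x \<in> PS n" "y \<in> PS (n + 2)"
  then have FS: "x \<in> FS" "y \<in> FS" by (auto intro: PS_FS)
  let ?h = "\<lambda>u v. PP (x \<otimes>\<^sub>C u) \<otimes>\<^sub>C PP (v \<otimes>\<^sub>C y)" and ?h' = "\<lambda>u v. PP (y \<otimes>\<^sub>C u) \<otimes>\<^sub>C PP (v \<otimes>\<^sub>C x)"
  have h: "bilinear_FS ?h" "bilinear_FS ?h'" by (rule bilinear_FSI; simp add: linear_simps FS)+
  have W: "basis_vec r \<in> PS k" if "r \<in> walks k" for r k using that by (simp add: basis_PS)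
  have "Phi (cre i x \<otimes>\<^sub>C y) = (\<Sum>r\<in>walks (n + 2). ?h (ann i (basis_vec r)) (basis_vec r))"
    using xy by (simp add: Phi_tensor[OF cre_PS] PP_cre_left[OF _ W] del: add_2_eq_Suc')
  also have "\<dots> = (\<Sum>q\<in>walks n. ?h (basis_vec q) (cre i (basis_vec q)))" by (rule sum_ann_basis[OF h(1)])
  also have "\<dots> = Phi (x \<otimes>\<^sub>C ann i y)"
    using xy by (simp add: Phi_tensor[OF _ ann_PS] PP_cre_left[OF W] del: add_2_eq_Suc')
  finally show "Phi (cre i x \<otimes>\<^sub>C y) = Phi (x \<otimes>\<^sub>C ann i y)" .
  have "Phi (y \<otimes>\<^sub>C cre i x) = (\<Sum>r\<in>walks (n + 2). ?h' (basis_vec r) (ann i (basis_vec r)))"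
    using xy by (simp add: Phi_tensor[OF _ cre_PS] PP_cre_right[OF _ W] del: add_2_eq_Suc')
  also have "\<dots> = (\<Sum>q\<in>walks n. ?h' (cre i (basis_vec q)) (basis_vec q))" by (rule sum_cre_basis[OF h(2)])
  also have "\<dots> = Phi (ann i y \<otimes>\<^sub>C x)"
    using xy by (simp add: Phi_tensor[OF ann_PS] PP_cre_right[OF W] del: add_2_eq_Suc')
  finally show "Phi (y \<otimes>\<^sub>C cre i x) = Phi (ann i y \<otimes>\<^sub>C x)" .
qed

lemma PP_cre_ess: "y \<in> PS m \<Longrightarrow> x \<in> E (m + 2) \<Longrightarrow> PP (cre i y \<otimes>\<^sub>C x) = 0"
  by (simp add: PP_cre_left[OF _ ess_PS] ess_ann lin_zero[OF lin_PP] del: add_2_eq_Suc')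

text \<open>On essential tensors the sum over walks equals the sum over the basis, because a
  creation in the middle is killed against the essential factor \<open>y\<close>; invariance of
  \<open>Phi\<close> does the rest. Hence the coproduct of a product can be computed from the
  unprojected concatenation.\<close>

lemma Delta_PP:
  assumes "X \<in> Q"
  shows "Delta (PP X) = Phi X"
proof -
  have "PP X \<in> A" using assms Q_FS PP_closed by blast
  have "Delta (PP X) = Phi (PP X)"
  proof (rule A_eqI[OF lin_Delta lin_Phi \<open>PP X \<in> A\<close>])
    fix n x y assume xy: "x \<in> E n" "y \<in> E n"
    then have FS: "x \<in> FS" "y \<in> FS" by (auto intro: ess_FS)
    let ?h = "\<lambda>u v. PP (x \<otimes>\<^sub>C u) \<otimes>\<^sub>C PP (v \<otimes>\<^sub>C y)"
    have h: "bilinear_FS ?h" by (rule bilinear_FSI; simp add: linear_simps FS)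
    have "Phi (x \<otimes>\<^sub>C y) = (\<Sum>b\<in>B n. ?h b b)"
      unfolding Phi_tensor[OF ess_PS[OF xy(1)] ess_PS[OF xy(2)]]
      by (rule sum_walks_eq_sum_ess[OF h]) (use xy PP_cre_ess in auto)
    then show "Delta (x \<otimes>\<^sub>C y) = Phi (x \<otimes>\<^sub>C y)"
      using xy by (simp add: Delta_tensor ess_PS PP_ess_tensor[of _ n] B_ess)
  qed
  also have "\<dots> = Phi X" by (rule invariant_PP_eq[OF invariant_Phi assms])
  finally show ?thesis .
qed

text \<open>The walks of length \<open>n + m\<close> in \<open>Phi\<close> are split at the joint,
  and each half is then replaced by the orthonormal basis. A creation in either half would cross
  over to an annihilation inside \<open>x'\<close> or \<open>y'\<close>, which are
  essential.\<close>

lemma Delta_mul_tensor: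
  assumes x: "x \<in> E n" "x' \<in> E n" and y: "y \<in> E m" "y' \<in> E m"
  shows "Delta (mul (x \<otimes>\<^sub>C x') (y \<otimes>\<^sub>C y')) =
    (\<Sum>c\<in>B n. \<Sum>d\<in>B m. mul (x \<otimes>\<^sub>C c) (y \<otimes>\<^sub>C d) \<otimes>\<^sub>C mul (c \<otimes>\<^sub>C x') (d \<otimes>\<^sub>C y'))"
proof -
  have P: "x \<in> PS n" "x' \<in> PS n" "y \<in> PS m" "y' \<in> PS m" using x y by (auto intro: ess_PS)
  have FS: "x \<in> FS" "x' \<in> FS" "y \<in> FS" "y' \<in> FS" using P by (auto intro: PS_FS)
  let ?X = "path_conc x y" and ?Y = "path_conc x' y'"
  have XY: "?X \<in> PS (n + m)" "?Y \<in> PS (n + m)" using P by (auto intro: conc_PS)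
  let ?H = "\<lambda>u v. PP (?X \<otimes>\<^sub>C u) \<otimes>\<^sub>C PP (v \<otimes>\<^sub>C ?Y)"
  have "Delta (mul (x \<otimes>\<^sub>C x') (y \<otimes>\<^sub>C y')) = (\<Sum>r\<in>walks (n + m). ?H (basis_vec r) (basis_vec r))"
    unfolding mul_tensor using XY by (simp add: Delta_PP tensor_end_gr[of _ PS "n + m"] Phi_tensor)
  also have "\<dots> = (\<Sum>p\<in>walks n. \<Sum>q\<in>walks m. if joinable p q then ?H (basis_vec (p @ tl q)) (basis_vec (p @ tl q)) else 0)"
    by (rule sum_walks_conc[symmetric])
  also have "\<dots> = (\<Sum>p\<in>walks n. \<Sum>q\<in>walks m.
      ?H (path_conc (basis_vec p) (basis_vec q)) (path_conc (basis_vec p) (basis_vec q)))"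
    by (intro sum.cong refl) (simp add: conc_basis lin_zero[OF lin_PP])
  also have "\<dots> = (\<Sum>p\<in>walks n. \<Sum>d\<in>B m. ?H (path_conc (basis_vec p) d) (path_conc (basis_vec p) d))"
  proof (intro sum.cong refl)
    fix p assume "p \<in> walks n"
    then have p: "basis_vec p \<in> PS n" by (simp add: basis_PS)
    show "(\<Sum>q\<in>walks m. ?H (path_conc (basis_vec p) (basis_vec q)) (path_conc (basis_vec p) (basis_vec q))) =
        (\<Sum>d\<in>B m. ?H (path_conc (basis_vec p) d) (path_conc (basis_vec p) d))"
    proof (rule sum_walks_eq_sum_ess[of "\<lambda>u v. ?H (path_conc (basis_vec p) u) (path_conc (basis_vec p) v)"])
      show "bilinear_FS (\<lambda>u v. ?H (path_conc (basis_vec p) u) (path_conc (basis_vec p) v))"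
        by (rule bilinear_FSI; simp add: linear_simps FS)
      fix k i u v assume m: "m = k + 2" and v: "v \<in> PS k"
      have Y: "?Y \<in> PS (n + k + 2)" using XY(2) m by (simp add: add.assoc)
      have "PP (path_conc (basis_vec p) (cre i v) \<otimes>\<^sub>C ?Y) = PP (path_conc (basis_vec p) v \<otimes>\<^sub>C ann (n + i) ?Y)"
        using PP_cre_left[OF conc_PS[OF p v] Y, of "n + i"] by (simp add: cre_conc_right[OF p PS_FS[OF v]])
      \<comment> \<open>From position \<open>n\<close> on, the contraction lies inside
        \<open>y'\<close>.\<close>
      also have "ann (n + i) ?Y = 0"
        using y by (simp add: ann_conc_right[OF P(2) FS(4)] ess_ann lin_zero[OF conc_right] FS)
      finally show "?H (path_conc (basis_vec p) u) (path_conc (basis_vec p) (cre i v)) = 0"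
        by (simp add: lin_zero[OF lin_PP])
    qed
  qed
  also have "\<dots> = (\<Sum>d\<in>B m. \<Sum>p\<in>walks n. ?H (path_conc (basis_vec p) d) (path_conc (basis_vec p) d))"
    by (rule sum.swap)
  also have "\<dots> = (\<Sum>d\<in>B m. \<Sum>c\<in>B n. ?H (path_conc c d) (path_conc c d))"
  proof (intro sum.cong refl)
    fix d assume dB: "d \<in> B m"
    then have d: "d \<in> PS m" "d \<in> FS" by (auto intro: B_PS B_FS)
    show "(\<Sum>p\<in>walks n. ?H (path_conc (basis_vec p) d) (path_conc (basis_vec p) d)) =
        (\<Sum>c\<in>B n. ?H (path_conc c d) (path_conc c d))"
    proof (rule sum_walks_eq_sum_ess[of "\<lambda>u v. ?H (path_conc u d) (path_conc v d)"])
      show "bilinear_FS (\<lambda>u v. ?H (path_conc u d) (path_conc v d))"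
        by (rule bilinear_FSI; simp add: linear_simps FS d)
      fix k i u v assume n: "n = k + 2" and v: "v \<in> PS k"
      have "PP (path_conc (cre i v) d \<otimes>\<^sub>C ?Y) = 0"
      proof (cases "i \<le> k")
        case True
        have Y: "?Y \<in> PS (k + m + 2)" using XY(2) n by (simp add: ac_simps)
        have "PP (path_conc (cre i v) d \<otimes>\<^sub>C ?Y) = PP (path_conc v d \<otimes>\<^sub>C ann i ?Y)"
          using PP_cre_left[OF conc_PS[OF v d(1)] Y, of i] by (simp add: cre_conc_left[OF v True d(2)])
        \<comment> \<open>Here the contraction lies inside \<open>x'\<close>.\<close>
        also have "ann i ?Y = 0"
          using x P n by (simp add: ann_conc_left[OF _ True FS(4)] ess_ann lin_zero[OF conc_left] FS del: add_2_eq_Suc')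
        finally show ?thesis by (simp add: lin_zero[OF lin_PP])
      next
        case False
        then show ?thesis using cre_PS_short[OF v] d by (simp add: lin_zero[OF conc_left] lin_zero[OF lin_PP])
      qed
      then show "?H (path_conc u d) (path_conc (cre i v) d) = 0" by simp
    qed
  qed
  also have "\<dots> = (\<Sum>c\<in>B n. \<Sum>d\<in>B m. ?H (path_conc c d) (path_conc c d))" by (rule sum.swap)
  finally show ?thesis by (simp add: mul_tensor)
qed

lemma bilinear_mul_tensor: "a1 \<in> FS \<Longrightarrow> a2 \<in> FS \<Longrightarrow> bilinear_FS (\<lambda>b1 b2. mul a1 b1 \<otimes>\<^sub>C mul a2 b2)"
  by (rule bilinear_FSI; simp add: linear_simps mul_simps)

lemma bilinear_bext_mul: "bilinear_FS (\<lambda>a1 a2. bext (\<lambda>b1 b2. mul a1 b1 \<otimes>\<^sub>C mul a2 b2) Y)"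
  unfolding bilinear_FS_def by (auto intro!: bext_param) (rule linear_onI; simp add: linear_simps mul_simps)+

lemma Delta_mul:
  assumes "a \<in> A" "b \<in> A"
  shows "Delta (mul a b) = bext (\<lambda>a1 a2. bext (\<lambda>b1 b2. mul a1 b1 \<otimes>\<^sub>C mul a2 b2) (Delta b)) (Delta a)"
proof -
  show ?thesis
  proof (rule bilinear_A_eqI[OF _ _ assms, of "\<lambda>a b. Delta (mul a b)"
        "\<lambda>a b. bext (\<lambda>a1 a2. bext (\<lambda>b1 b2. mul a1 b1 \<otimes>\<^sub>C mul a2 b2) (Delta b)) (Delta a)"])
    show "bilinear_FS (\<lambda>a b. Delta (mul a b))"
      by (rule bilinear_FS_post[OF bilinear_mul lin_Delta]) simp
    show "bilinear_FS (\<lambda>a b. bext (\<lambda>a1 a2. bext (\<lambda>b1 b2. mul a1 b1 \<otimes>\<^sub>C mul a2 b2) (Delta b)) (Delta a))"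
      unfolding bilinear_FS_def by (auto intro!: bext_param lin_bext_Delta)
    fix n m x y z w assume *: "x \<in> E n" "y \<in> E n" "z \<in> E m" "w \<in> E m"
    then have FS: "x \<in> FS" "y \<in> FS" by (auto intro: ess_FS)
    have "bext (\<lambda>a1 a2. bext (\<lambda>b1 b2. mul a1 b1 \<otimes>\<^sub>C mul a2 b2) (Delta (z \<otimes>\<^sub>C w))) (Delta (x \<otimes>\<^sub>C y)) =
        (\<Sum>c\<in>B n. bext (\<lambda>b1 b2. mul (x \<otimes>\<^sub>C c) b1 \<otimes>\<^sub>C mul (c \<otimes>\<^sub>C y) b2) (Delta (z \<otimes>\<^sub>C w)))"
      by (rule bext_Delta[OF bilinear_bext_mul]) (use * in \<open>auto intro: ess_PS\<close>)
    also have "\<dots> = (\<Sum>c\<in>B n. \<Sum>d\<in>B m. mul (x \<otimes>\<^sub>C c) (z \<otimes>\<^sub>C d) \<otimes>\<^sub>C mul (c \<otimes>\<^sub>C y) (d \<otimes>\<^sub>C w))"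
      by (intro sum.cong refl bext_Delta[OF bilinear_mul_tensor]) (use * FS in \<open>auto intro!: ess_PS FS_tensor B_FS\<close>)
    finally show "Delta (mul (x \<otimes>\<^sub>C y) (z \<otimes>\<^sub>C w)) =
        bext (\<lambda>a1 a2. bext (\<lambda>b1 b2. mul a1 b1 \<otimes>\<^sub>C mul a2 b2) (Delta (z \<otimes>\<^sub>C w))) (Delta (x \<otimes>\<^sub>C y))"
      using Delta_mul_tensor[OF *] by simp
  qed
qed

definition star2 :: "(('v list \<times> 'v list) \<times> ('v list \<times> 'v list) \<Rightarrow> complex) \<Rightarrow> (('v list \<times> 'v list) \<times> ('v list \<times> 'v list) \<Rightarrow> complex)"
  where "star2 X = (\<lambda>((p, q), (r, s)). cnj (X ((rev p, rev q), (rev r, rev s))))"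

lemma star2_add: "star2 (X + Y) = star2 X + star2 Y"
  and star2_scale: "star2 (k *\<^sub>C X) = cnj k *\<^sub>C star2 X"
  and star2_zero: "star2 0 = 0"
  and star2_tensor: "star2 (x \<otimes>\<^sub>C y) = ess_star x \<otimes>\<^sub>C ess_star y"
  by (auto simp: star2_def fun_eq_iff pointwise tensor_def ess_star_def)

lemma star2_sum: "star2 (\<Sum>i\<in>I. f i) = (\<Sum>i\<in>I. star2 (f i))"
  by (induction I rule: infinite_finite_induct) (simp_all add: star2_zero star2_add)

text \<open>The star reverses the basis elements in the middle, which \<open>sum_ess_rv\<close>
  undoes. As the star is antilinear, it is applied on both sides before comparing linear
  maps.\<close>

lemma Delta_star:
  assumes "a \<in> A"
  shows "Delta (ess_star a) = sweedler A (\<lambda>a1 a2. ess_star a1 \<otimes>\<^sub>C ess_star a2) (Delta a)"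
proof -
  have "sweedler A (\<lambda>a1 a2. ess_star a1 \<otimes>\<^sub>C ess_star a2) (Delta a) = star2 (Delta a)"
    by (rule sweedler_eq_additive[OF A_subspace A_FS Delta_closed[OF assms]])
      (simp_all add: star2_zero star2_add star2_tensor)
  moreover have "star2 (Delta (ess_star c)) = Delta c" if c: "c \<in> A" for c
  proof (rule A_eqI[OF _ lin_Delta c, of "\<lambda>c. star2 (Delta (ess_star c))"])
    show "linear_on FS (\<lambda>c. star2 (Delta (ess_star c)))"
      by (rule linear_onI) (simp_all add: ess_star_add ess_star_scale star2_add star2_scale
          lin_add[OF lin_Delta] lin_scale[OF lin_Delta])
    fix n x y assume xy: "x \<in> E n" "y \<in> E n"
    then have FS: "x \<in> FS" "y \<in> FS" by (auto intro: ess_FS)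
    have "path_star b = rv b" if "b \<in> B n" for b using B_cj[OF that] by (simp add: path_star_eq cj_rv)
    then have "star2 (Delta (ess_star (x \<otimes>\<^sub>C y))) = (\<Sum>b\<in>B n. (x \<otimes>\<^sub>C rv b) \<otimes>\<^sub>C (rv b \<otimes>\<^sub>C y))"
      using xy by (simp add: ess_star_tensor Delta_tensor[of _ n] path_star_PS ess_PS star2_sum star2_tensor)
    also have "\<dots> = (\<Sum>b\<in>B n. (x \<otimes>\<^sub>C b) \<otimes>\<^sub>C (b \<otimes>\<^sub>C y))"
      by (rule sum_ess_rv) (rule bilinear_FSI; simp add: linear_simps FS)
    finally show "star2 (Delta (ess_star (x \<otimes>\<^sub>C y))) = Delta (x \<otimes>\<^sub>C y)"
      using xy by (simp add: Delta_tensor[of x n y] ess_PS)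
  qed
  from this[OF ess_star_A[OF assms]] have "star2 (Delta a) = Delta (ess_star a)" by simp
  ultimately show ?thesis by simp
qed

lemma reassoc_add: "reassoc (X + Y) = reassoc X + reassoc Y"
  and reassoc_scale: "reassoc (k *\<^sub>C X) = k *\<^sub>C reassoc X"
  and reassoc_tensor: "reassoc ((x \<otimes>\<^sub>C y) \<otimes>\<^sub>C z) = x \<otimes>\<^sub>C (y \<otimes>\<^sub>C z)"
  and reassoc_zero: "reassoc 0 = 0"
  by (auto simp: reassoc_def fun_eq_iff pointwise tensor_def)

lemma reassoc_sum: "reassoc (\<Sum>i\<in>I. f i) = (\<Sum>i\<in>I. reassoc (f i))"
  by (induction I rule: infinite_finite_induct) (simp_all add: reassoc_zero reassoc_add)

lemma Delta_coassoc:
  assumes "a \<in> A"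
  shows "sweedler A (\<lambda>a1 a2. reassoc (Delta a1 \<otimes>\<^sub>C a2)) (Delta a) = sweedler A (\<lambda>a1 a2. a1 \<otimes>\<^sub>C Delta a2) (Delta a)"
proof -
  have b1: "bilinear_FS (\<lambda>a1 a2. reassoc (Delta a1 \<otimes>\<^sub>C a2))" and b2: "bilinear_FS (\<lambda>a1 a2. a1 \<otimes>\<^sub>C Delta a2)"
    by (rule bilinear_FSI; simp add: linear_simps reassoc_add reassoc_scale lin_add[OF lin_Delta] lin_scale[OF lin_Delta])+
  have "bext (\<lambda>a1 a2. reassoc (Delta a1 \<otimes>\<^sub>C a2)) (Delta a) = bext (\<lambda>a1 a2. a1 \<otimes>\<^sub>C Delta a2) (Delta a)"
  proof (rule A_eqI[OF lin_bext_Delta lin_bext_Delta assms])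
    fix n x y assume "x \<in> E n" "y \<in> E n"
    then have P: "x \<in> PS n" "y \<in> PS n" by (auto intro: ess_PS)
    have "(\<Sum>b\<in>B n. \<Sum>c\<in>B n. (x \<otimes>\<^sub>C c) \<otimes>\<^sub>C (c \<otimes>\<^sub>C b) \<otimes>\<^sub>C (b \<otimes>\<^sub>C y)) =
        (\<Sum>b\<in>B n. \<Sum>c\<in>B n. (x \<otimes>\<^sub>C b) \<otimes>\<^sub>C (b \<otimes>\<^sub>C c) \<otimes>\<^sub>C (c \<otimes>\<^sub>C y))"
      by (rule sum.swap)
    then show "bext (\<lambda>a1 a2. reassoc (Delta a1 \<otimes>\<^sub>C a2)) (Delta (x \<otimes>\<^sub>C y)) = bext (\<lambda>a1 a2. a1 \<otimes>\<^sub>C Delta a2) (Delta (x \<otimes>\<^sub>C y))"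
      unfolding bext_Delta[OF b1 P] bext_Delta[OF b2 P]
      using P B_PS by (simp add: Delta_tensor[of _ n] tensor_sum_left tensor_sum_right reassoc_sum reassoc_tensor)
  qed
  then show ?thesis
    by (simp add: sweedler_Delta[OF b1 _ assms] sweedler_Delta[OF b2 _ assms])
qed

section \<open>The coproduct of the unit and the counit axioms\<close>

lemma Delta_one: "bilinear_FS f \<Longrightarrow> bext f (Delta (ess_one G)) = (\<Sum>e\<in>B 0. f (vertex_sum \<otimes>\<^sub>C e) (e \<otimes>\<^sub>C vertex_sum))"
  unfolding ess_one_eq by (rule bext_Delta) (simp_all add: vertex_sum_PS)

text \<open>In degree 0 there are no images of creation operators, so the orthonormal basis may be
  replaced by the vertices.\<close>

lemma sum_B0: "bilinear_FS h \<Longrightarrow> (\<Sum>e\<in>B 0. h e e) = (\<Sum>v\<in>pverts G. h (basis_vec [v]) (basis_vec [v]))"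
  using sum_walks_eq_sum_ess[of h 0] by (simp add: walks_0 sum.reindex inj_on_def)

lemma ess_mult_eq: "a \<in> A \<Longrightarrow> b \<in> A \<Longrightarrow> ess_mult G \<mu> a b = mul a b"
  using A_Q by (auto simp: ess_mult_def mul_def intro!: ess_proj_Q end_conc_Q)

text \<open>The coproduct of the unit is the sum over vertices \<open>v\<close> of the tensors of
  \<open>vertex_sum \<otimes> v\<close> with \<open>v \<otimes> vertex_sum\<close>. These are the
  two insertions that occur when the counit of a concatenation is split at the joint.\<close>

lemma counit_mult:
  assumes "a \<in> A" "b \<in> A"
  shows "ess_counit (ess_mult G \<mu> a b) =
    sweedler A (\<lambda>u w. ess_counit (ess_mult G \<mu> a u) * ess_counit (ess_mult G \<mu> w b)) (Delta (ess_one G))"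
proof -
  have Q: "a \<in> Q" "b \<in> Q" using assms A_Q by auto
  have FS: "a \<in> FS" "b \<in> FS" using assms A_FS by auto
  let ?f = "\<lambda>u w (_ :: unit). counit (mul a u) () * counit (mul w b) ()"
  let ?h = "\<lambda>u w. ?f (vertex_sum \<otimes>\<^sub>C u) (w \<otimes>\<^sub>C vertex_sum)"
  note simps = lin_add[OF lin_counit] lin_scale[OF lin_counit] fun_eq_iff pointwise algebra_simps
    mul_simps
  have f: "bilinear_FS ?f" by (rule bilinear_FSI; simp add: FS simps)
  have h: "bilinear_FS ?h" by (rule bilinear_FSI; simp add: FS simps tensor_add_left tensor_add_right tensor_scale_left tensor_scale_right)
  have "sweedler A (\<lambda>u w. ess_counit (ess_mult G \<mu> a u) * ess_counit (ess_mult G \<mu> w b)) (Delta (ess_one G)) =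
      bext ?f (Delta (ess_one G)) ()"
  proof (rule sweedler_eq_additive[OF A_subspace A_FS Delta_closed[OF one_closed], of _ "\<lambda>X. bext ?f X ()"])
    fix x y assume "x \<in> A" "y \<in> A"
    then have "x \<in> FS" "y \<in> FS" using A_FS by auto
    then show "ess_counit (ess_mult G \<mu> a x) * ess_counit (ess_mult G \<mu> y b) = bext ?f (x \<otimes>\<^sub>C y) ()"
      using \<open>x \<in> A\<close> \<open>y \<in> A\<close> assms by (simp add: bext_tensor[OF f] ess_counit_eq ess_mult_eq)
  qed (simp_all add: lin_zero[OF linear_on_bext] lin_add[OF linear_on_bext] pointwise)
  also have "bext ?f (Delta (ess_one G)) = (\<Sum>v\<in>pverts G. ?h (basis_vec [v]) (basis_vec [v]))"
    unfolding Delta_one[OF f] by (rule sum_B0[OF h])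
  also have "\<dots> () = (\<Sum>v\<in>pverts G. counit (end_conc a (vertex_sum \<otimes>\<^sub>C basis_vec [v])) () *
      counit (end_conc (basis_vec [v] \<otimes>\<^sub>C vertex_sum) b) ())"
  proof -
    have "basis_vec [v] \<in> PS 0" if "v \<in> pverts G" for v using that by (simp add: basis_PS walks_single)
    then show ?thesis
      using Q vertex_sum_PS by (simp add: sum_fun_apply counit_mul tensor_end_gr[of _ PS 0])
  qed
  also have "\<dots> = counit (end_conc a b) ()" by (rule counit_end_conc[OF Q, symmetric])
  finally show ?thesis using assms by (simp add: ess_counit_eq ess_mult_eq counit_mul Q)
qed

lemma bilinear_counit_left: "bilinear_FS (\<lambda>(a1 :: 'v list \<times> 'v list \<Rightarrow> complex) a2. ess_counit a1 *\<^sub>C a2)"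
  and bilinear_counit_right: "bilinear_FS (\<lambda>a1 (a2 :: 'v list \<times> 'v list \<Rightarrow> complex). ess_counit a2 *\<^sub>C a1)"
  by (rule bilinear_FSI; simp add: ess_counit_eq lin_add[OF lin_counit] lin_scale[OF lin_counit] pointwise
      cfun.scale_left_distrib cfun.scale_right_distrib mult.commute)+

lemma counit_left:
  assumes "a \<in> A"
  shows "sweedler A (\<lambda>a1 a2. ess_counit a1 *\<^sub>C a2) (Delta a) = a"
  unfolding sweedler_Delta[OF bilinear_counit_left refl assms]
proof (rule A_eqI[OF lin_bext_Delta linear_on_id assms])
  fix n x y assume xy: "x \<in> E n" "y \<in> E n"
  have "bext (\<lambda>a1 a2. ess_counit a1 *\<^sub>C a2) (Delta (x \<otimes>\<^sub>C y)) = (\<Sum>b\<in>B n. inner_prod x b *\<^sub>C (b \<otimes>\<^sub>C y))"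
    unfolding bext_Delta[OF bilinear_counit_left ess_PS[OF xy(1)] ess_PS[OF xy(2)]]
    using xy by (intro sum.cong refl) (simp add: ess_counit_eq counit_tensor ess_FS B_FS B_cj)
  also have "\<dots> = x \<otimes>\<^sub>C y"
    unfolding tensor_scale_left[symmetric] tensor_sum_left[symmetric] B_expand[OF xy(1)] ..
  finally show "bext (\<lambda>a1 a2. ess_counit a1 *\<^sub>C a2) (Delta (x \<otimes>\<^sub>C y)) = x \<otimes>\<^sub>C y" .
qed

lemma counit_right:
  assumes "a \<in> A"
  shows "sweedler A (\<lambda>a1 a2. ess_counit a2 *\<^sub>C a1) (Delta a) = a"
  unfolding sweedler_Delta[OF bilinear_counit_right refl assms]
proof (rule A_eqI[OF lin_bext_Delta linear_on_id assms])
  fix n x y assume xy: "x \<in> E n" "y \<in> E n"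
  have "bext (\<lambda>a1 a2. ess_counit a2 *\<^sub>C a1) (Delta (x \<otimes>\<^sub>C y)) = (\<Sum>b\<in>B n. inner_prod y b *\<^sub>C (x \<otimes>\<^sub>C b))"
    unfolding bext_Delta[OF bilinear_counit_right ess_PS[OF xy(1)] ess_PS[OF xy(2)]]
  proof (intro sum.cong refl)
    fix b assume b: "b \<in> B n"
    have "counit (b \<otimes>\<^sub>C y) = counit (y \<otimes>\<^sub>C b)" using xy b by (intro counit_symmetric) (auto intro: ess_FS B_FS)
    then show "ess_counit (b \<otimes>\<^sub>C y) *\<^sub>C (x \<otimes>\<^sub>C b) = inner_prod y b *\<^sub>C (x \<otimes>\<^sub>C b)"
      using xy b by (simp add: ess_counit_eq counit_tensor ess_FS B_FS B_cj)
  qed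
  also have "\<dots> = x \<otimes>\<^sub>C y"
    unfolding tensor_scale_right[symmetric] tensor_sum_right[symmetric] B_expand[OF xy(2)] ..
  finally show "bext (\<lambda>a1 a2. ess_counit a2 *\<^sub>C a1) (Delta (x \<otimes>\<^sub>C y)) = x \<otimes>\<^sub>C y" .
qed

section \<open>The antipode axioms\<close>

lemma Delta_antipode:
  assumes "a \<in> A"
  shows "Delta (ess_antipode \<mu> a) = sweedler A (\<lambda>a1 a2. ess_antipode \<mu> a2 \<otimes>\<^sub>C ess_antipode \<mu> a1) (Delta a)"
proof -
  let ?f = "\<lambda>a1 a2 :: 'v list \<times> 'v list \<Rightarrow> complex. ess_antipode \<mu> a2 \<otimes>\<^sub>C ess_antipode \<mu> a1"
  have f: "bilinear_FS ?f" by (rule bilinear_FSI; simp add: linear_simps)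
  show ?thesis
    unfolding sweedler_Delta[OF f refl assms]
  proof (rule A_eqI[OF linear_on_compose[OF linear_antipode lin_Delta] lin_bext_Delta assms])
    fix n x y assume "x \<in> E n" "y \<in> E n"
    then have P: "x \<in> PS n" "y \<in> PS n" and FS: "x \<in> FS" "y \<in> FS" by (auto intro: ess_PS ess_FS)
    let ?y = "rv (wdn y)" and ?x = "rv (wup x)"
    have "bext ?f (Delta (x \<otimes>\<^sub>C y)) = (\<Sum>b\<in>B n. (?y \<otimes>\<^sub>C rv (wup b)) \<otimes>\<^sub>C (rv (wdn b) \<otimes>\<^sub>C ?x))"
      unfolding bext_Delta[OF f P] using FS by (simp add: antipode_tensor B_FS)
    \<comment> \<open>The two weights on the middle element \<open>b\<close> are scalars with
      product 1.\<close>
    also have "\<dots> = (\<Sum>b\<in>B n. (?y \<otimes>\<^sub>C rv b) \<otimes>\<^sub>C (rv b \<otimes>\<^sub>C ?x))"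
    proof (intro sum.cong refl)
      fix b assume b: "b \<in> B n"
      obtain k l where "wdn b = k *\<^sub>C b" "wup b = l *\<^sub>C b" "k * l = 1" by (rule B_wgt[OF b])
      then show "(?y \<otimes>\<^sub>C rv (wup b)) \<otimes>\<^sub>C (rv (wdn b) \<otimes>\<^sub>C ?x) = (?y \<otimes>\<^sub>C rv b) \<otimes>\<^sub>C (rv b \<otimes>\<^sub>C ?x)"
        using B_FS[OF b] by (simp add: lin_scale[OF lin_rv] tensor_scale_left tensor_scale_right)
    qed
    also have "\<dots> = (\<Sum>b\<in>B n. (?y \<otimes>\<^sub>C b) \<otimes>\<^sub>C (b \<otimes>\<^sub>C ?x))"
      by (rule sum_ess_rv) (rule bilinear_FSI; simp add: linear_simps FS)
    also have "\<dots> = Delta (?y \<otimes>\<^sub>C ?x)"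
      using P by (simp add: Delta_tensor[of _ n] rv_PS wgt_PS)
    finally show "Delta (ess_antipode \<mu> (x \<otimes>\<^sub>C y)) = bext ?f (Delta (x \<otimes>\<^sub>C y))"
      using FS by (simp add: antipode_tensor)
  qed simp
qed

text \<open>With walks in place of the basis, the first factor is the nested creation applied to the
  vertices. Carried across, it becomes a nested annihilation on the second factor and leaves paths
  of length 0, on which \<open>PP\<close> is the identity.\<close>

lemma sum_antipode_mul:
  assumes x: "x \<in> E n" and y: "y \<in> E n"
  shows "(\<Sum>c\<in>B n. mul (ess_antipode \<mu> (x \<otimes>\<^sub>C c)) (c \<otimes>\<^sub>C y)) =
    (\<Sum>v\<in>pverts G. inner_prod (path_conc x (basis_vec [v])) (cj y) *\<^sub>C (vertex_sum \<otimes>\<^sub>C basis_vec [v]))"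
proof -
  have P: "x \<in> PS n" "y \<in> PS n" and FS: "x \<in> FS" "y \<in> FS" using x y by (auto intro: ess_PS ess_FS)
  have X: "rv (wup x) \<in> PS n" by (rule rv_PS[OF wgt_PS[OF P(1)]])
  let ?z = "path_conc (rv (wup x)) y"
  have z: "?z \<in> PS (n + n)" by (rule conc_PS[OF X P(2)])
  then have z': "?z \<in> PS (0 + 2 * length [0..<n])" by (simp add: mult_2)
  let ?Z = "annihs \<mu> [0..<n] ?z"
  have Z: "?Z \<in> PS 0" by (rule annihs_PS[OF z'])
  let ?h = "\<lambda>u v. PP (path_conc (rv (wdn u)) v \<otimes>\<^sub>C ?z)"
  have h: "bilinear_FS ?h" by (rule bilinear_FSI; simp add: linear_simps FS)
  have "(\<Sum>c\<in>B n. mul (ess_antipode \<mu> (x \<otimes>\<^sub>C c)) (c \<otimes>\<^sub>C y)) = (\<Sum>c\<in>B n. ?h c c)"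
    using FS by (simp add: antipode_tensor B_FS mul_tensor)
  also have "\<dots> = (\<Sum>p\<in>walks n. ?h (basis_vec p) (basis_vec p))"
  proof (rule sum_walks_eq_sum_ess[OF h, symmetric])
    fix k i u v assume n: "n = k + 2" and u: "u \<in> PS n" and v: "v \<in> PS k"
    have U: "rv (wdn u) \<in> PS n" by (rule rv_PS[OF wgt_PS[OF u]])
    have zk: "?z \<in> PS (n + k + 2)" using z n by simp
    \<comment> \<open>A creation in the second copy of \<open>c\<close> crosses over to an
      annihilation inside the essential path \<open>y\<close>.\<close>
    have "?h u (cre i v) = PP (path_conc (rv (wdn u)) v \<otimes>\<^sub>C ann (n + i) ?z)"
      using PP_cre_left[OF conc_PS[OF U v] zk, of "n + i"] by (simp add: cre_conc_right[OF U PS_FS[OF v]])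
    also have "ann (n + i) ?z = 0"
      using y FS by (simp add: ann_conc_right[OF X FS(2)] ess_ann lin_zero[OF conc_right])
    finally show "?h u (cre i v) = 0" by (simp add: lin_zero[OF lin_PP])
  qed
  also have "\<dots> = (\<Sum>p\<in>walks n. PP ((wt (hd p) (last p) *\<^sub>C basis_vec (rev p @ tl p)) \<otimes>\<^sub>C ?z))"
  proof (intro sum.cong refl)
    fix p assume "p \<in> walks n"
    then have "joinable (rev p) p" by (auto simp: joinable_def last_rev dest: walksD)
    then show "?h (basis_vec p) (basis_vec p) = PP ((wt (hd p) (last p) *\<^sub>C basis_vec (rev p @ tl p)) \<otimes>\<^sub>C ?z)"
      by (simp add: wgt_basis lin_scale[OF lin_rv] lin_scale[OF conc_left] conc_basis)
  qed
  \<comment> \<open>Nested creation starts from a single vertex, which is the common end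
    \<open>v\<close> of the walks \<open>p\<close>.\<close>
  also have "\<dots> = (\<Sum>v\<in>pverts G. \<Sum>p\<in>{p \<in> walks n. last p = v}. PP ((wt (hd p) (last p) *\<^sub>C basis_vec (rev p @ tl p)) \<otimes>\<^sub>C ?z))"
    by (rule sum.group[symmetric]) (auto simp: finite_verts dest: walks_ends)
  also have "\<dots> = (\<Sum>v\<in>pverts G. PP (basis_vec [v] \<otimes>\<^sub>C ?Z))"
  proof (intro sum.cong refl)
    fix v assume v: "v \<in> pverts G"
    have "(\<Sum>p\<in>{p \<in> walks n. last p = v}. PP ((wt (hd p) (last p) *\<^sub>C basis_vec (rev p @ tl p)) \<otimes>\<^sub>C ?z)) =
        PP (creates G \<mu> [0..<n] (basis_vec [v]) \<otimes>\<^sub>C ?z)"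
      using FS by (simp add: creates_nested[OF v] tensor_sum_left lin_sum[OF lin_PP])
    also have "\<dots> = PP (basis_vec [v] \<otimes>\<^sub>C ?Z)"
      using v by (intro invariant_creates_left[OF invariant_PP _ z']) (simp add: basis_PS walks_single)
    finally show "(\<Sum>p\<in>{p \<in> walks n. last p = v}. PP ((wt (hd p) (last p) *\<^sub>C basis_vec (rev p @ tl p)) \<otimes>\<^sub>C ?z)) =
        PP (basis_vec [v] \<otimes>\<^sub>C ?Z)" .
  qed
  also have "\<dots> = PP (vertex_sum \<otimes>\<^sub>C ?Z)"
    using PS_FS[OF Z] by (simp add: vertex_sum_def tensor_sum_left lin_sum[OF lin_PP])
  also have "\<dots> = vertex_sum \<otimes>\<^sub>C ?Z"
    using Z vertex_sum_ess by (intro PP_ess_tensor[of _ 0]) (simp_all add: ess_space_small)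
  also have "?Z = (\<Sum>v\<in>pverts G. ?Z [v] *\<^sub>C basis_vec [v])"
    by (subst PS_expand[OF Z]) (simp add: walks_0 sum.reindex inj_on_def)
  also have "\<dots> = (\<Sum>v\<in>pverts G. inner_prod (path_conc x (basis_vec [v])) (cj y) *\<^sub>C basis_vec [v])"
    by (intro sum.cong refl) (simp add: annihs_nested_apply[OF P])
  finally show ?thesis by (simp add: tensor_sum_right tensor_scale_right)
qed

text \<open>By \<open>sum_antipode_mul\<close> the inner sum collapses to one over vertices
  \<open>v\<close>. The outer sum over \<open>b\<close> then reassembles
  \<open>path_conc x (basis_vec [v])\<close>, which is the effect of multiplying by the second leg
  of the coproduct of the unit.\<close>

lemma antipode_axiom:
  assumes "a \<in> A"
  shows "sweedler A (\<lambda>x a3. sweedler A (\<lambda>a1 a2. ess_mult G \<mu> (ess_antipode \<mu> a1) a2 \<otimes>\<^sub>C a3) (Delta x)) (Delta a) =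
    sweedler A (\<lambda>u w. u \<otimes>\<^sub>C ess_mult G \<mu> a w) (Delta (ess_one G))"
proof -
  have aF: "a \<in> FS" using assms A_FS by blast
  note simps = linear_simps
    mul_simps
  let ?f = "\<lambda>a3 a1 a2. mul (ess_antipode \<mu> a1) a2 \<otimes>\<^sub>C a3"
  let ?F = "\<lambda>x a3. bext (?f a3) (Delta x)"
  let ?g = "\<lambda>a u w. u \<otimes>\<^sub>C mul a w"
  have f: "bilinear_FS (?f a3)" for a3 :: "'v list \<times> 'v list \<Rightarrow> complex" by (rule bilinear_FSI; simp add: simps)
  have F: "bilinear_FS ?F"
    unfolding bilinear_FS_def
    by (auto intro!: bext_param lin_bext_Delta bilinear_FS_right[OF bilinear_FS_tensor])
  have g: "bilinear_FS (?g a)" if "a \<in> FS" for a :: "'v list \<times> 'v list \<Rightarrow> complex" using that by (intro bilinear_FSI) (simp_all add: simps)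
  have "sweedler A (\<lambda>x a3. sweedler A (\<lambda>a1 a2. ess_mult G \<mu> (ess_antipode \<mu> a1) a2 \<otimes>\<^sub>C a3) (Delta x)) (Delta a) =
      bext ?F (Delta a)"
    by (rule sweedler_Delta[OF F _ assms], rule sweedler_Delta[OF f]) (simp_all add: ess_mult_eq antipode_closed)
  also have "\<dots> = bext (?g a) (Delta (ess_one G))"
  proof (rule A_eqI[OF lin_bext_Delta _ assms, of "\<lambda>a. bext (?g a) (Delta (ess_one G))"])
    show "linear_on FS (\<lambda>a. bext (?g a) (Delta (ess_one G)))"
      by (rule bext_param) (rule linear_onI; simp add: simps)
    fix n x y assume xy: "x \<in> E n" "y \<in> E n"
    then have P: "x \<in> PS n" "y \<in> PS n" and FS: "x \<in> FS" "y \<in> FS" by (auto intro: ess_PS ess_FS)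
    have "bext ?F (Delta (x \<otimes>\<^sub>C y)) = (\<Sum>b\<in>B n. \<Sum>c\<in>B n. ?f (b \<otimes>\<^sub>C y) (x \<otimes>\<^sub>C c) (c \<otimes>\<^sub>C b))"
      unfolding bext_Delta[OF F P] by (intro sum.cong refl bext_Delta[OF f P(1)] B_PS)
    also have "\<dots> = (\<Sum>b\<in>B n. (\<Sum>v\<in>pverts G. inner_prod (path_conc x (basis_vec [v])) b *\<^sub>C
        (vertex_sum \<otimes>\<^sub>C basis_vec [v])) \<otimes>\<^sub>C (b \<otimes>\<^sub>C y))"
      unfolding tensor_sum_left[symmetric]
      by (intro sum.cong refl) (simp add: sum_antipode_mul[OF xy(1) B_ess] B_cj)
    also have "\<dots> = (\<Sum>v\<in>pverts G. (vertex_sum \<otimes>\<^sub>C basis_vec [v]) \<otimes>\<^sub>C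
        ((\<Sum>b\<in>B n. inner_prod (path_conc x (basis_vec [v])) b *\<^sub>C b) \<otimes>\<^sub>C y))"
      by (simp add: tensor_sum_left tensor_sum_right tensor_scale_left tensor_scale_right sum.swap[of _ "pverts G"])
    also have "\<dots> = (\<Sum>v\<in>pverts G. ?g (x \<otimes>\<^sub>C y) (vertex_sum \<otimes>\<^sub>C basis_vec [v]) (basis_vec [v] \<otimes>\<^sub>C vertex_sum))"
    proof (intro sum.cong refl)
      fix v assume v: "v \<in> pverts G"
      then have "basis_vec [v] \<in> PS 0" by (simp add: basis_PS walks_single)
      then have C: "path_conc x (basis_vec [v]) \<in> PS n" using conc_PS[OF P(1)] by force
      \<comment> \<open>Appending a vertex shifts no positions, so the contractions act on
        \<open>x\<close> alone and the result is again essential; this permits its expansion in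
        \<open>B n\<close>.\<close>
      have "ann i (path_conc x (basis_vec [v])) = 0" for i
      proof (cases "i + 2 \<le> n")
        case True
        then obtain m where n: "n = m + 2" "i \<le> m" by (intro that[of "n - 2"]) auto
        then show ?thesis
          using ann_conc_left[of x m i "basis_vec [v]"] P xy by (simp add: ess_ann lin_zero[OF conc_left])
      next
        case False
        then show ?thesis using ann_PS_short[OF C] by simp
      qed
      then have "path_conc x (basis_vec [v]) \<in> E n" using C by (simp add: ess_space_iff)
      then show "(vertex_sum \<otimes>\<^sub>C basis_vec [v]) \<otimes>\<^sub>C ((\<Sum>b\<in>B n. inner_prod (path_conc x (basis_vec [v])) b *\<^sub>C b) \<otimes>\<^sub>C y) =
          ?g (x \<otimes>\<^sub>C y) (vertex_sum \<otimes>\<^sub>C basis_vec [v]) (basis_vec [v] \<otimes>\<^sub>C vertex_sum)"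
        using xy P by (simp add: B_expand mul_tensor conc_vertex_right PP_ess_tensor)
    qed
    also have "\<dots> = (\<Sum>e\<in>B 0. ?g (x \<otimes>\<^sub>C y) (vertex_sum \<otimes>\<^sub>C e) (e \<otimes>\<^sub>C vertex_sum))"
      by (rule sum_B0[of "\<lambda>u w. ?g (x \<otimes>\<^sub>C y) (vertex_sum \<otimes>\<^sub>C u) (w \<otimes>\<^sub>C vertex_sum)", symmetric])
        (rule bilinear_FSI; simp add: simps FS)
    also have "\<dots> = bext (?g (x \<otimes>\<^sub>C y)) (Delta (ess_one G))"
      using FS by (intro Delta_one[symmetric] g) simp
    finally show "bext ?F (Delta (x \<otimes>\<^sub>C y)) = bext (?g (x \<otimes>\<^sub>C y)) (Delta (ess_one G))" .
  qed
  also have "\<dots> = sweedler A (\<lambda>u w. u \<otimes>\<^sub>C ess_mult G \<mu> a w) (Delta (ess_one G))"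
    by (rule sweedler_Delta[OF g[OF aF] _ one_closed, symmetric]) (simp add: ess_mult_eq assms)
  finally show ?thesis .
qed

section \<open>Assembly of the axioms\<close>

lemma mult_linear: "b \<in> A \<Longrightarrow> linear_on A (\<lambda>a. ess_mult G \<mu> a b)" "a \<in> A \<Longrightarrow> linear_on A (\<lambda>b. ess_mult G \<mu> a b)"
proof -
  have AF: "a \<in> FS" if "a \<in> A" for a using that A_FS by blast
  note * = ess_mult_eq AF cfun.subspace_add[OF A_subspace] cfun.subspace_scale[OF A_subspace]
    mul_simps
  show "b \<in> A \<Longrightarrow> linear_on A (\<lambda>a. ess_mult G \<mu> a b)" "a \<in> A \<Longrightarrow> linear_on A (\<lambda>b. ess_mult G \<mu> a b)"
    by (rule linear_onI; simp add: *)+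
qed

lemma weak_star_hopf:
  "weak_star_hopf_algebra A (ess_mult G \<mu>) (ess_one G) ess_star Delta ess_counit (ess_antipode \<mu>)"
proof
  have AF: "a \<in> FS" if "a \<in> A" for a using that A_FS by blast
  have mc: "mul a b \<in> A" if "a \<in> A" "b \<in> A" for a b using that by (intro mul_closed AF)
  show "cfun.subspace A" by (rule A_subspace)
  show "ess_one G \<in> A" by (rule one_closed)
  show "linear_on A Delta" "linear_on A (ess_antipode \<mu>)"
    by (rule linear_on_subset[OF _ A_FS]; simp)+
  fix a b c k assume a: "a \<in> A"
  show "linear_on A (\<lambda>b. ess_mult G \<mu> b a)" "linear_on A (\<lambda>b. ess_mult G \<mu> a b)"
    by (rule mult_linear[OF a])+
  show "ess_mult G \<mu> (ess_one G) a = a" "ess_mult G \<mu> a (ess_one G) = a"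
    using a by (simp_all add: ess_mult_eq one_closed mul_one)
  show "ess_star a \<in> A" "ess_antipode \<mu> a \<in> A"
    using a by (auto intro: ess_star_A antipode_closed)
  show "ess_star (k *\<^sub>C a) = cnj k *\<^sub>C ess_star a" "ess_star (ess_star a) = a"
    by (simp_all add: ess_star_scale)
  show "Delta a \<in> tensor_square A" using a by (rule Delta_closed)
  show "Delta (ess_star a) = sweedler A (\<lambda>a1 a2. ess_star a1 \<otimes>\<^sub>C ess_star a2) (Delta a)"
    using a by (rule Delta_star)
  show "sweedler A (\<lambda>a1 a2. reassoc (Delta a1 \<otimes>\<^sub>C a2)) (Delta a) = sweedler A (\<lambda>a1 a2. a1 \<otimes>\<^sub>C Delta a2) (Delta a)"
    using a by (rule Delta_coassoc)
  show "ess_counit (k *\<^sub>C a) = k * ess_counit a"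
    using AF[OF a] by (simp add: ess_counit_eq lin_scale[OF lin_counit] pointwise)
  show "sweedler A (\<lambda>a1 a2. ess_counit a1 *\<^sub>C a2) (Delta a) = a" using a by (rule counit_left)
  show "sweedler A (\<lambda>a1 a2. ess_counit a2 *\<^sub>C a1) (Delta a) = a" using a by (rule counit_right)
  show "Im (ess_counit (ess_mult G \<mu> a (ess_star a))) = 0 \<and> Re (ess_counit (ess_mult G \<mu> a (ess_star a))) \<ge> 0"
    using counit_nonneg[OF a] a by (simp add: ess_counit_eq ess_mult_eq ess_star_A)
  show "ess_antipode \<mu> (ess_star (ess_antipode \<mu> (ess_star a))) = a" using a by (rule antipode_star)
  show "Delta (ess_antipode \<mu> a) = sweedler A (\<lambda>a1 a2. ess_antipode \<mu> a2 \<otimes>\<^sub>C ess_antipode \<mu> a1) (Delta a)"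
    using a by (rule Delta_antipode)
  show "sweedler A (\<lambda>x a3. sweedler A (\<lambda>a1 a2. ess_mult G \<mu> (ess_antipode \<mu> a1) a2 \<otimes>\<^sub>C a3) (Delta x)) (Delta a) =
      sweedler A (\<lambda>u w. u \<otimes>\<^sub>C ess_mult G \<mu> a w) (Delta (ess_one G))"
    using a by (rule antipode_axiom)
  assume b: "b \<in> A"
  show "ess_mult G \<mu> a b \<in> A" using a b by (simp add: ess_mult_eq mc)
  show "ess_star (a + b) = ess_star a + ess_star b" by (rule ess_star_add)
  show "ess_star (ess_mult G \<mu> a b) = ess_mult G \<mu> (ess_star b) (ess_star a)"
    using a b by (simp add: ess_mult_eq ess_star_A ess_star_mul)
  show "Delta (ess_mult G \<mu> a b) =
      sweedler A (\<lambda>a1 a2. sweedler A (\<lambda>b1 b2. ess_mult G \<mu> a1 b1 \<otimes>\<^sub>C ess_mult G \<mu> a2 b2) (Delta b)) (Delta a)"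
  proof -
    have "sweedler A (\<lambda>a1 a2. sweedler A (\<lambda>b1 b2. ess_mult G \<mu> a1 b1 \<otimes>\<^sub>C ess_mult G \<mu> a2 b2) (Delta b)) (Delta a) =
        bext (\<lambda>a1 a2. bext (\<lambda>b1 b2. mul a1 b1 \<otimes>\<^sub>C mul a2 b2) (Delta b)) (Delta a)"
      by (rule sweedler_Delta[OF bilinear_bext_mul _ a], rule sweedler_Delta[OF bilinear_mul_tensor _ b]) (simp_all add: AF ess_mult_eq)
    then show ?thesis using Delta_mul[OF a b] a b by (simp add: ess_mult_eq)
  qed
  show "ess_counit (a + b) = ess_counit a + ess_counit b"
    using AF[OF a] AF[OF b] by (simp add: ess_counit_eq lin_add[OF lin_counit] pointwise)
  show "ess_counit (ess_mult G \<mu> a b) =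
      sweedler A (\<lambda>u w. ess_counit (ess_mult G \<mu> a u) * ess_counit (ess_mult G \<mu> w b)) (Delta (ess_one G))"
    using a b by (rule counit_mult)
  show "ess_antipode \<mu> (ess_mult G \<mu> a b) = ess_mult G \<mu> (ess_antipode \<mu> b) (ess_antipode \<mu> a)"
    using a b by (simp add: ess_mult_eq antipode_closed antipode_mul)
  assume c: "c \<in> A"
  show "ess_mult G \<mu> (ess_mult G \<mu> a b) c = ess_mult G \<mu> a (ess_mult G \<mu> b c)"
    using a b c by (simp add: ess_mult_eq mc mul_assoc)
qed

end

theorem mainTheorem1:
  fixes G :: "'v pair_pre_digraph" and \<beta> :: real and \<mu> :: "'v \<Rightarrow> real"
    and B :: "nat \<Rightarrow> ('v list \<Rightarrow> complex) set"
  assumes "pair_graph G" and "connected (with_proj G)"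
    and "perron_frobenius G \<beta> \<mu>"
    and "\<And>n. ess_onb G \<mu> n (B n)"
  shows "weak_star_hopf_algebra (ess_algebra G \<mu>) (ess_mult G \<mu>) (ess_one G) ess_star
           (ess_coproduct B) ess_counit (ess_antipode \<mu>)"
proof -
  interpret ess_graph G \<beta> \<mu> B
    using assms by (simp add: ess_graph_def perron_graph_def ess_graph_axioms_def)
  show ?thesis by (rule weak_star_hopf)
qed

end
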